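(* Let $X\in L^1(\mathbb{P}_0)$, let $\phi_1,\phi_2\in\Phi_0$ be lower-semicontinuous, and let $r>0$. Define $$\rho^{l}_{\mathrm{oce},\mathbb{P}_0}(X)=\sup_{\{\mathbb{Q}:\mathbb{Q}\ll \mathbb{P}_0\}}\ \sup_{\{\bar{\mathbb{Q}}:\bar{\mathbb{Q}}\ll \mathbb{Q}\}}\mathbb{E}_{\bar{\mathbb{Q}}}[-X]-I_{\phi_1}(\bar{\mathbb{Q}},\mathbb{Q})- I_{\phi_2}(\mathbb{Q},\mathbb{P}_0),\qquad (P_l)$$ $$\rho^{s}_{\mathrm{oce},\mathbb{P}_0}(X)=\sup_{\{\mathbb{Q}:I_{\phi_2}(\mathbb{Q},\mathbb{P}_0)\leq r\}}\ \sup_{\{\bar{\mathbb{Q}}:\bar{\mathbb{Q}}\ll \mathbb{Q}\}}\mathbb{E}_{\bar{\mathbb{Q}}}[-X]-I_{\phi_1}(\bar{\mathbb{Q}},\mathbb{Q}).\qquad (P_s)$$ Then $$\rho^{l}_{\mathrm{oce},\mathbb{P}_0}(X)=\inf_{\theta_1,\theta_2\in \mathbb{R}}\Big\{-\theta_1-\theta_2+\mathbb{E}_{\mathbb{P}_0}\left[\phi_2^*(\phi_1^*(\theta_2-X)+\theta_1)\right]\Big\},\qquad (D_l)$$ $$\rho^{s}_{\mathrm{oce},\mathbb{P}_0}(X)=\inf_{\lambda\geq 0,\ \theta_1,\theta_2\in\mathbb{R}}\Big\{-\theta_1-\theta_2+\lambda r+\mathbb{E}_{\mathbb{P}_0}\left[\lambda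 \phi_2^*\left(\frac{\phi_1^*(\theta_2-X)+\theta_1}{\lambda}\right)\right]\Big\}.\qquad (D_s)$$ Furthermore, for $\boldsymbol{\theta}=(\theta_1,\theta_2)$ put $\beta^*(\omega,\boldsymbol{\theta})=\phi_2^*(\phi_1^*(\theta_2-X(\omega))+\theta_1)$ and $\tilde{\beta}^*(\omega,\boldsymbol{\theta},\lambda)=\lambda \phi_2^*\left(\frac{\phi_1^*(\theta_2-X(\omega))+\theta_1}{\lambda}\right)$, and suppose that: (1) $\phi_1^*$ and $\phi_2^*$ are differentiable on $\mathbb{R}$; (2) each of the sets $\mathcal{F}=\{\boldsymbol{\theta}\in \mathbb{R}^2 : \int_\Omega \beta^*(\omega,\boldsymbol{\theta})\,\mathrm{d}\mathbb{P}_0(\omega)<\infty\}$ and $\tilde{\mathcal{F}}=\{(\boldsymbol{\theta},\lambda)\in \mathbb{R}^2\times [0,\infty) : \int_\Omega \tilde{\beta}^*(\omega,\boldsymbol{\theta},\lambda)\,\mathrm{d}\mathbb{P}_0(\omega)<\infty\}$ has non-empty interior. Then there exist dual solutions $\boldsymbol{\theta}^*$ and $(\tilde{\boldsymbol{\theta}}^*,\lambda^* )$ attaining the minimum in $(D_l)$ and $(D_s)$ respectively. Moreover, if $\boldsymbol{\theta}^*\in \mathrm{int}(\mathcal{F})$ and $(\tilde{\boldsymbol{\theta}}^*,\lambda^* )\in \mathrm{int}(\tilde{\mathcal{F}})$, then the partial derivatives with respect to $\boldsymbol{\theta}$, namely $(\partial_{\theta_1}\beta^*(\omega,\boldsymbol{\theta}^*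 ),\partial_{\theta_2}\beta^*(\omega,\boldsymbol{\theta}^* ))$, respectively $(\partial_{\theta_1}\tilde\beta^*(\omega,\tilde{\boldsymbol{\theta}}^*,\lambda^* ),\partial_{\theta_2}\tilde\beta^*(\omega,\tilde{\boldsymbol{\theta}}^*,\lambda^* ))$, are the densities with respect to $\mathbb{P}_0$ of measures $(\mathbb{Q}^*,\bar{\mathbb{Q}}^* )$ that attain the maximum in $(P_l)$, respectively $(P_s)$.
   Context: $\mathbb{P}_0$ is a given (nominal) probability measure on a measurable space $(\Omega,\mathcal{F})$; $\mathbb{Q},\bar{\mathbb{Q}}$ range over probability measures. $\Phi_0$ is the set of all convex functions $\phi:\mathbb{R}\to[0,\infty]$ with $\phi(1)=0$ whose effective domain $\mathrm{dom}(\phi)=\{t:\phi(t)<\infty\}$ is contained in $[0,\infty)$ and contains a neighborhood of $1$. The $\phi$-divergence is $I_\phi(\mathbb{Q},\mathbb{P})=\int_\Omega\phi\left(\frac{\mathrm{d}\mathbb{Q}}{\mathrm{d}\mathbb{P}}\right)\mathrm{d}\mathbb{P}$ if $\mathbb{Q}\ll\mathbb{P}$, and $+\infty$ otherwise. Conventions: $\phi(0)=\lim_{t\downarrow0}\phi(t)$, $0\phi(0/0)=0$, $0\phi(a/0)=a\lim_{t\to\infty}\phi(t)/t$ for $a>0$. $\phi^*(s)=\sup_{t\in\mathbb{R}}\{st-\phi(t)\}$ is the convex conjugate. Convention for $\lambda=0$: $0\phi^*(s/0)=0$ if $s\le0$ and $+\infty$ if $s>0$.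
   Formalization: Attainment in (D_s) is shown with the λ=0 term taken as the limit sup over t in dom φ₂ of st, and with the stated convention only if (0,∞)⊆dom φ₂ (it can fail otherwise); where E[-X] and the penalty are both +∞, their difference is read as one integral of the combined integrand. *)

theory Defs
  imports "HOL-Probability.Probability"
begin

definition effdom :: "(real \<Rightarrow> ennreal) \<Rightarrow> real set" where
  "effdom \<phi> = {t. \<phi> t < \<infinity>}"

definition convex_ext :: "(real \<Rightarrow> ennreal) \<Rightarrow> bool" where
  "convex_ext \<phi> \<longleftrightarrow>
     (\<forall>x y u. 0 \<le> u \<and> u \<le> 1 \<longrightarrow>
        \<phi> ((1 - u) * x + u * y) \<le> ennreal (1 - u) * \<phi> x + ennreal u * \<phi> y)"

definition lower_semicont :: "(real \<Rightarrow> ennreal) \<Rightarrow> bool" where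
  "lower_semicont \<phi> \<longleftrightarrow> (\<forall>x. \<phi> x \<le> Liminf (at x) \<phi>)"

text \<open>For a lower-semicontinuous member of \<open>Phi0\<close> the convention that \<open>\<phi> 0\<close> is the limit of
  \<open>\<phi>\<close> at \<open>0\<close> from the right holds automatically.\<close>

definition Phi0 :: "(real \<Rightarrow> ennreal) set" where
  "Phi0 = {\<phi>. convex_ext \<phi> \<and> \<phi> 1 = 0 \<and> effdom \<phi> \<subseteq> {0..} \<and> 1 \<in> interior (effdom \<phi>)}"

definition phi_div :: "(real \<Rightarrow> ennreal) \<Rightarrow> 'a measure \<Rightarrow> 'a measure \<Rightarrow> ennreal" where
  "phi_div \<phi> Q P =
     (if absolutely_continuous P Q then \<integral>\<^sup>+\<omega>. \<phi> (enn2real (RN_deriv P Q \<omega>)) \<partial>P else \<infinity>)"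

definition prob_on :: "'a measure \<Rightarrow> 'a measure set" where
  "prob_on P = {Q. prob_space Q \<and> sets Q = sets P}"

text \<open>In \<open>ereal\<close>, \<open>\<infinity> - \<infinity> = \<infinity>\<close>. The subtraction below takes the value \<open>-\<infinity>\<close> there.\<close>

definition ediff :: "ereal \<Rightarrow> ereal \<Rightarrow> ereal" where
  "ediff a b = (if b = \<infinity> then -\<infinity> else a - b)"

definition eexpect :: "'a measure \<Rightarrow> ('a \<Rightarrow> ereal) \<Rightarrow> ereal" where
  "eexpect M f = ediff (enn2ereal (\<integral>\<^sup>+\<omega>. e2ennreal (f \<omega>) \<partial>M))
                       (enn2ereal (\<integral>\<^sup>+\<omega>. e2ennreal (- f \<omega>) \<partial>M))"

definition conjugate :: "(real \<Rightarrow> ennreal) \<Rightarrow> real \<Rightarrow> ereal" where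
  "conjugate \<phi> s = (SUP t. ereal (s * t) - enn2ereal (\<phi> t))"

text \<open>The inner conjugate may take the value \<open>\<infinity>\<close> (never \<open>-\<infinity>\<close>), where the outer one is \<open>\<infinity>\<close>.\<close>

definition conjugate_ext :: "(real \<Rightarrow> ennreal) \<Rightarrow> ereal \<Rightarrow> ereal" where
  "conjugate_ext \<phi> u = (if u = \<infinity> then \<infinity> else conjugate \<phi> (real_of_ereal u))"

definition conjugate_persp :: "(real \<Rightarrow> ennreal) \<Rightarrow> real \<Rightarrow> ereal \<Rightarrow> ereal" where
  "conjugate_persp \<phi> lam u =
     (if lam = 0 then (if u \<le> 0 then 0 else \<infinity>)
      else ereal lam * conjugate_ext \<phi> (u / ereal lam))"

definition conjugate_differentiable :: "(real \<Rightarrow> ennreal) \<Rightarrow> bool" where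
  "conjugate_differentiable \<phi> \<longleftrightarrow>
     (\<forall>s. \<bar>conjugate \<phi> s\<bar> \<noteq> \<infinity>) \<and>
     (\<lambda>s. real_of_ereal (conjugate \<phi> s)) differentiable_on UNIV"


text \<open>The primal objectives are the literal differences, with one convention: if both the expected
  value and the penalty are \<open>\<infinity>\<close>, the difference is read as the integral of the combined
  integrand. With \<open>z = dQ/dP0\<close> and \<open>y = dQ'/dQ\<close> this integrand is
  \<open>- X z y - z \<phi>1(y) - \<phi>2(z)\<close>, respectively \<open>- X y - \<phi>1(y)\<close> with respect to \<open>Q\<close>. The case
  cannot be read as \<open>-\<infinity>\<close>: if \<open>\<phi>1(t) = t ln t - t + 1\<close> and \<open>\<phi>2(t) = (t - 1)^2\<close> on \<open>[0,2]\<close>, and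
  \<open>exp(-X)\<close> is integrable but \<open>X exp(-X)\<close> is not, then the optimal densities given by the dual
  solution fall under it.\<close>

definition primal_l ::
  "'a measure \<Rightarrow> (real \<Rightarrow> ennreal) \<Rightarrow> (real \<Rightarrow> ennreal) \<Rightarrow> ('a \<Rightarrow> real) \<Rightarrow>
   'a measure \<Rightarrow> 'a measure \<Rightarrow> ereal" where
  "primal_l P0 \<phi>1 \<phi>2 X Q Q' =
     (let e = eexpect Q' (\<lambda>\<omega>. ereal (- X \<omega>));
          p = enn2ereal (phi_div \<phi>1 Q' Q) + enn2ereal (phi_div \<phi>2 Q P0)
      in if e = \<infinity> \<and> p = \<infinity>
         then eexpect P0 (\<lambda>\<omega>.
                let z = enn2real (RN_deriv P0 Q \<omega>); y = enn2real (RN_deriv Q Q' \<omega>)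
                in ereal (- X \<omega> * (z * y)) - ereal z * enn2ereal (\<phi>1 y) - enn2ereal (\<phi>2 z))
         else ediff e p)"

definition primal_s ::
  "(real \<Rightarrow> ennreal) \<Rightarrow> ('a \<Rightarrow> real) \<Rightarrow> 'a measure \<Rightarrow> 'a measure \<Rightarrow> ereal" where
  "primal_s \<phi>1 X Q Q' =
     (let e = eexpect Q' (\<lambda>\<omega>. ereal (- X \<omega>));
          p = enn2ereal (phi_div \<phi>1 Q' Q)
      in if e = \<infinity> \<and> p = \<infinity>
         then eexpect Q (\<lambda>\<omega>.
                let y = enn2real (RN_deriv Q Q' \<omega>)
                in ereal (- X \<omega> * y) - enn2ereal (\<phi>1 y))
         else ediff e p)"

definition feasible_l :: "'a measure \<Rightarrow> 'a measure set" where
  "feasible_l P0 = {Q \<in> prob_on P0. absolutely_continuous P0 Q}"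

definition feasible_s :: "'a measure \<Rightarrow> (real \<Rightarrow> ennreal) \<Rightarrow> real \<Rightarrow> 'a measure set" where
  "feasible_s P0 \<phi>2 r = {Q \<in> prob_on P0. phi_div \<phi>2 Q P0 \<le> ennreal r}"

definition rho_l ::
  "'a measure \<Rightarrow> (real \<Rightarrow> ennreal) \<Rightarrow> (real \<Rightarrow> ennreal) \<Rightarrow> ('a \<Rightarrow> real) \<Rightarrow> ereal" where
  "rho_l P0 \<phi>1 \<phi>2 X =
     (SUP Q \<in> feasible_l P0. SUP Q' \<in> feasible_l Q. primal_l P0 \<phi>1 \<phi>2 X Q Q')"

definition rho_s ::
  "'a measure \<Rightarrow> (real \<Rightarrow> ennreal) \<Rightarrow> (real \<Rightarrow> ennreal) \<Rightarrow> real \<Rightarrow> ('a \<Rightarrow> real) \<Rightarrow> ereal" where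
  "rho_s P0 \<phi>1 \<phi>2 r X =
     (SUP Q \<in> feasible_s P0 \<phi>2 r. SUP Q' \<in> feasible_l Q. primal_s \<phi>1 X Q Q')"


definition beta_l ::
  "(real \<Rightarrow> ennreal) \<Rightarrow> (real \<Rightarrow> ennreal) \<Rightarrow> ('a \<Rightarrow> real) \<Rightarrow> 'a \<Rightarrow> real \<times> real \<Rightarrow> ereal" where
  "beta_l \<phi>1 \<phi>2 X \<omega> = (\<lambda>(\<theta>1, \<theta>2).
     conjugate_ext \<phi>2 (conjugate \<phi>1 (\<theta>2 - X \<omega>) + ereal \<theta>1))"

definition beta_s ::
  "(real \<Rightarrow> ennreal) \<Rightarrow> (real \<Rightarrow> ennreal) \<Rightarrow> ('a \<Rightarrow> real) \<Rightarrow> 'a \<Rightarrow> (real \<times> real) \<times> real \<Rightarrow> ereal" where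
  "beta_s \<phi>1 \<phi>2 X \<omega> = (\<lambda>((\<theta>1, \<theta>2), lam).
     conjugate_persp \<phi>2 lam (conjugate \<phi>1 (\<theta>2 - X \<omega>) + ereal \<theta>1))"

definition dual_l ::
  "'a measure \<Rightarrow> (real \<Rightarrow> ennreal) \<Rightarrow> (real \<Rightarrow> ennreal) \<Rightarrow> ('a \<Rightarrow> real) \<Rightarrow> real \<times> real \<Rightarrow> ereal" where
  "dual_l P0 \<phi>1 \<phi>2 X = (\<lambda>(\<theta>1, \<theta>2).
     ereal (- \<theta>1 - \<theta>2) + eexpect P0 (\<lambda>\<omega>. beta_l \<phi>1 \<phi>2 X \<omega> (\<theta>1, \<theta>2)))"

definition dual_s ::
  "'a measure \<Rightarrow> (real \<Rightarrow> ennreal) \<Rightarrow> (real \<Rightarrow> ennreal) \<Rightarrow> real \<Rightarrow> ('a \<Rightarrow> real) \<Rightarrow>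
   (real \<times> real) \<times> real \<Rightarrow> ereal" where
  "dual_s P0 \<phi>1 \<phi>2 r X = (\<lambda>((\<theta>1, \<theta>2), lam).
     ereal (- \<theta>1 - \<theta>2 + lam * r) + eexpect P0 (\<lambda>\<omega>. beta_s \<phi>1 \<phi>2 X \<omega> ((\<theta>1, \<theta>2), lam)))"

definition finite_l ::
  "'a measure \<Rightarrow> (real \<Rightarrow> ennreal) \<Rightarrow> (real \<Rightarrow> ennreal) \<Rightarrow> ('a \<Rightarrow> real) \<Rightarrow> (real \<times> real) set" where
  "finite_l P0 \<phi>1 \<phi>2 X = {\<theta>. eexpect P0 (\<lambda>\<omega>. beta_l \<phi>1 \<phi>2 X \<omega> \<theta>) < \<infinity>}"

definition finite_s ::
  "'a measure \<Rightarrow> (real \<Rightarrow> ennreal) \<Rightarrow> (real \<Rightarrow> ennreal) \<Rightarrow> ('a \<Rightarrow> real) \<Rightarrow>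
   ((real \<times> real) \<times> real) set" where
  "finite_s P0 \<phi>1 \<phi>2 X =
     {(\<theta>, lam). 0 \<le> lam \<and> eexpect P0 (\<lambda>\<omega>. beta_s \<phi>1 \<phi>2 X \<omega> (\<theta>, lam)) < \<infinity>}"

text \<open>The limit of \<open>lam \<phi>\<^sup>*(u/lam)\<close> for \<open>lam\<close> tending to \<open>0\<close> from the right is the supremum of \<open>u t\<close>
  over the effective domain of \<open>\<phi>\<close>. It agrees with the convention in \<open>conjugate_persp\<close> if and
  only if that domain contains \<open>{0<..}\<close>. Otherwise \<open>dual_s\<close> is too large at \<open>lam = 0\<close>, which
  leaves its infimum unchanged but can destroy attainment. Example: \<open>\<phi>1 = \<phi>2 = \<phi>\<close> with
  \<open>\<phi>(t) = (t - 1)^2\<close> on \<open>[1/2, 3/2]\<close>, \<open>r = 1\<close>, and \<open>X = 4, -4\<close> with probability \<open>1/2\<close> each.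
  Since \<open>\<phi> \<le> 1/4\<close> on its domain, halving \<open>lam > 0\<close> lowers \<open>dual_s\<close> by at least \<open>3/8 lam\<close>, so no
  minimizer has \<open>lam > 0\<close>; at \<open>lam = 0\<close> all values are at least \<open>4\<close>, while the value at
  \<open>\<theta>1 = -23/4\<close>, \<open>\<theta>2 = 0\<close>, \<open>lam = 1/10\<close> is below \<open>4\<close>. Existence for arbitrary \<open>\<phi>2\<close> is
  therefore stated with \<open>dual_s_closed\<close>, which differs from \<open>dual_s\<close> only at \<open>lam = 0\<close>.\<close>

definition beta_s_closed ::
  "(real \<Rightarrow> ennreal) \<Rightarrow> (real \<Rightarrow> ennreal) \<Rightarrow> ('a \<Rightarrow> real) \<Rightarrow> 'a \<Rightarrow> (real \<times> real) \<times> real \<Rightarrow> ereal" where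
  "beta_s_closed \<phi>1 \<phi>2 X \<omega> = (\<lambda>((\<theta>1, \<theta>2), lam).
     if lam = 0 then (SUP t \<in> effdom \<phi>2. (conjugate \<phi>1 (\<theta>2 - X \<omega>) + ereal \<theta>1) * ereal t)
     else beta_s \<phi>1 \<phi>2 X \<omega> ((\<theta>1, \<theta>2), lam))"

definition dual_s_closed ::
  "'a measure \<Rightarrow> (real \<Rightarrow> ennreal) \<Rightarrow> (real \<Rightarrow> ennreal) \<Rightarrow> real \<Rightarrow> ('a \<Rightarrow> real) \<Rightarrow>
   (real \<times> real) \<times> real \<Rightarrow> ereal" where
  "dual_s_closed P0 \<phi>1 \<phi>2 r X = (\<lambda>((\<theta>1, \<theta>2), lam).
     ereal (- \<theta>1 - \<theta>2 + lam * r) + eexpect P0 (\<lambda>\<omega>. beta_s_closed \<phi>1 \<phi>2 X \<omega> ((\<theta>1, \<theta>2), lam)))"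

definition is_density :: "'a measure \<Rightarrow> 'a measure \<Rightarrow> ('a \<Rightarrow> real) \<Rightarrow> bool" where
  "is_density P Q z \<longleftrightarrow>
     z \<in> borel_measurable P \<and> (\<forall>\<omega>\<in>space P. 0 \<le> z \<omega>) \<and> Q = density P (\<lambda>\<omega>. ennreal (z \<omega>))"

end

theory Submission
  imports Defs
begin

text \<open>With \<open>z = dQ/dP0\<close>, \<open>y = dQ'/dQ\<close> and \<open>w = z y\<close>, both primal problems maximize a concave functional
  of \<open>(z, w)\<close> under the linear constraints \<open>E z = E w = 1\<close> and, in \<open>(P_s)\<close>, the convex constraint
  \<open>E \<phi>2(z) \<le> r\<close>. The constant pairs near \<open>(1, 1)\<close> are a Slater condition, so the finite-dimensional
  value function has a supergradient at the constraint levels; its entries are \<open>\<theta>1, \<theta>2\<close> and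
  \<open>- lam\<close>. The resulting Lagrangian is maximized pointwise: the conjugates are suprema over countably
  many rational points, finitely many of them can be selected by simple functions, and monotone
  convergence interchanges supremum and expectation. This gives strong duality together with a dual
  solution, without the smoothness assumptions.

  At an interior dual solution the first order conditions in \<open>\<theta>1\<close>, \<open>\<theta>2\<close> and \<open>lam\<close> may be taken under
  the expectation by convexity, and read \<open>E z = 1\<close>, \<open>E w = 1\<close> and \<open>E \<phi>2(z) = r\<close> for the partial
  derivatives \<open>z, w\<close>. Equality in the Fenchel-Young inequality then makes \<open>(z, w)\<close> attain the dual value.\<close>

section \<open>Expectations in the extended reals\<close>

text \<open>Densities are recorded as \<open>(z, y)\<close> because the pointwise problem factors in
  these coordinates: the supremum over \<open>y\<close> gives the inner conjugate, that over
  \<open>z\<close> the outer one. Concavity is visible only in \<open>(z, w)\<close>, so convex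
  combinations go through \<open>w = z y\<close> and back, which requires \<open>z > 0\<close>. The
  obstacle is integrability: for general densities the expected value and the penalties may be
  infinite. The lower bound is therefore carried out with simple \<open>(z, y)\<close> alone, whose
  integrals are all finite; general densities occur only in weak duality and at the explicit
  optimizer. The multiplier of the penalty constraint may come out as 0. There the supremum of the
  Lagrangian is \<open>B 0\<close> and not the convention of \<open>conjugate_persp\<close>, so
  duality is proved for \<open>B\<close> and the literal dual is compared with it afterwards. An
  interior point of \<open>finite_s\<close> cannot have \<open>lam = 0\<close>, so division by
  \<open>lam\<close> is harmless for the optimal densities.\<close>

lemma eexpect_cong_AE:
  assumes "AE \<omega> in M. f \<omega> = g \<omega>"
  shows "eexpect M f = eexpect M g"
proof -
  have "(\<integral>\<^sup>+\<omega>. e2ennreal (f \<omega>) \<partial>M) = (\<integral>\<^sup>+\<omega>. e2ennreal (g \<omega>) \<partial>M)"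
    "(\<integral>\<^sup>+\<omega>. e2ennreal (- f \<omega>) \<partial>M) = (\<integral>\<^sup>+\<omega>. e2ennreal (- g \<omega>) \<partial>M)"
    using assms by (auto intro!: nn_integral_cong_AE)
  then show ?thesis by (simp add: eexpect_def)
qed

lemma eexpect_mono_AE:
  assumes "AE \<omega> in M. f \<omega> \<le> g \<omega>"
  shows "eexpect M f \<le> eexpect M g"
proof -
  have 1: "(\<integral>\<^sup>+\<omega>. e2ennreal (f \<omega>) \<partial>M) \<le> (\<integral>\<^sup>+\<omega>. e2ennreal (g \<omega>) \<partial>M)"
    using assms by (auto intro!: nn_integral_mono_AE e2ennreal_mono)
  have 2: "(\<integral>\<^sup>+\<omega>. e2ennreal (- g \<omega>) \<partial>M) \<le> (\<integral>\<^sup>+\<omega>. e2ennreal (- f \<omega>) \<partial>M)"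
    using assms by (auto intro!: nn_integral_mono_AE e2ennreal_mono)
  show ?thesis
  \<comment> \<open>An infinite negative part of \<open>f\<close> makes the left side -\<infinity>
    by \<open>ediff\<close>; otherwise that of \<open>g\<close> is finite too and both differences
    are ordinary.\<close>
  proof (cases "(\<integral>\<^sup>+\<omega>. e2ennreal (- f \<omega>) \<partial>M) = \<infinity>")
    case True
    then show ?thesis by (simp add: eexpect_def ediff_def)
  next
    case False
    then have "(\<integral>\<^sup>+\<omega>. e2ennreal (- g \<omega>) \<partial>M) \<noteq> \<infinity>" using 2 by (auto simp: top_unique)
    then show ?thesis using False 1 2
      by (auto simp: eexpect_def ediff_def enn2ereal_eq_top_iff
          simp flip: less_eq_ennreal.rep_eq intro!: ereal_minus_mono)
  qed
qed

lemma eexpect_real: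
  fixes g :: "'a \<Rightarrow> real"
  assumes "integrable M g"
  shows "eexpect M (\<lambda>\<omega>. ereal (g \<omega>)) = ereal (\<integral>\<omega>. g \<omega> \<partial>M)"
proof -
  have e: "e2ennreal (ereal (g \<omega>)) = ennreal (g \<omega>)" "e2ennreal (- ereal (g \<omega>)) = ennreal (- g \<omega>)" for \<omega>
    by simp_all
  from real_lebesgue_integral_def[OF assms]
  have L: "(\<integral>\<omega>. g \<omega> \<partial>M) = enn2real (\<integral>\<^sup>+\<omega>. g \<omega> \<partial>M) - enn2real (\<integral>\<^sup>+\<omega>. - g \<omega> \<partial>M)" .
  have f: "(\<integral>\<^sup>+\<omega>. g \<omega> \<partial>M) < \<infinity>" "(\<integral>\<^sup>+\<omega>. - g \<omega> \<partial>M) < \<infinity>"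
    using assms by (auto simp: real_integrable_def less_top)
  then obtain a b where ab: "(\<integral>\<^sup>+\<omega>. g \<omega> \<partial>M) = ennreal a" "(\<integral>\<^sup>+\<omega>. - g \<omega> \<partial>M) = ennreal b" "a \<ge> 0" "b \<ge> 0"
    by (metis ennreal_cases infinity_ennreal_def less_irrefl)
  show ?thesis unfolding eexpect_def e L ab ediff_def using ab(3,4) by (simp add: enn2ereal_ennreal)
qed

text \<open>Positive and negative parts are not additive, and either part of \<open>f\<close> may
  have infinite integral. So an identity between parts without any subtraction is integrated first,
  and the subtraction is performed only once the negative parts are known to be finite together or
  infinite together.\<close>

lemma eexpect_add_integrable:
  fixes g :: "'a \<Rightarrow> real"
  assumes [measurable]: "f \<in> borel_measurable M" and g: "integrable M g"
  shows "eexpect M (\<lambda>\<omega>. f \<omega> + ereal (g \<omega>)) = eexpect M f + ereal (\<integral>\<omega>. g \<omega> \<partial>M)"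
proof -
  have [measurable]: "g \<in> borel_measurable M" using g by auto
  define A where "A = (\<integral>\<^sup>+\<omega>. e2ennreal (f \<omega> + ereal (g \<omega>)) \<partial>M)"
  define B where "B = (\<integral>\<^sup>+\<omega>. e2ennreal (- (f \<omega> + ereal (g \<omega>))) \<partial>M)"
  define C where "C = (\<integral>\<^sup>+\<omega>. e2ennreal (f \<omega>) \<partial>M)"
  define D where "D = (\<integral>\<^sup>+\<omega>. e2ennreal (- f \<omega>) \<partial>M)"
  have f: "(\<integral>\<^sup>+\<omega>. g \<omega> \<partial>M) < \<infinity>" "(\<integral>\<^sup>+\<omega>. - g \<omega> \<partial>M) < \<infinity>"
    using g by (auto simp: real_integrable_def less_top)
  then obtain a b where ab: "(\<integral>\<^sup>+\<omega>. g \<omega> \<partial>M) = ennreal a" "(\<integral>\<^sup>+\<omega>. - g \<omega> \<partial>M) = ennreal b" "a \<ge> 0" "b \<ge> 0"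
    by (metis ennreal_cases infinity_ennreal_def less_irrefl)
  have I: "(\<integral>\<omega>. g \<omega> \<partial>M) = a - b"
    unfolding real_lebesgue_integral_def[OF g] using ab by simp
  \<comment> \<open>With x+ and x- for the parts of x, \<open>pt\<close> says (u+v)+ + u- + v- =
    (u+v)- + u+ + v+. By \<open>pt2\<close> and \<open>pt3\<close> the negative parts of u and u+v
    bound each other up to the parts of v, whose integrals are finite.\<close>
  have pt: "e2ennreal (u + ereal v) + e2ennreal (- u) + ennreal (- v)
      = e2ennreal (- (u + ereal v)) + e2ennreal u + ennreal v"
    and pt2: "e2ennreal (- u) \<le> e2ennreal (- (u + ereal v)) + ennreal v"
    and pt3: "e2ennreal (- (u + ereal v)) \<le> e2ennreal (- u) + ennreal (- v)" for u v
    by (cases u; cases "u \<ge> 0"; cases "v \<ge> 0"; cases "u + v \<ge> 0";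
        simp add: e2ennreal_ereal e2ennreal_neg ennreal_neg flip: ennreal_plus;
        (subst ennreal_plus[symmetric])?; simp?; linarith?)+
  have "(\<integral>\<^sup>+\<omega>. e2ennreal (f \<omega> + ereal (g \<omega>)) + e2ennreal (- f \<omega>) + ennreal (- g \<omega>) \<partial>M)
      = (\<integral>\<^sup>+\<omega>. e2ennreal (- (f \<omega> + ereal (g \<omega>))) + e2ennreal (f \<omega>) + ennreal (g \<omega>) \<partial>M)"
    by (simp only: pt)
  then have eq: "A + D + ennreal b = B + C + ennreal a"
    by (simp add: nn_integral_add A_def B_def C_def D_def ab)
  have "D \<le> (\<integral>\<^sup>+\<omega>. e2ennreal (- (f \<omega> + ereal (g \<omega>))) + ennreal (g \<omega>) \<partial>M)"
    unfolding D_def by (intro nn_integral_mono pt2)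
  also have "\<dots> = B + ennreal a"
    by (simp add: nn_integral_add B_def ab)
  finally have DB: "D \<le> B + ennreal a" .
  have "B \<le> (\<integral>\<^sup>+\<omega>. e2ennreal (- f \<omega>) + ennreal (- g \<omega>) \<partial>M)"
    unfolding B_def by (intro nn_integral_mono pt3)
  also have "\<dots> = D + ennreal b"
    by (simp add: nn_integral_add D_def ab)
  finally have BD: "B \<le> D + ennreal b" .
  have L: "eexpect M (\<lambda>\<omega>. f \<omega> + ereal (g \<omega>)) = ediff (enn2ereal A) (enn2ereal B)"
    "eexpect M f = ediff (enn2ereal C) (enn2ereal D)"
    by (simp_all add: eexpect_def A_def B_def C_def D_def)
  show ?thesis
  proof (cases "D = \<infinity>")
    case True
    with DB have "B = \<infinity>" by (simp add: top_unique)
    then show ?thesis using True by (simp add: L ediff_def)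
  next
    case False
    then obtain d where d: "D = ennreal d" "0 \<le> d" by (cases D) auto
    with BD have "B < \<infinity>" by (metis ennreal_less_top ennreal_plus ab(4) infinity_ennreal_def le_less_trans)
    then obtain b' where b': "B = ennreal b'" "0 \<le> b'" by (cases B) auto
    show ?thesis
    proof (cases "C = \<infinity>")
      case True
      then have "A = \<infinity>" using eq d ab by (simp flip: ennreal_plus)
      then show ?thesis using True d b' by (simp add: L ediff_def)
    next
      case False
      then obtain c where c: "C = ennreal c" "0 \<le> c" by (cases C) auto
      have "A \<noteq> \<infinity>" using eq c b' ab by (auto simp flip: ennreal_plus)
      then obtain a' where a': "A = ennreal a'" "0 \<le> a'" by (cases A) auto
      have "a' + d + b = b' + c + a" using eq a' b' c d ab by (simp flip: ennreal_plus)
      then show ?thesis using a' b' c d ab by (simp add: L ediff_def I)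
    qed
  qed
qed

text \<open>Identifies the literal difference in the primal objectives with the expectation of the
  combined integrand. The excluded case is exactly the one in which those objectives are defined by
  the combined integrand.\<close>

lemma eexpect_diff_penalty:
  fixes g :: "'a \<Rightarrow> real" and p :: "'a \<Rightarrow> ennreal"
  assumes [measurable]: "g \<in> borel_measurable M" "p \<in> borel_measurable M"
    and ninf: "\<not> (eexpect M (\<lambda>\<omega>. ereal (g \<omega>)) = \<infinity> \<and> (\<integral>\<^sup>+\<omega>. p \<omega> \<partial>M) = \<infinity>)"
  shows "eexpect M (\<lambda>\<omega>. ereal (g \<omega>) - enn2ereal (p \<omega>))
    = ediff (eexpect M (\<lambda>\<omega>. ereal (g \<omega>))) (enn2ereal (\<integral>\<^sup>+\<omega>. p \<omega> \<partial>M))"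
proof (cases "(\<integral>\<^sup>+\<omega>. p \<omega> \<partial>M) = \<infinity>")
  case False
  have ae: "AE \<omega> in M. p \<omega> \<noteq> \<infinity>"
    by (rule nn_integral_noteq_infinite) (use False in auto)
  define q where "q = (\<lambda>\<omega>. enn2real (p \<omega>))"
  have qp: "AE \<omega> in M. p \<omega> = ennreal (q \<omega>)" using ae by eventually_elim (simp add: q_def less_top)
  have [measurable]: "q \<in> borel_measurable M" by (simp add: q_def)
  have q0: "q \<omega> \<ge> 0" for \<omega> by (simp add: q_def)
  have pint: "(\<integral>\<^sup>+\<omega>. p \<omega> \<partial>M) = (\<integral>\<^sup>+\<omega>. ennreal (q \<omega>) \<partial>M)" using qp by (rule nn_integral_cong_AE)
  have qi: "integrable M q"
    by (rule integrableI_nonneg) (use q0 False pint in \<open>auto simp: less_top\<close>)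
  have "eexpect M (\<lambda>\<omega>. ereal (g \<omega>) - enn2ereal (p \<omega>)) = eexpect M (\<lambda>\<omega>. ereal (g \<omega>) + ereal (- q \<omega>))"
    by (rule eexpect_cong_AE) (use qp in eventually_elim, simp add: q0)
  also have "\<dots> = eexpect M (\<lambda>\<omega>. ereal (g \<omega>)) + ereal (\<integral>\<omega>. - q \<omega> \<partial>M)"
    by (rule eexpect_add_integrable) (use qi in auto)
  also have "\<dots> = ediff (eexpect M (\<lambda>\<omega>. ereal (g \<omega>))) (enn2ereal (\<integral>\<^sup>+\<omega>. p \<omega> \<partial>M))"
    unfolding pint nn_integral_eq_integral[OF qi AE_I2[OF q0]]
    using q0 by (simp add: ediff_def minus_ereal_def)
  finally show ?thesis .
next
  case True
  define P N where "P = (\<integral>\<^sup>+\<omega>. ennreal (g \<omega>) \<partial>M)" and "N = (\<integral>\<^sup>+\<omega>. ennreal (- g \<omega>) \<partial>M)"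
  define B where "B = (\<integral>\<^sup>+\<omega>. e2ennreal (- (ereal (g \<omega>) - enn2ereal (p \<omega>))) \<partial>M)"
  have e: "eexpect M (\<lambda>\<omega>. ereal (g \<omega>)) = ediff (enn2ereal P) (enn2ereal N)"
    by (simp add: eexpect_def P_def N_def)
  have pt1: "ennreal (- u) \<le> e2ennreal (- (ereal u - enn2ereal v))"
    and pt2: "v \<le> e2ennreal (- (ereal u - enn2ereal v)) + ennreal u" for u v
    by (cases v; cases "u \<ge> 0"; cases "enn2real v - u \<ge> 0";
       simp add: ennreal_neg flip: ennreal_plus; (subst ennreal_plus[symmetric])?; simp add: ennreal_leI)+
  \<comment> \<open>Either the negative part of \<open>g\<close> already diverges, or the positive
    part of \<open>g\<close> has a finite integral and cannot compensate \<open>p\<close>.\<close>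
  have "B = \<infinity>"
  proof (cases "N = \<infinity>")
    case True
    have "N \<le> B" unfolding N_def B_def by (intro nn_integral_mono pt1)
    then show ?thesis using True by (simp add: top_unique)
  next
    case False
    have "P \<noteq> \<infinity>"
    proof
      assume "P = \<infinity>"
      then have "eexpect M (\<lambda>\<omega>. ereal (g \<omega>)) = \<infinity>" using False by (cases N) (auto simp: e ediff_def)
      then show False using ninf True by simp
    qed
    have "(\<integral>\<^sup>+\<omega>. p \<omega> \<partial>M) \<le> (\<integral>\<^sup>+\<omega>. e2ennreal (- (ereal (g \<omega>) - enn2ereal (p \<omega>))) + ennreal (g \<omega>) \<partial>M)"
      by (intro nn_integral_mono pt2)
    also have "\<dots> = B + P" by (simp add: nn_integral_add B_def P_def)
    finally show ?thesis using True \<open>P \<noteq> \<infinity>\<close> by (simp add: top_unique)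
  qed
  then show ?thesis using True by (simp add: eexpect_def B_def ediff_def)
qed

lemma eexpect_density:
  fixes z :: "'a \<Rightarrow> real"
  assumes [measurable]: "z \<in> borel_measurable M" "f \<in> borel_measurable M"
    and z: "AE \<omega> in M. 0 \<le> z \<omega>"
  shows "eexpect (density M (\<lambda>\<omega>. ennreal (z \<omega>))) f = eexpect M (\<lambda>\<omega>. ereal (z \<omega>) * f \<omega>)"
proof -
  \<comment> \<open>The case \<open>a = 0\<close> relies on 0 * \<infinity> = 0 in both
    \<open>ennreal\<close> and \<open>ereal\<close>.\<close>
  have m: "ennreal a * e2ennreal u = e2ennreal (ereal a * u)" if "0 \<le> a" for a u
    using that by (cases u; cases "a = 0"; cases "u \<ge> 0")
      (auto simp: ennreal_neg ennreal_mult' e2ennreal_neg ennreal_mult_top mult_le_0_iff)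
  have m2: "ennreal a * e2ennreal (- u) = e2ennreal (- (ereal a * u))" if "0 \<le> a" for a u
    using m[OF that, of "- u"] by simp
  have "(\<integral>\<^sup>+\<omega>. ennreal (z \<omega>) * e2ennreal (f \<omega>) \<partial>M) = (\<integral>\<^sup>+\<omega>. e2ennreal (ereal (z \<omega>) * f \<omega>) \<partial>M)"
    "(\<integral>\<^sup>+\<omega>. ennreal (z \<omega>) * e2ennreal (- f \<omega>) \<partial>M) = (\<integral>\<^sup>+\<omega>. e2ennreal (- (ereal (z \<omega>) * f \<omega>)) \<partial>M)"
    by (intro nn_integral_cong_AE; use z in eventually_elim; simp only: m m2 ereal_mult_minus_right)+
  then show ?thesis by (simp add: eexpect_def nn_integral_density)
qed

lemma integrable_of_eexpect_finite:
  fixes g :: "'a \<Rightarrow> real"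
  assumes "g \<in> borel_measurable M" "eexpect M (\<lambda>\<omega>. ereal (g \<omega>)) \<noteq> - \<infinity>" "eexpect M (\<lambda>\<omega>. ereal (g \<omega>)) < \<infinity>"
  shows "integrable M g"
proof -
  have e: "eexpect M (\<lambda>\<omega>. ereal (g \<omega>)) = ediff (enn2ereal (\<integral>\<^sup>+\<omega>. ennreal (g \<omega>) \<partial>M)) (enn2ereal (\<integral>\<^sup>+\<omega>. ennreal (- g \<omega>) \<partial>M))"
    by (simp add: eexpect_def)
  then have N: "(\<integral>\<^sup>+\<omega>. ennreal (- g \<omega>) \<partial>M) \<noteq> \<infinity>" using assms(2) by (auto simp: ediff_def)
  then have "(\<integral>\<^sup>+\<omega>. ennreal (g \<omega>) \<partial>M) \<noteq> \<infinity>" using assms(3) e by (auto simp: ediff_def)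
  with N assms(1) show ?thesis by (simp add: real_integrable_def)
qed

text \<open>The running maximum over an enumeration of \<open>C\<close> is attained by a choice of
  index with finitely many values, hence by a simple function. Each stage is bounded by
  \<open>V\<close>, and monotone convergence carries the bound to the supremum.\<close>

lemma eexpect_SUP_le_of_simple_selectors:
  fixes \<Psi> :: "'b \<Rightarrow> 'a \<Rightarrow> real"
  assumes C: "countable C" "b0 \<in> C" and int: "\<And>b. b \<in> C \<Longrightarrow> integrable M (\<Psi> b)"
    and bound: "\<And>s. simple_function M s \<Longrightarrow> (\<And>\<omega>. s \<omega> \<in> C) \<Longrightarrow> integrable M (\<lambda>\<omega>. \<Psi> (s \<omega>) \<omega>)
      \<Longrightarrow> (\<integral>\<omega>. \<Psi> (s \<omega>) \<omega> \<partial>M) \<le> V"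
  shows "eexpect M (\<lambda>\<omega>. SUP b\<in>C. ereal (\<Psi> b \<omega>)) \<le> ereal V"
proof -
  define e where "e = from_nat_into C"
  have eC: "e n \<in> C" for n using C by (auto simp: e_def intro!: from_nat_into)
  \<comment> \<open>\<open>sel n\<close> selects a maximizer among \<open>b0\<close> and the first
    \<open>n\<close> enumerated indices; ties keep the older index, and \<open>b0\<close> supplies
    an integrable start.\<close>
  define sel where "sel = rec_nat (\<lambda>\<omega>. b0) (\<lambda>n s \<omega>. if \<Psi> (s \<omega>) \<omega> < \<Psi> (e n) \<omega> then e n else s \<omega>)"
  have sel0: "sel 0 = (\<lambda>\<omega>. b0)"
    and selS: "sel (Suc n) = (\<lambda>\<omega>. if \<Psi> (sel n \<omega>) \<omega> < \<Psi> (e n) \<omega> then e n else sel n \<omega>)" for n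
    unfolding sel_def by simp_all
  define g where "g = (\<lambda>n \<omega>. \<Psi> (sel n \<omega>) \<omega>)"
  have gS: "g (Suc n) = (\<lambda>\<omega>. max (g n \<omega>) (\<Psi> (e n) \<omega>))" for n
    by (auto simp: g_def selS max_def)
  have selC: "sel n \<omega> \<in> C" for n \<omega>
    by (induction n) (auto simp: sel0 selS C eC)
  have gint: "integrable M (g n)" for n
  proof (induction n)
    case 0
    then show ?case using int[OF C(2)] by (simp add: g_def sel0)
  next
    case (Suc n)
    then show ?case using int[OF eC[of n]] by (simp add: gS)
  qed
  note [measurable] = borel_measurable_integrable[OF gint]
  have ssel: "simple_function M (sel n)" for n
  proof (induction n)
    case (Suc n)
    have [measurable]: "\<Psi> (e n) \<in> borel_measurable M" using int[OF eC] by auto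
    have "{\<omega> \<in> space M. g n \<omega> < \<Psi> (e n) \<omega>} \<in> sets M" by measurable
    then show ?case unfolding selS using Suc
      by (intro simple_function_If) (auto simp: g_def)
  qed (simp add: sel0)
  have gV: "(\<integral>\<omega>. g n \<omega> \<partial>M) \<le> V" for n
    unfolding g_def by (rule bound) (use ssel selC gint in \<open>auto simp: g_def\<close>)
  have ginc: "incseq (\<lambda>n. g n \<omega>)" for \<omega> by (rule incseq_SucI) (simp add: gS)
  \<comment> \<open>Subtracting the integrable first stage makes the sequence nonnegative, as
    monotone convergence in \<open>ennreal\<close> requires.\<close>
  define d where "d = (\<lambda>n \<omega>. g n \<omega> - g 0 \<omega>)"
  have dint: "integrable M (d n)" for n unfolding d_def using gint by auto
  note [measurable] = borel_measurable_integrable[OF dint]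
  have dinc: "incseq (\<lambda>n. d n \<omega>)" for \<omega> using ginc by (auto simp: d_def incseq_def)
  have d0: "0 \<le> d n \<omega>" for n \<omega> using ginc[of \<omega>] by (auto simp: d_def incseq_def)
  have "(SUP b\<in>C. ereal (\<Psi> b \<omega>)) = (SUP n. ereal (d n \<omega>)) + ereal (g 0 \<omega>)" for \<omega>
  proof -
    have "(SUP b\<in>C. ereal (\<Psi> b \<omega>)) = (SUP n. ereal (g n \<omega>))"
    proof (rule antisym)
      show "(SUP b\<in>C. ereal (\<Psi> b \<omega>)) \<le> (SUP n. ereal (g n \<omega>))"
      proof (rule SUP_least)
        fix b assume "b \<in> C"
        then obtain n where "b = e n" using C(1) by (metis e_def from_nat_into_surj)
        then show "ereal (\<Psi> b \<omega>) \<le> (SUP n. ereal (g n \<omega>))"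
          by (intro SUP_upper2[of "Suc n"]) (auto simp: gS)
      qed
      show "(SUP n. ereal (g n \<omega>)) \<le> (SUP b\<in>C. ereal (\<Psi> b \<omega>))"
        by (rule SUP_mono) (use selC in \<open>auto simp: g_def\<close>)
    qed
    also have "\<dots> = (SUP n. ereal (d n \<omega>) + ereal (g 0 \<omega>))" by (simp add: d_def)
    also have "\<dots> = (SUP n. ereal (d n \<omega>)) + ereal (g 0 \<omega>)"
      by (rule SUP_ereal_add_left) auto
    finally show ?thesis .
  qed
  then have "eexpect M (\<lambda>\<omega>. SUP b\<in>C. ereal (\<Psi> b \<omega>)) = eexpect M (\<lambda>\<omega>. SUP n. ereal (d n \<omega>)) + ereal (\<integral>\<omega>. g 0 \<omega> \<partial>M)"
    by (simp add: eexpect_add_integrable gint)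
  also have "eexpect M (\<lambda>\<omega>. SUP n. ereal (d n \<omega>)) \<le> ereal (V - (\<integral>\<omega>. g 0 \<omega> \<partial>M))"
  proof -
    have e: "e2ennreal (SUP n. ereal (d n \<omega>)) = (SUP n. ennreal (d n \<omega>))" for \<omega>
      using sup_continuousD[OF sup_continuous_e2ennreal[OF sup_continuous_id], of "\<lambda>n. ereal (d n \<omega>)"] dinc[of \<omega>]
      by (simp add: incseq_def)
    have "(\<integral>\<^sup>+\<omega>. (SUP n. ennreal (d n \<omega>)) \<partial>M) = (SUP n. \<integral>\<^sup>+\<omega>. ennreal (d n \<omega>) \<partial>M)"
      by (rule nn_integral_monotone_convergence_SUP) (use dinc in \<open>auto simp: incseq_def le_fun_def ennreal_leI\<close>)
    also have "\<dots> \<le> ennreal (V - (\<integral>\<omega>. g 0 \<omega> \<partial>M))"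
    proof (rule SUP_least)
      fix n
      have "(\<integral>\<^sup>+\<omega>. ennreal (d n \<omega>) \<partial>M) = ennreal (\<integral>\<omega>. d n \<omega> \<partial>M)"
        by (rule nn_integral_eq_integral[OF dint]) (simp add: d0)
      also have "\<dots> \<le> ennreal (V - (\<integral>\<omega>. g 0 \<omega> \<partial>M))"
        unfolding d_def using gV[of n] gint by (simp add: ennreal_leI)
      finally show "(\<integral>\<^sup>+\<omega>. ennreal (d n \<omega>) \<partial>M) \<le> ennreal (V - (\<integral>\<omega>. g 0 \<omega> \<partial>M))" .
    qed
    finally have 1: "enn2ereal (\<integral>\<^sup>+\<omega>. e2ennreal (SUP n. ereal (d n \<omega>)) \<partial>M) \<le> ereal (V - (\<integral>\<omega>. g 0 \<omega> \<partial>M))"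
      using gV[of 0] unfolding e by (metis diff_ge_0_iff_ge enn2ereal_ennreal less_eq_ennreal.rep_eq)
    have "e2ennreal (- (SUP n. ereal (d n \<omega>))) = 0" for \<omega>
      by (rule e2ennreal_neg) (use d0[of 0 \<omega>] in \<open>auto intro!: SUP_upper2[of 0]\<close>)
    then show ?thesis using 1 by (simp add: eexpect_def ediff_def zero_ennreal.rep_eq)
  qed
  finally show ?thesis by (simp add: add_right_mono)
qed

section \<open>Convex analysis\<close>

text \<open>Separate \<open>A\<close> from the open vertical ray above \<open>(x0, V)\<close>. The
  separating normal cannot be horizontal since \<open>x0\<close> is interior to the projection, so
  dividing by its last component gives the slope \<open>\<alpha>\<close>.\<close>

lemma concave_hypograph_supergradient:
  fixes A :: "('b::euclidean_space \<times> real) set"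
  assumes conv: "convex A" and x0: "x0 \<in> interior (fst ` A)"
    and V: "\<And>c. (x0, c) \<in> A \<Longrightarrow> c \<le> V"
  obtains \<alpha> where "\<And>x c. (x, c) \<in> A \<Longrightarrow> c + \<alpha> \<bullet> x \<le> V + \<alpha> \<bullet> x0"
proof -
  define B where "B = {x0} \<times> {V<..}"
  have "convex B" "B \<noteq> {}" unfolding B_def by (auto intro!: convex_Times simp: gt_ex)
  moreover have "A \<noteq> {}" using x0 interior_subset by fastforce
  moreover have "A \<inter> B = {}" using V by (force simp: B_def)
  ultimately obtain a b where a0: "a \<noteq> 0" and aA: "\<And>x. x \<in> A \<Longrightarrow> a \<bullet> x \<le> b"
    and aB: "\<And>x. x \<in> B \<Longrightarrow> b \<le> a \<bullet> x"
    using separating_hyperplane_sets[OF conv] by metis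
  obtain a1 g where ag: "a = (a1, g)" by (cases a)
  have A: "a1 \<bullet> x + g * c \<le> b" if "(x, c) \<in> A" for x c
    using aA[OF that] by (simp add: ag)
  have B: "b \<le> a1 \<bullet> x0 + g * c" if "V < c" for c
    using aB[of "(x0, c)"] that by (simp add: ag B_def)
  obtain c0 where c0: "(x0, c0) \<in> A" using x0 interior_subset by fastforce
  have g0: "0 \<le> g"
  proof -
    \<comment> \<open>A height above both \<open>V\<close> and the point \<open>c0\<close> of
      \<open>A\<close> over \<open>x0\<close>: comparing the two separation inequalities there
      forces the sign of \<open>g\<close>.\<close>
    define C where "C = max V c0 + 1"
    have C: "V < C" "c0 < C" by (auto simp: C_def)
    have "0 \<le> g * (C - c0)" using A[OF c0] B[OF C(1)] by (simp add: algebra_simps)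
    then show ?thesis using C(2) by (simp add: zero_le_mult_iff)
  qed
  have "g \<noteq> 0"
  proof
    assume "g = 0"
    obtain e where e: "e > 0" "cball x0 e \<subseteq> fst ` A" using x0 by (auto simp: mem_interior_cball)
    have a1: "a1 \<noteq> 0" using a0 ag \<open>g = 0\<close> by (auto simp: zero_prod_def)
    \<comment> \<open>If \<open>g = 0\<close>, the functional \<open>a1\<close> would be maximal
      over the projection at \<open>x0\<close>; a step of length \<open>e\<close> in its own
      direction stays in the projection and increases it.\<close>
    have "x0 + (e / norm a1) *\<^sub>R a1 \<in> cball x0 e" using a1 e by (simp add: dist_norm)
    with e obtain c where "(x0 + (e / norm a1) *\<^sub>R a1, c) \<in> A" by force
    from A[OF this] B[of "V + 1"] have "(e / norm a1) * (a1 \<bullet> a1) \<le> 0"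
      by (simp add: \<open>g = 0\<close> inner_add_right)
    moreover have "(e / norm a1) * (a1 \<bullet> a1) > 0" using a1 e by simp
    ultimately show False by simp
  qed
  with g0 have g: "g > 0" by simp
  have "c + (a1 /\<^sub>R g) \<bullet> x \<le> V + (a1 /\<^sub>R g) \<bullet> x0" if "(x, c) \<in> A" for x c
  \<comment> \<open>The ray starts strictly above \<open>V\<close>, so the height \<open>V\<close>
    is reached only up to \<open>e\<close>.\<close>
  proof (rule field_le_epsilon)
    fix e :: real assume "0 < e"
    then have "a1 \<bullet> x + g * c \<le> a1 \<bullet> x0 + g * (V + e)" using A[OF that] B[of "V + e"] by simp
    then have "c + (a1 \<bullet> x) / g \<le> V + (a1 \<bullet> x0) / g + e"
      using divide_right_mono[of _ _ g] g by (fastforce simp: add_divide_distrib)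
    then show "c + (a1 /\<^sub>R g) \<bullet> x \<le> V + (a1 /\<^sub>R g) \<bullet> x0 + e"
      by (simp add: divide_inverse mult.commute)
  qed
  then show ?thesis by (rule that)
qed

text \<open>Yields convexity of the dual integrand in each multiplier separately; the affine
  functions are the Lagrangian at fixed points.\<close>

lemma convex_on_SUP_affine:
  fixes b :: "real \<Rightarrow> real"
  assumes "convex S" and b: "\<And>\<tau>. \<tau> \<in> S \<Longrightarrow> ereal (b \<tau>) = (SUP i\<in>I. ereal (p i + q i * \<tau>))"
  shows "convex_on S b"
proof (rule convex_onI)
  fix t x y :: real assume t: "0 < t" "t < 1" and x: "x \<in> S" and y: "y \<in> S"
  let ?m = "(1 - t) * x + t * y"
  have m: "?m \<in> S" using convexD[OF assms(1) x y, of "1 - t" t] t by simp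
  have *: "p i + q i * \<tau> \<le> b \<tau>" if "i \<in> I" "\<tau> \<in> S" for i \<tau>
  proof -
    have "ereal (p i + q i * \<tau>) \<le> (SUP i\<in>I. ereal (p i + q i * \<tau>))"
      using that(1) by (rule SUP_upper)
    then show ?thesis by (simp flip: b[OF that(2)])
  qed
  have "ereal (b ?m) \<le> ereal ((1 - t) * b x + t * b y)"
    unfolding b[OF m]
  proof (rule SUP_least)
    fix i assume i: "i \<in> I"
    have "p i + q i * ?m = (1 - t) * (p i + q i * x) + t * (p i + q i * y)" by (simp add: algebra_simps)
    also have "\<dots> \<le> (1 - t) * b x + t * b y"
      using t *[OF i x] *[OF i y] by (intro add_mono mult_left_mono) auto
    finally show "ereal (p i + q i * ?m) \<le> ereal ((1 - t) * b x + t * b y)" by simp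
  qed
  then show "b ((1 - t) *\<^sub>R x + t *\<^sub>R y) \<le> (1 - t) * b x + t * b y" by simp
qed (rule assms(1))

text \<open>The difference quotients of a convex function at \<open>t0\<close> are squeezed between those at distance
  \<open>\<epsilon>\<close>, so they converge in the mean to the derivative.\<close>

lemma integral_deriv_convex_minimizer:
  fixes f :: "'a \<Rightarrow> real \<Rightarrow> real"
  assumes e: "0 < \<epsilon>"
    and int: "\<And>\<tau>. \<bar>\<tau> - t0\<bar> \<le> \<epsilon> \<Longrightarrow> integrable M (\<lambda>\<omega>. f \<omega> \<tau>)"
    and conv: "\<And>\<omega>. \<omega> \<in> space M \<Longrightarrow> convex_on {t0 - \<epsilon>..t0 + \<epsilon>} (f \<omega>)"
    and der: "\<And>\<omega>. \<omega> \<in> space M \<Longrightarrow> (f \<omega> has_real_derivative z \<omega>) (at t0)"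
    and min: "\<And>\<tau>. \<bar>\<tau> - t0\<bar> \<le> \<epsilon> \<Longrightarrow> (\<integral>\<omega>. f \<omega> t0 \<partial>M) - c * t0 \<le> (\<integral>\<omega>. f \<omega> \<tau> \<partial>M) - c * \<tau>"
  shows "integrable M z" and "(\<integral>\<omega>. z \<omega> \<partial>M) = c"
proof -
  define q where "q = (\<lambda>h \<omega>. (f \<omega> (t0 + h) - f \<omega> t0) / h)"
  define h where "h = (\<lambda>n::nat. \<epsilon> / (real n + 1))"
  have h: "0 < h n" "h n \<le> \<epsilon>" for n using e by (auto simp: h_def field_simps)
  have "h = (\<lambda>n. \<epsilon> * inverse (real (Suc n)))" by (auto simp: h_def divide_inverse)
  then have h0: "h \<longlonglongrightarrow> 0"
    using tendsto_mult_right_zero[OF LIMSEQ_inverse_real_of_nat, of \<epsilon>] by simp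
  have it0: "integrable M (\<lambda>\<omega>. f \<omega> t0)" using int[of t0] e by simp
  have qi: "integrable M (q d)" if "\<bar>d\<bar> \<le> \<epsilon>" for d
    unfolding q_def using that int[of "t0 + d"] it0 by auto
  have qI: "(\<integral>\<omega>. q d \<omega> \<partial>M) = ((\<integral>\<omega>. f \<omega> (t0 + d) \<partial>M) - (\<integral>\<omega>. f \<omega> t0 \<partial>M)) / d" if "\<bar>d\<bar> \<le> \<epsilon>" for d
    unfolding q_def using that int[of "t0 + d"] it0 by simp
  have lim: "(\<lambda>n. q (s * h n) \<omega>) \<longlonglongrightarrow> z \<omega>" if "\<omega> \<in> space M" "s \<noteq> 0" for s \<omega>
  proof -
    have q: "((\<lambda>d. q d \<omega>) \<longlongrightarrow> z \<omega>) (at 0)" using der[OF that(1)] by (simp add: DERIV_def q_def)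
    have "(\<lambda>n. s * h n) \<longlonglongrightarrow> 0" using tendsto_mult_right_zero[OF h0] by simp
    moreover have "s * h n \<noteq> 0" for n using h(1)[of n] that(2) by simp
    ultimately have "filterlim (\<lambda>n. s * h n) (at 0) sequentially"
      by (simp add: filterlim_at)
    from filterlim_compose[OF q this] show ?thesis .
  qed
  \<comment> \<open>The weight \<open>d/\<epsilon>\<close> writes \<open>t0 + d\<close> and
    \<open>t0 - d\<close> as convex combinations of \<open>t0\<close> and the endpoints; the third
    inequality is midpoint convexity at \<open>t0\<close>.\<close>
  have up: "q d \<omega> \<le> q \<epsilon> \<omega>" "q (-\<epsilon>) \<omega> \<le> q (-d) \<omega>" "q (-d) \<omega> \<le> q d \<omega>"
    if "\<omega> \<in> space M" "0 < d" "d \<le> \<epsilon>" for \<omega> d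
  proof -
    have e1: "(1 - d/\<epsilon>) *\<^sub>R t0 + (d/\<epsilon>) *\<^sub>R (t0 + \<epsilon>) = t0 + d"
      and e2: "(1 - d/\<epsilon>) *\<^sub>R t0 + (d/\<epsilon>) *\<^sub>R (t0 - \<epsilon>) = t0 - d"
      using e by (simp_all add: field_simps)
    note c = convex_onD[OF conv[OF that(1)]]
    have "f \<omega> ((1 - d/\<epsilon>) *\<^sub>R t0 + (d/\<epsilon>) *\<^sub>R (t0 + \<epsilon>)) \<le> (1 - d/\<epsilon>) * f \<omega> t0 + d/\<epsilon> * f \<omega> (t0 + \<epsilon>)"
      by (rule c) (use that e in auto)
    then have "f \<omega> (t0 + d) \<le> (1 - d/\<epsilon>) * f \<omega> t0 + d/\<epsilon> * f \<omega> (t0 + \<epsilon>)"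
      by (simp only: e1)
    then show "q d \<omega> \<le> q \<epsilon> \<omega>" using that e by (simp add: q_def field_simps)
    have "f \<omega> ((1 - d/\<epsilon>) *\<^sub>R t0 + (d/\<epsilon>) *\<^sub>R (t0 - \<epsilon>)) \<le> (1 - d/\<epsilon>) * f \<omega> t0 + d/\<epsilon> * f \<omega> (t0 - \<epsilon>)"
      by (rule c) (use that e in auto)
    then have "f \<omega> (t0 - d) \<le> (1 - d/\<epsilon>) * f \<omega> t0 + d/\<epsilon> * f \<omega> (t0 - \<epsilon>)"
      by (simp only: e2)
    then show "q (-\<epsilon>) \<omega> \<le> q (-d) \<omega>" using that e by (simp add: q_def field_simps)
    have "f \<omega> ((1 - 1/2) *\<^sub>R (t0 - d) + (1/2) *\<^sub>R (t0 + d)) \<le> (1 - 1/2) * f \<omega> (t0 - d) + 1/2 * f \<omega> (t0 + d)"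
      by (rule c) (use that e in auto)
    then have "2 * f \<omega> t0 \<le> f \<omega> (t0 - d) + f \<omega> (t0 + d)" by (simp add: field_simps)
    then have "(f \<omega> t0 - f \<omega> (t0 - d)) / d \<le> (f \<omega> (t0 + d) - f \<omega> t0) / d"
      using that by (intro divide_right_mono) auto
    then show "q (-d) \<omega> \<le> q d \<omega>" by (simp add: q_def minus_divide_left)
  qed
  have bound: "norm (q (s * h n) \<omega>) \<le> \<bar>q \<epsilon> \<omega>\<bar> + \<bar>q (-\<epsilon>) \<omega>\<bar>"
    if "\<omega> \<in> space M" "s = 1 \<or> s = -1" for n s \<omega>
    using up[OF that(1) h[of n]] up[OF that(1) e order_refl] that(2) by (auto simp: abs_if)
  have wi: "integrable M (\<lambda>\<omega>. \<bar>q \<epsilon> \<omega>\<bar> + \<bar>q (-\<epsilon>) \<omega>\<bar>)" using qi[of \<epsilon>] qi[of "-\<epsilon>"] e by auto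
  have zm: "z \<in> borel_measurable M"
    by (rule borel_measurable_LIMSEQ_real[of _ "\<lambda>n. q (1 * h n)"])
      (use lim[of _ 1] qi[of "h n" for n] h in \<open>auto simp: abs_of_pos\<close>)
  \<comment> \<open>The sign \<open>s\<close> picks the right or the left difference quotients. Both
    converge to the same derivative, and minimality bounds the integrals of the former from below
    and of the latter from above by \<open>c\<close>.\<close>
  have dct: "integrable M z" "(\<lambda>n. \<integral>\<omega>. q (s * h n) \<omega> \<partial>M) \<longlonglongrightarrow> (\<integral>\<omega>. z \<omega> \<partial>M)" if "s = 1 \<or> s = -1" for s
  proof -
    have m: "q (s * h n) \<in> borel_measurable M" for n
      using qi[of "s * h n"] h[of n] that by (auto simp: abs_mult abs_of_pos)
    have l: "AE \<omega> in M. (\<lambda>n. q (s * h n) \<omega>) \<longlonglongrightarrow> z \<omega>" by (intro AE_I2 lim) (use that in auto)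
    have b: "AE \<omega> in M. norm (q (s * h n) \<omega>) \<le> \<bar>q \<epsilon> \<omega>\<bar> + \<bar>q (-\<epsilon>) \<omega>\<bar>" for n
      by (intro AE_I2 bound that)
    show "integrable M z" by (rule integrable_dominated_convergence[OF zm m wi l b])
    show "(\<lambda>n. \<integral>\<omega>. q (s * h n) \<omega> \<partial>M) \<longlonglongrightarrow> (\<integral>\<omega>. z \<omega> \<partial>M)"
      by (rule integral_dominated_convergence[OF zm m wi l b])
  qed
  show "integrable M z" using dct(1)[of 1] by simp
  have "c \<le> (\<integral>\<omega>. q (1 * h n) \<omega> \<partial>M)" for n
    using min[of "t0 + h n"] h[of n] by (simp add: qI abs_of_pos field_simps)
  then have "c \<le> (\<integral>\<omega>. z \<omega> \<partial>M)" using LIMSEQ_le_const[OF dct(2)[of 1]] by auto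
  moreover have "(\<integral>\<omega>. q (-1 * h n) \<omega> \<partial>M) \<le> c" for n
    using min[of "t0 - h n"] h[of n] by (simp add: qI abs_of_pos field_simps)
  then have "(\<integral>\<omega>. z \<omega> \<partial>M) \<le> c" using LIMSEQ_le_const2[OF dct(2)[of "-1"]] by auto
  ultimately show "(\<integral>\<omega>. z \<omega> \<partial>M) = c" by simp
qed

section \<open>Divergence functions and their conjugates\<close>

locale divergence_function =
  fixes \<phi> :: "real \<Rightarrow> ennreal"
  assumes Phi0: "\<phi> \<in> Phi0" and lsc: "lower_semicont \<phi>"
begin

definition D :: "real set" where "D = effdom \<phi>"
text \<open>Outside \<open>D\<close> this takes the default value
  \<open>enn2real \<infinity> = 0\<close>, so it represents \<phi> only together with membership in
  \<open>D\<close>.\<close>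

definition f :: "real \<Rightarrow> real" where "f t = enn2real (\<phi> t)"
text \<open>Countable, and inside the interior, where \<open>f\<close> is continuous and all points
  are positive. Boundary points of \<open>D\<close>, including a possible 0, are recovered by
  \<open>C_approximates\<close>.\<close>

definition C :: "real set" where "C = interior D \<inter> \<rat>"

lemma phi_eq: "t \<in> D \<Longrightarrow> \<phi> t = ennreal (f t)"
  by (simp add: D_def effdom_def f_def)

lemma phi_notin: "t \<notin> D \<Longrightarrow> \<phi> t = \<infinity>"
  by (simp add: D_def effdom_def less_top[symmetric])

lemma f_nonneg: "0 \<le> f t"
  by (simp add: f_def)

lemma f_1 [simp]: "f 1 = 0"
  using Phi0 by (simp add: f_def Phi0_def)

lemma one_interior: "1 \<in> interior D"
  using Phi0 by (simp add: D_def Phi0_def)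

lemma one_D: "1 \<in> D"
  using one_interior interior_subset by blast

lemma one_C: "1 \<in> C"
  using one_interior by (simp add: C_def)

lemma D_nonneg: "t \<in> D \<Longrightarrow> 0 \<le> t"
  using Phi0 by (auto simp: D_def Phi0_def)

lemma C_subset_D: "C \<subseteq> D"
  using interior_subset by (auto simp: C_def)

lemma interior_D_pos: "t \<in> interior D \<Longrightarrow> 0 < t"
proof -
  have "interior D \<subseteq> interior {0..}" by (intro interior_mono) (auto dest: D_nonneg)
  then show "t \<in> interior D \<Longrightarrow> 0 < t" by (auto simp: interior_real_atLeast)
qed

lemma countable_C: "countable C"
  unfolding C_def by (intro countable_Int2 countable_rat)

lemma convex_combination:
  assumes "x \<in> D" "y \<in> D" "0 \<le> u" "u \<le> 1"
  shows "(1 - u) * x + u * y \<in> D \<and> f ((1 - u) * x + u * y) \<le> (1 - u) * f x + u * f y"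
proof -
  have "\<phi> ((1 - u) * x + u * y) \<le> ennreal (1 - u) * \<phi> x + ennreal u * \<phi> y"
    using Phi0 assms(3,4) by (auto simp: Phi0_def convex_ext_def)
  also have "\<dots> = ennreal ((1 - u) * f x + u * f y)"
    using assms by (simp add: phi_eq f_nonneg ennreal_mult)
  finally have *: "\<phi> ((1 - u) * x + u * y) \<le> ennreal ((1 - u) * f x + u * f y)" .
  then have "(1 - u) * x + u * y \<in> D"
    unfolding D_def effdom_def by (auto intro: le_less_trans)
  moreover have "0 \<le> (1 - u) * f x + u * f y" using assms f_nonneg by simp
  ultimately show ?thesis
    using * by (simp add: phi_eq del: ennreal_plus)
qed

lemma convex_D: "convex D"
proof (rule convexI)
  fix x y u v :: real assume "x \<in> D" "y \<in> D" "0 \<le> u" "0 \<le> v" "u + v = 1"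
  then show "u *\<^sub>R x + v *\<^sub>R y \<in> D" using convex_combination[of x y v] by (simp add: eq_diff_eq[symmetric])
qed

lemma convex_on_f: "convex_on D f"
  by (rule convex_onI) (use convex_combination convex_D in auto)

lemma continuous_on_f: "continuous_on (interior D) f"
  by (intro convex_on_continuous convex_on_subset[OF convex_on_f]) (auto simp: interior_subset convex_D)

text \<open>Moving \<open>t\<close> slightly towards the interior point 1 reaches the interior
  without raising \<open>f\<close>, as \<open>f 1 = 0\<close> is its minimum; continuity there
  permits a further move to a rational point. An upper bound on \<open>f\<close> suffices since
  \<open>f\<close> enters the suprema with a negative sign.\<close>

lemma C_approximates:
  assumes t: "t \<in> D" and e: "0 < e"
  obtains c where "c \<in> C" "\<bar>c - t\<bar> < e" "f c < f t + e"
proof -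
  \<comment> \<open>The bound 1/2 keeps \<open>u < 1\<close>; the other one limits the shift
    \<open>u * \<bar>1 - t\<bar>\<close> to \<open>e / 2\<close>, and the added 1 avoids division by
    0 at \<open>t = 1\<close>.\<close>
  define u where "u = min (1/2) (e / (2 * (\<bar>1 - t\<bar> + 1)))"
  have u: "0 < u" "u < 1" "u * (\<bar>1 - t\<bar> + 1) \<le> e / 2"
  proof -
    define k where "k = \<bar>1 - t\<bar> + 1"
    have "0 < k" by (simp add: k_def)
    have "u * (\<bar>1 - t\<bar> + 1) \<le> (e / (2 * (\<bar>1 - t\<bar> + 1))) * (\<bar>1 - t\<bar> + 1)"
      by (intro mult_right_mono) (auto simp: u_def)
    also have "\<dots> = e / 2" using \<open>0 < k\<close> by (simp flip: k_def)
    finally show "u * (\<bar>1 - t\<bar> + 1) \<le> e / 2" .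
    show "0 < u" using e \<open>0 < k\<close> by (simp add: u_def flip: k_def)
    show "u < 1" by (simp add: u_def)
  qed
  define s where "s = (1 - u) * t + u * 1"
  have "t - u *\<^sub>R (t - 1) \<in> interior D"
    by (rule mem_interior_closure_convex_shrink) (use u t convex_D one_interior closure_subset in auto)
  then have s: "s \<in> interior D" by (simp add: s_def algebra_simps)
  have fs: "f s \<le> f t"
  proof -
    have "f s \<le> (1 - u) * f t" using convex_combination[OF t one_D, of u] u by (simp add: s_def)
    also have "\<dots> \<le> f t" using u f_nonneg by (simp add: mult_left_le_one_le)
    finally show ?thesis .
  qed
  have st: "\<bar>s - t\<bar> < e"
  proof -
    have sd: "s - t = u * (1 - t)" by (simp add: s_def algebra_simps)
    have "\<bar>s - t\<bar> = u * \<bar>1 - t\<bar>" using u by (simp add: sd abs_mult)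
    also have "\<dots> \<le> u * (\<bar>1 - t\<bar> + 1)" using u by (intro mult_left_mono) auto
    finally show ?thesis using u e by simp
  qed
  have "isCont f s" using continuous_on_f s by (simp add: continuous_on_eq_continuous_at)
  then have "(f \<longlongrightarrow> f s) (nhds s)" by (simp add: isCont_def tendsto_at_iff_tendsto_nhds)
  then have "\<forall>\<^sub>F x in nhds s. f x < f t + e" by (rule order_tendstoD) (use fs e in simp)
  moreover have "((\<lambda>x. \<bar>x - t\<bar>) \<longlongrightarrow> \<bar>s - t\<bar>) (nhds s)" by (intro tendsto_intros filterlim_ident)
  then have "\<forall>\<^sub>F x in nhds s. \<bar>x - t\<bar> < e" by (rule order_tendstoD) (use st in simp)
  moreover have "\<forall>\<^sub>F x in nhds s. x \<in> interior D" using s by (simp add: eventually_nhds_in_open)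
  ultimately have "\<forall>\<^sub>F x in nhds s. f x < f t + e \<and> \<bar>x - t\<bar> < e \<and> x \<in> interior D"
    by eventually_elim auto
  then obtain S where "open S" "s \<in> S" and S: "\<And>x. x \<in> S \<Longrightarrow> f x < f t + e \<and> \<bar>x - t\<bar> < e \<and> x \<in> interior D"
    unfolding eventually_nhds by blast
  then obtain d where d: "d > 0" "\<And>x. \<bar>x - s\<bar> < d \<Longrightarrow> x \<in> S" by (auto simp: open_real)
  obtain q where "q \<in> \<rat>" "s < q" "q < s + d" using Rats_dense_in_real[of s "s + d"] d by auto
  then show ?thesis using that[of q] S[OF d(2)[of q]] by (auto simp: C_def)
qed

lemma C_sequence:
  assumes "t \<in> D"
  obtains c where "\<And>n. c n \<in> C" "c \<longlonglongrightarrow> t" "\<And>n. f (c n) \<le> f t + inverse (real (Suc n))"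
proof -
  have "\<exists>c. c \<in> C \<and> \<bar>c - t\<bar> < inverse (real (Suc n)) \<and> f c \<le> f t + inverse (real (Suc n))" for n
    using C_approximates[OF assms, of "inverse (real (Suc n))"] by (metis less_imp_le positive_imp_inverse_positive of_nat_0_less_iff zero_less_Suc)
  then obtain c where c: "\<And>n. c n \<in> C \<and> \<bar>c n - t\<bar> < inverse (real (Suc n)) \<and> f (c n) \<le> f t + inverse (real (Suc n))"
    by metis
  have "(\<lambda>n. c n - t) \<longlonglongrightarrow> 0"
    by (rule Lim_null_comparison[OF _ LIMSEQ_inverse_real_of_nat]) (use c in \<open>auto simp: less_imp_le\<close>)
  then have "c \<longlonglongrightarrow> t" by (simp add: LIM_zero_iff)
  then show ?thesis using c that by blast
qed

text \<open>Lower semicontinuity makes each set \<open>{x. a < \<phi> x}\<close> open; the limit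
  inferior is taken over a punctured neighbourhood, so \<open>x\<close> itself is added
  separately.\<close>

lemma measurable_phi [measurable]: "\<phi> \<in> borel_measurable borel"
proof (rule borel_measurableI_greater)
  fix a
  have "open {x. a < \<phi> x}"
  proof (subst open_subopen, safe)
    fix x assume x: "a < \<phi> x"
    then have "a < Liminf (at x) \<phi>" using lsc by (auto simp: lower_semicont_def intro: less_le_trans)
    then have "\<forall>\<^sub>F y in at x. a < \<phi> y" by (rule less_LiminfD)
    then have "\<forall>\<^sub>F y in nhds x. a < \<phi> y" using x by (auto simp: eventually_at_filter elim: eventually_mono)
    then show "\<exists>T. open T \<and> x \<in> T \<and> T \<subseteq> {x. a < \<phi> x}" by (auto simp: eventually_nhds)
  qed
  then show "{x \<in> space borel. a < \<phi> x} \<in> sets borel" by simp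
qed

lemma measurable_f [measurable]: "f \<in> borel_measurable borel"
  unfolding f_def by measurable

lemma conjugate_eq: "conjugate \<phi> s = (SUP t\<in>D. ereal (s * t - f t))"
proof (rule antisym)
  show "conjugate \<phi> s \<le> (SUP t\<in>D. ereal (s * t - f t))"
    unfolding conjugate_def
  proof (rule SUP_least)
    fix t
    show "ereal (s * t) - enn2ereal (\<phi> t) \<le> (SUP t\<in>D. ereal (s * t - f t))"
      by (cases "t \<in> D") (auto simp: phi_eq phi_notin f_nonneg intro!: SUP_upper2[of t])
  qed
  show "(SUP t\<in>D. ereal (s * t - f t)) \<le> conjugate \<phi> s"
    unfolding conjugate_def
  proof (rule SUP_least)
    fix t assume "t \<in> D"
    then show "ereal (s * t - f t) \<le> (SUP t. ereal (s * t) - enn2ereal (\<phi> t))"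
      by (intro SUP_upper2[of t]) (auto simp: phi_eq f_nonneg)
  qed
qed

lemma conjugate_ge: "t \<in> D \<Longrightarrow> ereal (s * t - f t) \<le> conjugate \<phi> s"
  unfolding conjugate_eq by (rule SUP_upper)

lemma conjugate_not_MInf: "conjugate \<phi> s \<noteq> -\<infinity>"
  using conjugate_ge[OF one_D, of s] by auto

definition c :: "real \<Rightarrow> real" where "c s = real_of_ereal (conjugate \<phi> s)"

end

locale smooth_divergence_function = divergence_function +
  assumes cdiff: "conjugate_differentiable \<phi>"
begin

lemma conjugate_c: "conjugate \<phi> s = ereal (c s)"
  using cdiff by (auto simp: conjugate_differentiable_def c_def ereal_real')

lemma c_ge: "t \<in> D \<Longrightarrow> s * t - f t \<le> c s"
  using conjugate_ge[of t s] by (simp add: conjugate_c)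

lemma c_deriv: "(c has_real_derivative deriv c s) (at s)"
proof -
  have "c differentiable (at s)"
    using cdiff by (simp add: conjugate_differentiable_def differentiable_on_def c_def[abs_def])
  then show ?thesis by (simp add: DERIV_deriv_iff_real_differentiable)
qed

text \<open>A maximizing sequence is bounded because the conjugate is finite at \<open>s + 1\<close>
  as well, and lower semicontinuity makes a subsequential limit a maximizer.\<close>

lemma conjugate_attained:
  obtains t where "t \<in> D" "c s = s * t - f t"
proof -
  have "\<exists>t\<in>D. c s - inverse (real (Suc n)) < s * t - f t" for n
  proof -
    have "ereal (c s - inverse (real (Suc n))) < (SUP t\<in>D. ereal (s * t - f t))"
      by (simp flip: conjugate_eq add: conjugate_c)
    then show ?thesis by (auto simp: less_SUP_iff)
  qed
  then obtain t where t: "\<And>n. t n \<in> D" "\<And>n. c s - inverse (real (Suc n)) < s * t n - f (t n)" by metis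
  \<comment> \<open>Subtracting near-maximality at \<open>s\<close> from the Fenchel-Young
    inequality at \<open>s + 1\<close> isolates \<open>t n\<close>; the last 1 absorbs the error of
    near-maximality.\<close>
  have "t n \<in> {0..c (s + 1) - c s + 1}" for n
  proof -
    have "(s + 1) * t n - f (t n) \<le> c (s + 1)" by (rule c_ge[OF t(1)])
    moreover have "inverse (real (Suc n)) \<le> 1" by (simp add: field_simps)
    ultimately have "t n \<le> c (s + 1) - c s + 1" using t(2)[of n] by (simp add: algebra_simps)
    then show ?thesis using D_nonneg t(1) by auto
  qed
  then obtain l r where l: "strict_mono r" "(t \<circ> r) \<longlonglongrightarrow> l"
    using compact_Icc[of 0 "c (s + 1) - c s + 1"] unfolding compact_def by metis
  \<comment> \<open>This is \<open>\<phi> l \<le> s * l - c s\<close> tested against real levels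
    below \<open>\<phi> l\<close>, a form that also covers the value \<infinity> and so yields
    \<open>l \<in> D\<close> below.\<close>
  have "a \<le> s * l - c s" if a: "0 \<le> a" "ennreal a < \<phi> l" for a
  proof -
    have "ennreal a < Liminf (at l) \<phi>" using lsc a by (auto simp: lower_semicont_def intro: less_le_trans)
    then have "\<forall>\<^sub>F y in at l. ennreal a < \<phi> y" by (rule less_LiminfD)
    then have "\<forall>\<^sub>F y in nhds l. ennreal a < \<phi> y" using a by (auto simp: eventually_at_filter elim: eventually_mono)
    then have "\<forall>\<^sub>F n in sequentially. ennreal a < \<phi> ((t \<circ> r) n)" by (rule eventually_compose_filterlim[OF _ l(2)])
    then have "\<forall>\<^sub>F n in sequentially. a \<le> s * (t \<circ> r) n - c s + inverse (real (Suc (r n)))"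
    proof eventually_elim
      case (elim n)
      then have "a < f (t (r n))" using a by (simp add: phi_eq t ennreal_less_iff)
      then show ?case using t(2)[of "r n"] by simp
    qed
    moreover have "(\<lambda>n. s * (t \<circ> r) n - c s + inverse (real (Suc (r n)))) \<longlonglongrightarrow> s * l - c s + 0"
      using LIMSEQ_subseq_LIMSEQ[OF LIMSEQ_inverse_real_of_nat l(1)]
      by (intro tendsto_intros l(2)) (simp add: o_def)
    ultimately show ?thesis
      using tendsto_lowerbound[of _ _ sequentially a] by force
  qed note * = this
  have "l \<in> D"
  proof (rule ccontr)
    assume "l \<notin> D"
    then have "\<bar>s * l - c s\<bar> + 1 \<le> s * l - c s" by (intro *) (auto simp: phi_notin)
    then show False by simp
  qed
  moreover have "f l \<le> s * l - c s"
  proof (rule dense_le)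
    fix a assume "a < f l"
    then have "max a 0 \<le> s * l - c s" if "0 < f l"
      using that by (intro *) (auto simp: phi_eq[OF \<open>l \<in> D\<close>] ennreal_lessI)
    \<comment> \<open>No level \<open>a \<ge> 0\<close> lies below \<open>\<phi> l = 0\<close>, so
      this value is treated directly from the maximizing sequence.\<close>
    moreover have "0 \<le> s * l - c s" if "f l = 0"
    proof -
      have "c s - inverse (real (Suc (r n))) \<le> s * (t \<circ> r) n" for n
        using t(2)[of "r n"] f_nonneg[of "t (r n)"] by simp
      moreover have "(\<lambda>n. c s - inverse (real (Suc (r n)))) \<longlonglongrightarrow> c s - 0"
        using LIMSEQ_subseq_LIMSEQ[OF LIMSEQ_inverse_real_of_nat l(1)]
        by (intro tendsto_intros) (simp add: o_def)
      moreover have "(\<lambda>n. s * (t \<circ> r) n) \<longlonglongrightarrow> s * l" by (intro tendsto_intros l(2))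
      ultimately have "c s - 0 \<le> s * l" by (intro LIMSEQ_le) auto
      then show ?thesis by simp
    qed
    ultimately show "a \<le> s * l - c s" using \<open>a < f l\<close> f_nonneg[of l] by (cases "f l = 0") auto
  qed
  ultimately show ?thesis using that[of l] c_ge[of l s] by simp
qed

text \<open>If \<open>t\<close> attains the supremum at \<open>s\<close>, then c s' - t s' is
  minimal at s' = s, so its derivative vanishes and the maximizer is
  \<open>deriv c s\<close>.\<close>

lemma fenchel_deriv: "deriv c s \<in> D" "c s = s * deriv c s - f (deriv c s)"
proof -
  obtain t where t: "t \<in> D" "c s = s * t - f t" by (rule conjugate_attained)
  have d: "((\<lambda>s'. c s' - t * s') has_real_derivative (deriv c s - t)) (at s)"
    by (auto intro!: derivative_eq_intros c_deriv)
  have "deriv c s - t = 0"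
  proof (rule DERIV_local_min[OF d zero_less_one], safe)
    fix y show "c s - t * s \<le> c y - t * y" using c_ge[OF t(1), of y] t(2) by (simp add: mult.commute)
  qed
  then have "deriv c s = t" by simp
  then show "deriv c s \<in> D" "c s = s * deriv c s - f (deriv c s)" using t by auto
qed

lemma continuous_c: "continuous_on UNIV c"
  using c_deriv DERIV_isCont continuous_at_imp_continuous_on by blast

lemma measurable_c [measurable]: "c \<in> borel_measurable borel"
  using continuous_c by (rule borel_measurable_continuous_onI)

lemma measurable_deriv_c [measurable]: "deriv c \<in> borel_measurable borel"
proof (rule borel_measurable_LIMSEQ_real)
  fix s
  have "filterlim (\<lambda>n. inverse (real (Suc n))) (at 0) sequentially"
    using LIMSEQ_inverse_real_of_nat by (simp add: filterlim_at)
  with c_deriv[of s] show "(\<lambda>n. (c (s + inverse (real (Suc n))) - c s) / inverse (real (Suc n))) \<longlonglongrightarrow> deriv c s"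
    unfolding DERIV_def by (rule filterlim_compose)
qed measurable

end

section \<open>Densities\<close>

lemma RN_deriv_real_density:
  fixes y :: "'a \<Rightarrow> real"
  assumes "sigma_finite_measure P" "y \<in> borel_measurable P" "\<And>\<omega>. 0 \<le> y \<omega>"
  shows "AE \<omega> in P. enn2real (RN_deriv P (density P (\<lambda>\<omega>. ennreal (y \<omega>))) \<omega>) = y \<omega>"
proof -
  have "AE \<omega> in P. ennreal (y \<omega>) = RN_deriv P (density P (\<lambda>\<omega>. ennreal (y \<omega>))) \<omega>"
    by (rule sigma_finite_measure.RN_deriv_unique[OF assms(1)]) (use assms(2) in auto)
  then show ?thesis by eventually_elim (metis assms(3) enn2real_ennreal)
qed

lemma phi_div_density:
  fixes y :: "'a \<Rightarrow> real"
  assumes "sigma_finite_measure P" "y \<in> borel_measurable P" "\<And>\<omega>. 0 \<le> y \<omega>"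
  shows "phi_div \<phi> (density P (\<lambda>\<omega>. ennreal (y \<omega>))) P = (\<integral>\<^sup>+\<omega>. \<phi> (y \<omega>) \<partial>P)"
proof -
  have "absolutely_continuous P (density P (\<lambda>\<omega>. ennreal (y \<omega>)))"
    using assms(2) by (intro absolutely_continuousI_density) auto
  moreover have "(\<integral>\<^sup>+\<omega>. \<phi> (enn2real (RN_deriv P (density P (\<lambda>\<omega>. ennreal (y \<omega>))) \<omega>)) \<partial>P) = (\<integral>\<^sup>+\<omega>. \<phi> (y \<omega>) \<partial>P)"
    by (intro nn_integral_cong_AE) (use RN_deriv_real_density[OF assms] in eventually_elim, simp)
  ultimately show ?thesis by (simp add: phi_div_def)
qed

text \<open>The Radon-Nikodym derivative is finite almost everywhere, so its image under
  \<open>enn2real\<close> defines the same measure and is nonnegative at every point.\<close>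

lemma feasible_l_density:
  assumes P: "prob_space P" and Q: "Q \<in> feasible_l P"
  obtains z :: "'a \<Rightarrow> real" where "z \<in> borel_measurable P" "\<And>\<omega>. 0 \<le> z \<omega>" "Q = density P (\<lambda>\<omega>. ennreal (z \<omega>))"
proof -
  interpret P: prob_space P by fact
  have Q': "absolutely_continuous P Q" "sets Q = sets P" "prob_space Q"
    using Q by (auto simp: feasible_l_def prob_on_def)
  interpret Q: prob_space Q by fact
  define z where "z = (\<lambda>\<omega>. enn2real (RN_deriv P Q \<omega>))"
  have "AE \<omega> in P. RN_deriv P Q \<omega> \<noteq> \<infinity>"
    by (rule P.RN_deriv_finite[OF Q.sigma_finite_measure_axioms Q'(1,2)])
  then have "AE \<omega> in P. RN_deriv P Q \<omega> = ennreal (z \<omega>)"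
    by eventually_elim (simp add: z_def less_top)
  then have "density P (RN_deriv P Q) = density P (\<lambda>\<omega>. ennreal (z \<omega>))"
    by (intro density_cong) (auto simp: z_def)
  then have "Q = density P (\<lambda>\<omega>. ennreal (z \<omega>))"
    using P.density_RN_deriv[OF Q'(1,2)] by simp
  then show ?thesis by (intro that[of z]) (auto simp: z_def)
qed

lemma feasible_l_densityI:
  fixes z :: "'a \<Rightarrow> real"
  assumes [measurable]: "z \<in> borel_measurable P" and z: "\<And>\<omega>. 0 \<le> z \<omega>" "integrable P z" "(\<integral>\<omega>. z \<omega> \<partial>P) = 1"
  shows "density P (\<lambda>\<omega>. ennreal (z \<omega>)) \<in> feasible_l P"
proof -
  have "(\<integral>\<^sup>+\<omega>. ennreal (z \<omega>) \<partial>P) = 1"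
    using nn_integral_eq_integral[OF z(2)] z by simp
  then have "prob_space (density P (\<lambda>\<omega>. ennreal (z \<omega>)))"
    by (intro prob_spaceI) (simp add: emeasure_density cong: nn_integral_cong)
  then show ?thesis by (auto simp: feasible_l_def prob_on_def intro!: absolutely_continuousI_density)
qed

lemma prob_density_integral:
  fixes z :: "'a \<Rightarrow> real"
  assumes [measurable]: "z \<in> borel_measurable P" and z: "\<And>\<omega>. 0 \<le> z \<omega>"
    and "prob_space (density P (\<lambda>\<omega>. ennreal (z \<omega>)))"
  shows "integrable P z" "(\<integral>\<omega>. z \<omega> \<partial>P) = 1"
proof -
  have "(\<integral>\<^sup>+\<omega>. ennreal (z \<omega>) \<partial>P) = 1"
    using prob_space.emeasure_space_1[OF assms(3)] by (simp add: emeasure_density cong: nn_integral_cong)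
  then show "integrable P z" "(\<integral>\<omega>. z \<omega> \<partial>P) = 1"
    using z by (auto intro!: integrableI_nonneg simp: integral_eq_nn_integral)
qed

lemma density_density_mult:
  fixes z y :: "'a \<Rightarrow> real"
  assumes [measurable]: "z \<in> borel_measurable P" "y \<in> borel_measurable P" and z: "\<And>\<omega>. 0 \<le> z \<omega>"
  shows "density (density P (\<lambda>\<omega>. ennreal (z \<omega>))) (\<lambda>\<omega>. ennreal (y \<omega>)) = density P (\<lambda>\<omega>. ennreal (z \<omega> * y \<omega>))"
  using z by (subst density_density_eq) (auto simp: ennreal_mult' intro!: density_cong)

section \<open>Duality\<close>

locale oce = prob_space P0 + d1: divergence_function \<phi>1 + d2: divergence_function \<phi>2
  for P0 :: "'a measure" and \<phi>1 \<phi>2 +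
  fixes X :: "'a \<Rightarrow> real"
  assumes X: "integrable P0 X"
begin

section \<open>Primal objectives as expectations under \<open>P0\<close>\<close>

lemma measurable_X [measurable]: "X \<in> borel_measurable P0"
  using X by auto

lemma measurable_phi12 [measurable (raw)]:
  "y \<in> borel_measurable M \<Longrightarrow> (\<lambda>\<omega>. \<phi>1 (y \<omega>)) \<in> borel_measurable M"
  "y \<in> borel_measurable M \<Longrightarrow> (\<lambda>\<omega>. \<phi>2 (y \<omega>)) \<in> borel_measurable M"
  by (auto intro: measurable_compose d1.measurable_phi d2.measurable_phi)

text \<open>The integrand of E_Q'[-X] minus the first penalty, expressed under \<open>P0\<close>.
  The weight is multiplied in \<open>ennreal\<close>, where 0 * \<infinity> = 0 discards the value
  of \<open>y\<close> at points with \<open>z = 0\<close>.\<close>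

definition payoff :: "('a \<Rightarrow> real) \<Rightarrow> ('a \<Rightarrow> real) \<Rightarrow> 'a \<Rightarrow> ereal" where
  "payoff z y \<omega> = ereal (- X \<omega> * (z \<omega> * y \<omega>)) - enn2ereal (ennreal (z \<omega>) * \<phi>1 (y \<omega>))"

lemma measurable_payoff [measurable]:
  assumes [measurable]: "z \<in> borel_measurable P0" "y \<in> borel_measurable P0"
  shows "payoff z y \<in> borel_measurable P0"
  unfolding payoff_def by measurable

context
  fixes z y :: "'a \<Rightarrow> real" and Q Q' :: "'a measure"
  assumes zm [measurable]: "z \<in> borel_measurable P0" and ym [measurable]: "y \<in> borel_measurable P0"
    and z0: "\<And>\<omega>. 0 \<le> z \<omega>" and y0: "\<And>\<omega>. 0 \<le> y \<omega>"
    and Q: "Q = density P0 (\<lambda>\<omega>. ennreal (z \<omega>))" and Q': "Q' = density Q (\<lambda>\<omega>. ennreal (y \<omega>))"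
    and pQ: "prob_space Q"
begin

lemma measurable_Q: "borel_measurable Q = borel_measurable P0"
  by (auto simp: measurable_def Q)

lemma sigma_finite_Q: "sigma_finite_measure Q"
proof -
  interpret Q: prob_space Q by (rule pQ)
  show ?thesis ..
qed

lemma AE_RN_Q: "AE \<omega> in P0. enn2real (RN_deriv P0 Q \<omega>) = z \<omega>"
  unfolding Q by (rule RN_deriv_real_density) (auto simp: z0 sigma_finite_measure_axioms)

lemma AE_RN_Q': "AE \<omega> in Q. enn2real (RN_deriv Q Q' \<omega>) = y \<omega>"
  unfolding Q' by (rule RN_deriv_real_density[OF sigma_finite_Q]) (auto simp: y0 measurable_Q)

lemma eexpect_Q': "eexpect Q' (\<lambda>\<omega>. ereal (- X \<omega>)) = eexpect Q (\<lambda>\<omega>. ereal (- X \<omega> * y \<omega>))"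
  unfolding Q' by (subst eexpect_density) (auto simp: measurable_Q y0 mult.commute)

lemma eexpect_Q: "f \<in> borel_measurable P0 \<Longrightarrow> eexpect Q f = eexpect P0 (\<lambda>\<omega>. ereal (z \<omega>) * f \<omega>)"
  unfolding Q by (subst eexpect_density) (auto simp: z0)

lemma phi_div_Q': "phi_div \<phi>1 Q' Q = (\<integral>\<^sup>+\<omega>. ennreal (z \<omega>) * \<phi>1 (y \<omega>) \<partial>P0)"
proof -
  have "phi_div \<phi>1 Q' Q = (\<integral>\<^sup>+\<omega>. \<phi>1 (y \<omega>) \<partial>Q)"
    unfolding Q' by (rule phi_div_density[OF sigma_finite_Q]) (auto simp: y0 measurable_Q)
  then show ?thesis by (simp add: Q nn_integral_density)
qed

lemma phi_div_Q: "phi_div \<phi>2 Q P0 = (\<integral>\<^sup>+\<omega>. \<phi>2 (z \<omega>) \<partial>P0)"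
  unfolding Q by (rule phi_div_density) (auto simp: z0 sigma_finite_measure_axioms)

text \<open>Both branches of the objective give the expectation of the combined integrand: the
  exceptional one by definition, the other by \<open>eexpect_diff_penalty\<close>.\<close>

lemma primal_s_eq: "primal_s \<phi>1 X Q Q' = eexpect P0 (payoff z y)"
proof -
  let ?J = "eexpect Q (\<lambda>\<omega>. ereal (- X \<omega> * y \<omega>) - enn2ereal (\<phi>1 (y \<omega>)))"
  have p: "phi_div \<phi>1 Q' Q = (\<integral>\<^sup>+\<omega>. \<phi>1 (y \<omega>) \<partial>Q)"
    unfolding Q' by (rule phi_div_density[OF sigma_finite_Q]) (auto simp: y0 measurable_Q)
  have J: "eexpect Q (\<lambda>\<omega>. let y = enn2real (RN_deriv Q Q' \<omega>) in ereal (- X \<omega> * y) - enn2ereal (\<phi>1 y)) = ?J"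
    by (rule eexpect_cong_AE) (use AE_RN_Q' in eventually_elim, simp add: Let_def)
  have d: "?J = ediff (eexpect Q (\<lambda>\<omega>. ereal (- X \<omega> * y \<omega>))) (enn2ereal (\<integral>\<^sup>+\<omega>. \<phi>1 (y \<omega>) \<partial>Q))"
    if "\<not> (eexpect Q (\<lambda>\<omega>. ereal (- X \<omega> * y \<omega>)) = \<infinity> \<and> (\<integral>\<^sup>+\<omega>. \<phi>1 (y \<omega>) \<partial>Q) = \<infinity>)"
    by (rule eexpect_diff_penalty[OF _ _ that]) (simp_all add: measurable_Q)
  have "primal_s \<phi>1 X Q Q' = ?J"
    unfolding primal_s_def J[unfolded Let_def] p eexpect_Q' Let_def using d by auto
  also have "\<dots> = eexpect P0 (\<lambda>\<omega>. ereal (z \<omega>) * (ereal (- X \<omega> * y \<omega>) - enn2ereal (\<phi>1 (y \<omega>))))"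
    by (rule eexpect_Q) measurable
  also have "(\<lambda>\<omega>. ereal (z \<omega>) * (ereal (- X \<omega> * y \<omega>) - enn2ereal (\<phi>1 (y \<omega>)))) = payoff z y"
  proof
    fix \<omega>
    show "ereal (z \<omega>) * (ereal (- X \<omega> * y \<omega>) - enn2ereal (\<phi>1 (y \<omega>))) = payoff z y \<omega>"
      using z0[of \<omega>] by (cases "\<phi>1 (y \<omega>)"; cases "z \<omega> = 0")
        (auto simp: payoff_def times_ennreal.rep_eq algebra_simps zero_ennreal.rep_eq simp flip: zero_ereal_def)
  qed
  finally show ?thesis .
qed

lemma primal_l_eq:
  "primal_l P0 \<phi>1 \<phi>2 X Q Q' = eexpect P0 (\<lambda>\<omega>. payoff z y \<omega> - enn2ereal (\<phi>2 (z \<omega>)))"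
proof -
  let ?g = "\<lambda>\<omega>. - X \<omega> * (z \<omega> * y \<omega>)"
  let ?p = "\<lambda>\<omega>. ennreal (z \<omega>) * \<phi>1 (y \<omega>) + \<phi>2 (z \<omega>)"
  have split: "ereal a - enn2ereal b - enn2ereal c = ereal a - enn2ereal (b + c)" for a b c
    by (cases b; cases c) (auto simp: plus_ennreal.rep_eq algebra_simps)
  have e: "eexpect Q' (\<lambda>\<omega>. ereal (- X \<omega>)) = eexpect P0 (\<lambda>\<omega>. ereal (?g \<omega>))"
    unfolding eexpect_Q' by (subst eexpect_Q) (auto simp: algebra_simps)
  have p: "enn2ereal (phi_div \<phi>1 Q' Q) + enn2ereal (phi_div \<phi>2 Q P0) = enn2ereal (\<integral>\<^sup>+\<omega>. ?p \<omega> \<partial>P0)"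
    unfolding phi_div_Q phi_div_Q' by (simp add: nn_integral_add plus_ennreal.rep_eq)
  have J: "eexpect P0 (\<lambda>\<omega>. let z = enn2real (RN_deriv P0 Q \<omega>); y = enn2real (RN_deriv Q Q' \<omega>)
                in ereal (- X \<omega> * (z * y)) - ereal z * enn2ereal (\<phi>1 y) - enn2ereal (\<phi>2 z))
      = eexpect P0 (\<lambda>\<omega>. ereal (?g \<omega>) - enn2ereal (?p \<omega>))"
  proof (rule eexpect_cong_AE)
    \<comment> \<open>The derivative of \<open>Q'\<close> is determined only \<open>Q\<close>-almost
      everywhere, that is, where \<open>z > 0\<close>; elsewhere the factor \<open>z\<close> removes
      it from the integrand.\<close>
    have "AE \<omega> in P0. 0 < ennreal (z \<omega>) \<longrightarrow> enn2real (RN_deriv Q Q' \<omega>) = y \<omega>"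
      using AE_RN_Q' unfolding Q by (subst (asm) AE_density) auto
    then show "AE \<omega> in P0. (let z = enn2real (RN_deriv P0 Q \<omega>); y = enn2real (RN_deriv Q Q' \<omega>)
                in ereal (- X \<omega> * (z * y)) - ereal z * enn2ereal (\<phi>1 y) - enn2ereal (\<phi>2 z))
      = ereal (?g \<omega>) - enn2ereal (?p \<omega>)"
      using AE_RN_Q
    proof eventually_elim
      case (elim \<omega>)
      show ?case
      proof (cases "z \<omega> = 0")
        case True
        then show ?thesis using elim by (simp add: Let_def flip: zero_ereal_def)
      next
        case False
        then have "0 < z \<omega>" using z0[of \<omega>] by simp
        then show ?thesis using elim by (simp add: Let_def times_ennreal.rep_eq flip: split)
      qed
    qed
  qed
  have d: "eexpect P0 (\<lambda>\<omega>. ereal (?g \<omega>) - enn2ereal (?p \<omega>))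
      = ediff (eexpect P0 (\<lambda>\<omega>. ereal (?g \<omega>))) (enn2ereal (\<integral>\<^sup>+\<omega>. ?p \<omega> \<partial>P0))"
    if "\<not> (eexpect P0 (\<lambda>\<omega>. ereal (?g \<omega>)) = \<infinity> \<and> (\<integral>\<^sup>+\<omega>. ?p \<omega> \<partial>P0) = \<infinity>)"
    by (rule eexpect_diff_penalty[OF _ _ that]) simp_all
  have "primal_l P0 \<phi>1 \<phi>2 X Q Q' = eexpect P0 (\<lambda>\<omega>. ereal (?g \<omega>) - enn2ereal (?p \<omega>))"
    unfolding primal_l_def J[unfolded Let_def] Let_def p e using d by auto
  then show ?thesis by (simp add: payoff_def split)
qed

end

section \<open>The pointwise Lagrangian and its supremum\<close>

text \<open>The pair \<open>(t, y)\<close> stands for the values of \<open>dQ/dP0\<close> and \<open>dQ'/dQ\<close> at a point where \<open>X = x\<close>. The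
  supremum \<open>B\<close> is \<open>beta_l\<close> for \<open>lam = 1\<close>, \<open>beta_s\<close> for \<open>lam > 0\<close> and \<open>beta_s_closed\<close> for \<open>lam \<ge> 0\<close>.\<close>

definition psi :: "real \<Rightarrow> real \<Rightarrow> real \<Rightarrow> real \<Rightarrow> real \<times> real \<Rightarrow> real" where
  "psi lam x \<theta>1 \<theta>2 = (\<lambda>(t, y). t * (\<theta>1 + (\<theta>2 - x) * y - d1.f y) - lam * d2.f t)"

definition B :: "real \<Rightarrow> real \<Rightarrow> real \<Rightarrow> real \<Rightarrow> ereal" where
  "B lam x \<theta>1 \<theta>2 = (SUP p\<in>d2.D \<times> d1.D. ereal (psi lam x \<theta>1 \<theta>2 p))"

lemma psi_le_B: "t \<in> d2.D \<Longrightarrow> y \<in> d1.D \<Longrightarrow> ereal (psi lam x \<theta>1 \<theta>2 (t, y)) \<le> B lam x \<theta>1 \<theta>2"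
  unfolding B_def by (rule SUP_upper) auto

text \<open>Approximate \<open>t\<close> and \<open>y\<close> by points of \<open>C\<close>, with
  \<open>f\<close> controlled from above; the nonnegative coefficients \<open>a n\<close> and
  \<open>lam\<close> turn this into a lower bound for the Lagrangian. Countability is what the
  selection by simple functions requires.\<close>

lemma B_eq_countable_SUP:
  assumes lam: "0 \<le> lam"
  shows "B lam x \<theta>1 \<theta>2 = (SUP p\<in>d2.C \<times> d1.C. ereal (psi lam x \<theta>1 \<theta>2 p))"
proof (rule antisym)
  show "(SUP p\<in>d2.C \<times> d1.C. ereal (psi lam x \<theta>1 \<theta>2 p)) \<le> B lam x \<theta>1 \<theta>2"
    unfolding B_def using d1.C_subset_D d2.C_subset_D by (intro SUP_subset_mono) auto
  show "B lam x \<theta>1 \<theta>2 \<le> (SUP p\<in>d2.C \<times> d1.C. ereal (psi lam x \<theta>1 \<theta>2 p))" (is "_ \<le> ?S")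
    unfolding B_def
  proof (rule SUP_least, safe)
    fix t y assume t: "t \<in> d2.D" and y: "y \<in> d1.D"
    obtain a where a: "\<And>n. a n \<in> d2.C" "a \<longlonglongrightarrow> t" "\<And>n. d2.f (a n) \<le> d2.f t + inverse (real (Suc n))"
      using d2.C_sequence[OF t] by blast
    obtain b where b: "\<And>n. b n \<in> d1.C" "b \<longlonglongrightarrow> y" "\<And>n. d1.f (b n) \<le> d1.f y + inverse (real (Suc n))"
      using d1.C_sequence[OF y] by blast
    define h where "h n = a n * (\<theta>1 + (\<theta>2 - x) * b n - (d1.f y + inverse (real (Suc n))))
      - lam * (d2.f t + inverse (real (Suc n)))" for n
    have "h \<longlonglongrightarrow> t * (\<theta>1 + (\<theta>2 - x) * y - (d1.f y + 0)) - lam * (d2.f t + 0)"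
      unfolding h_def by (intro tendsto_intros a b LIMSEQ_inverse_real_of_nat)
    then have lim: "(\<lambda>n. ereal (h n)) \<longlonglongrightarrow> ereal (psi lam x \<theta>1 \<theta>2 (t, y))"
      by (simp add: psi_def)
    have "ereal (h n) \<le> ?S" for n
    proof -
      have "0 \<le> a n" using a(1) d2.C_subset_D d2.D_nonneg by blast
      then have "h n \<le> psi lam x \<theta>1 \<theta>2 (a n, b n)"
        unfolding h_def psi_def using a(3)[of n] b(3)[of n] lam
        by (auto intro!: diff_mono mult_left_mono)
      also have "ereal \<dots> \<le> ?S" by (rule SUP_upper) (use a b in auto)
      finally show ?thesis by simp
    qed
    then show "ereal (psi lam x \<theta>1 \<theta>2 (t, y)) \<le> ?S"
      by (intro LIMSEQ_le_const2[OF lim]) blast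
  qed
qed

text \<open>Taking the supremum over \<open>y\<close> first: a factor \<open>t \<ge> 0\<close>
  commutes with a supremum over a nonempty set, also when \<open>t = 0\<close> and the inner
  conjugate is \<infinity>.\<close>

lemma B_eq:
  assumes "0 \<le> lam"
  shows "B lam x \<theta>1 \<theta>2 = (SUP t\<in>d2.D. (conjugate \<phi>1 (\<theta>2 - x) + ereal \<theta>1) * ereal t - ereal (lam * d2.f t))"
proof -
  have ne: "d1.D \<noteq> {}" using d1.one_D by auto
  have u: "conjugate \<phi>1 (\<theta>2 - x) + ereal \<theta>1 = (SUP y\<in>d1.D. ereal (\<theta>1 + (\<theta>2 - x) * y - d1.f y))"
    unfolding d1.conjugate_eq by (subst SUP_ereal_add_left[symmetric]) (auto simp: ne algebra_simps)
  have "(conjugate \<phi>1 (\<theta>2 - x) + ereal \<theta>1) * ereal t - ereal (lam * d2.f t)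
      = (SUP y\<in>d1.D. ereal (psi lam x \<theta>1 \<theta>2 (t, y)))" if "t \<in> d2.D" for t
    unfolding u Sup_ereal_mult_right'[OF ne d2.D_nonneg[OF that]]
    by (subst SUP_ereal_minus_left[OF ne, symmetric]) (auto simp: psi_def mult.commute)
  then show ?thesis unfolding B_def by (simp add: SUP_pair flip: Sigma_def)
qed

lemma inner_conjugate_not_MInf: "conjugate \<phi>1 (\<theta>2 - x) + ereal \<theta>1 \<noteq> - \<infinity>"
  using d1.conjugate_not_MInf by (cases "conjugate \<phi>1 (\<theta>2 - x)") auto

text \<open>Moving the factor \<open>lam\<close> inside the supremum of the outer conjugate at
  \<open>u / lam\<close> leaves the supremum of u t - lam \<phi>2(t). For
  \<open>u = \<infinity>\<close> the point \<open>t = 1\<close> already makes it infinite.\<close>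

lemma beta_s_pos:
  assumes lam: "0 < lam"
  shows "beta_s \<phi>1 \<phi>2 X \<omega> ((\<theta>1, \<theta>2), lam) = B lam (X \<omega>) \<theta>1 \<theta>2"
proof -
  define u where "u = conjugate \<phi>1 (\<theta>2 - X \<omega>) + ereal \<theta>1"
  have ne: "d2.D \<noteq> {}" using d2.one_D by auto
  have B: "B lam (X \<omega>) \<theta>1 \<theta>2 = (SUP t\<in>d2.D. u * ereal t - ereal (lam * d2.f t))"
    using B_eq[of lam] lam by (simp add: u_def)
  have "conjugate_persp \<phi>2 lam u = B lam (X \<omega>) \<theta>1 \<theta>2"
  proof (cases u)
    case PInf
    have "\<infinity> \<le> (SUP t\<in>d2.D. u * ereal t - ereal (lam * d2.f t))"
      by (rule SUP_upper2[OF d2.one_D]) (simp add: PInf)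
    then show ?thesis using lam by (simp add: B PInf conjugate_persp_def conjugate_ext_def)
  next
    case MInf
    then show ?thesis using inner_conjugate_not_MInf by (simp add: u_def)
  next
    case (real v)
    have "ereal lam * conjugate \<phi>2 (v / lam) = (SUP t\<in>d2.D. u * ereal t - ereal (lam * d2.f t))"
      unfolding d2.conjugate_eq using lam real
      by (subst Sup_ereal_mult_left'[OF ne]) (auto simp: algebra_simps)
    then show ?thesis using lam by (simp add: B real conjugate_persp_def conjugate_ext_def)
  qed
  then show ?thesis by (simp add: beta_s_def u_def)
qed

lemma beta_s_closed_eq:
  assumes "0 \<le> lam"
  shows "beta_s_closed \<phi>1 \<phi>2 X \<omega> ((\<theta>1, \<theta>2), lam) = B lam (X \<omega>) \<theta>1 \<theta>2"
  using assms beta_s_pos[of lam] B_eq[of 0]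
  by (cases "lam = 0") (auto simp: beta_s_closed_def d2.D_def simp flip: zero_ereal_def)

lemma beta_l_eq: "beta_l \<phi>1 \<phi>2 X \<omega> (\<theta>1, \<theta>2) = B 1 (X \<omega>) \<theta>1 \<theta>2"
  using beta_s_pos[of 1 \<omega> \<theta>1 \<theta>2]
  by (simp add: beta_s_def beta_l_def conjugate_persp_def flip: one_ereal_def)

text \<open>Only \<open>lam = 0\<close> can be strict: for \<open>u \<le> 0\<close> every u t with
  \<open>t \<ge> 0\<close> is at most 0, and for \<open>u > 0\<close> the right side is
  \<infinity>.\<close>

lemma B_le_beta_s:
  assumes "0 \<le> lam"
  shows "B lam (X \<omega>) \<theta>1 \<theta>2 \<le> beta_s \<phi>1 \<phi>2 X \<omega> ((\<theta>1, \<theta>2), lam)"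
proof (cases "lam = 0")
  case True
  define u where "u = conjugate \<phi>1 (\<theta>2 - X \<omega>) + ereal \<theta>1"
  have "(SUP t\<in>d2.D. u * ereal t) \<le> 0" if "u \<le> 0"
    by (rule SUP_least) (use that d2.D_nonneg in \<open>auto simp: ereal_mult_le_0_iff\<close>)
  then show ?thesis using True B_eq[of 0]
    by (auto simp: beta_s_def conjugate_persp_def u_def simp flip: zero_ereal_def)
qed (use assms beta_s_pos in auto)

lemma beta_s_eq:
  assumes "0 \<le> lam" "{0<..} \<subseteq> effdom \<phi>2"
  shows "beta_s \<phi>1 \<phi>2 X \<omega> ((\<theta>1, \<theta>2), lam) = B lam (X \<omega>) \<theta>1 \<theta>2"
proof (cases "lam = 0")
  case True
  define u where "u = conjugate \<phi>1 (\<theta>2 - X \<omega>) + ereal \<theta>1"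
  have B: "B 0 (X \<omega>) \<theta>1 \<theta>2 = (SUP t\<in>d2.D. u * ereal t)"
    using B_eq[of 0] by (simp add: u_def flip: zero_ereal_def)
  have D: "t \<in> d2.D" if "0 < t" for t using assms that by (auto simp: d2.D_def)
  have "conjugate_persp \<phi>2 0 u \<le> B 0 (X \<omega>) \<theta>1 \<theta>2"
  proof (cases u)
    case PInf
    have "\<infinity> \<le> (SUP t\<in>d2.D. u * ereal t)"
      by (rule SUP_upper2[OF d2.one_D]) (simp add: PInf)
    then show ?thesis by (simp add: B)
  next
    case MInf
    then show ?thesis using inner_conjugate_not_MInf by (simp add: u_def)
  next
    case (real v)
    have seq: "ereal (v * t) \<le> B 0 (X \<omega>) \<theta>1 \<theta>2" if "0 < t" for t
      unfolding B using D[OF that] by (intro SUP_upper2[of t]) (auto simp: real)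
    show ?thesis
    proof (cases "v \<le> 0")
      case True
      \<comment> \<open>The point 0 may lie outside the domain, so the value 0 is approached through
        positive \<open>t\<close>.\<close>
      have "(\<lambda>n. ereal (v * inverse (real (Suc n)))) \<longlonglongrightarrow> ereal (v * 0)"
        by (intro tendsto_intros LIMSEQ_inverse_real_of_nat)
      then have "ereal (v * 0) \<le> B 0 (X \<omega>) \<theta>1 \<theta>2"
        by (rule LIMSEQ_le_const2) (use seq in auto)
      then show ?thesis using True by (simp add: conjugate_persp_def real flip: zero_ereal_def)
    next
      case False
      \<comment> \<open>The term at \<open>t = k / v\<close> equals \<open>k\<close>, and all
        positive \<open>t\<close> are in the domain.\<close>
      have "ereal k \<le> B 0 (X \<omega>) \<theta>1 \<theta>2" if "0 < k" for k
        using seq[of "k / v"] False that by simp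
      then have "B 0 (X \<omega>) \<theta>1 \<theta>2 = \<infinity>"
        by (metis ereal_top ereal_less_eq(3) gt_ex linorder_le_cases order_less_le_trans order_trans zero_less_one)
      then show ?thesis by simp
    qed
  qed
  then show ?thesis using True B_le_beta_s[of 0 \<omega> \<theta>1 \<theta>2] by (simp add: beta_s_def u_def)
qed (use assms beta_s_pos in auto)

lemma B_antimono:
  assumes "0 \<le> lam"
  shows "B lam x \<theta>1 \<theta>2 \<le> B 0 x \<theta>1 \<theta>2"
  unfolding B_def using assms d2.f_nonneg by (intro SUP_mono') (auto simp: psi_def)

lemma integrable_psi: "integrable P0 (\<lambda>\<omega>. psi lam (X \<omega>) \<theta>1 \<theta>2 p)"
  unfolding psi_def using X by (cases p) simp

text \<open>The Fenchel-Young inequality in integrand form. If \<open>y\<close> is outside the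
  domain of \<phi>1, either the left side is -\<infinity>, or \<open>z = 0\<close> and
  \<open>y\<close> may be replaced by 1.\<close>

lemma payoff_le_B:
  assumes "z \<in> d2.D" "0 \<le> lam"
  shows "ereal (- x * (z * y)) - enn2ereal (ennreal z * \<phi>1 y) + ereal (\<theta>1 * z + \<theta>2 * (z * y) - lam * d2.f z)
    \<le> B lam x \<theta>1 \<theta>2"
proof (cases "y \<in> d1.D")
  case True
  have "ennreal z * \<phi>1 y = ennreal (z * d1.f y)"
    using d2.D_nonneg[OF assms(1)] by (simp add: d1.phi_eq[OF True] ennreal_mult d1.f_nonneg)
  then show ?thesis using psi_le_B[OF assms(1) True, of lam x \<theta>1 \<theta>2] d2.D_nonneg[OF assms(1)] d1.f_nonneg[of y]
    by (simp add: psi_def algebra_simps)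
next
  case False
  show ?thesis
  proof (cases "z = 0")
    case True
    then show ?thesis using psi_le_B[OF assms(1) d1.one_D, of lam x \<theta>1 \<theta>2]
      by (simp add: psi_def zero_ennreal.rep_eq)
  next
    case False
    then have "ennreal z * \<phi>1 y = \<infinity>"
      using d2.D_nonneg[OF assms(1)] by (simp add: d1.phi_notin[OF \<open>y \<notin> d1.D\<close>] ennreal_mult_top)
    then show ?thesis by simp
  qed
qed

text \<open>The Lagrangian at \<open>t = y = 1\<close> is an integrable minorant of the
  supremum.\<close>

lemma eexpect_B_gt_MInf:
  assumes "0 \<le> lam"
  shows "eexpect P0 (\<lambda>\<omega>. B lam (X \<omega>) \<theta>1 \<theta>2) \<noteq> - \<infinity>"
proof -
  have "eexpect P0 (\<lambda>\<omega>. ereal (psi lam (X \<omega>) \<theta>1 \<theta>2 (1, 1))) \<le> eexpect P0 (\<lambda>\<omega>. B lam (X \<omega>) \<theta>1 \<theta>2)"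
    by (rule eexpect_mono_AE) (use psi_le_B d1.one_D d2.one_D in auto)
  then show ?thesis by (auto simp: eexpect_real[OF integrable_psi])
qed

text \<open>The multiplier terms form an integrable function with known integral, so they can be
  added to the payoff before the pointwise bound is integrated, even if the payoff has infinite
  expectation.\<close>

lemma weak_duality:
  assumes [measurable]: "z \<in> borel_measurable P0" "y \<in> borel_measurable P0" and lam: "0 \<le> lam"
    and z: "integrable P0 z" "(\<integral>\<omega>. z \<omega> \<partial>P0) = 1" "AE \<omega> in P0. z \<omega> \<in> d2.D"
    and y: "integrable P0 (\<lambda>\<omega>. z \<omega> * y \<omega>)" "(\<integral>\<omega>. z \<omega> * y \<omega> \<partial>P0) = 1"
    and f: "integrable P0 (\<lambda>\<omega>. d2.f (z \<omega>))"
  shows "eexpect P0 (payoff z y) \<le> ereal (- \<theta>1 - \<theta>2 + lam * (\<integral>\<omega>. d2.f (z \<omega>) \<partial>P0))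
    + eexpect P0 (\<lambda>\<omega>. B lam (X \<omega>) \<theta>1 \<theta>2)"
proof -
  let ?g = "\<lambda>\<omega>. \<theta>1 * z \<omega> + \<theta>2 * (z \<omega> * y \<omega>) - lam * d2.f (z \<omega>)"
  have g: "integrable P0 ?g" "(\<integral>\<omega>. ?g \<omega> \<partial>P0) = \<theta>1 + \<theta>2 - lam * (\<integral>\<omega>. d2.f (z \<omega>) \<partial>P0)"
    using z y f by simp_all
  have "eexpect P0 (payoff z y) + ereal (\<integral>\<omega>. ?g \<omega> \<partial>P0) = eexpect P0 (\<lambda>\<omega>. payoff z y \<omega> + ereal (?g \<omega>))"
    using g by (subst eexpect_add_integrable) auto
  also have "\<dots> \<le> eexpect P0 (\<lambda>\<omega>. B lam (X \<omega>) \<theta>1 \<theta>2)"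
    by (rule eexpect_mono_AE) (use z(3) in eventually_elim, use payoff_le_B lam in \<open>simp add: payoff_def\<close>)
  finally show ?thesis
    unfolding g(2)
    by (cases "eexpect P0 (payoff z y)"; cases "eexpect P0 (\<lambda>\<omega>. B lam (X \<omega>) \<theta>1 \<theta>2)") (auto simp: algebra_simps)
qed

section \<open>The perturbed problem over simple functions\<close>

definition K :: "(real \<times> real) set" where
  "K = {(t, y). t \<in> d2.D \<and> 0 < t \<and> y \<in> d1.D}"

text \<open>Simple functions make all integrals below finite although \<open>X\<close> is only
  integrable. In \<open>K\<close>, the condition \<open>0 < t\<close> makes the passage between
  \<open>(t, y)\<close> and \<open>(t, t * y)\<close> invertible.\<close>

definition admissible :: "('a \<Rightarrow> real \<times> real) \<Rightarrow> bool" where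
  "admissible s \<longleftrightarrow> simple_function P0 s \<and> (\<forall>\<omega>. s \<omega> \<in> K)"

text \<open>The linear constraints read \<open>mass s = (1, 1)\<close>; other masses are kept as
  perturbations, in which the supergradient is taken.\<close>

definition mass :: "('a \<Rightarrow> real \<times> real) \<Rightarrow> real \<times> real" where
  "mass s = (\<integral>\<omega>. fst (s \<omega>) \<partial>P0, \<integral>\<omega>. fst (s \<omega>) * snd (s \<omega>) \<partial>P0)"

definition pen :: "('a \<Rightarrow> real \<times> real) \<Rightarrow> real" where
  "pen s = (\<integral>\<omega>. d2.f (fst (s \<omega>)) \<partial>P0)"

definition val :: "('a \<Rightarrow> real \<times> real) \<Rightarrow> real" where
  "val s = (\<integral>\<omega>. - X \<omega> * (fst (s \<omega>) * snd (s \<omega>)) - fst (s \<omega>) * d1.f (snd (s \<omega>)) \<partial>P0)"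

lemma integrable_simple_image:
  fixes h :: "'b \<Rightarrow> real"
  assumes "simple_function P0 s"
  shows "integrable P0 (\<lambda>\<omega>. h (s \<omega>))" "integrable P0 (\<lambda>\<omega>. X \<omega> * h (s \<omega>))"
proof -
  have s: "simple_function P0 (\<lambda>\<omega>. h (s \<omega>))" by (rule simple_function_compose1[OF assms])
  then have [measurable]: "(\<lambda>\<omega>. h (s \<omega>)) \<in> borel_measurable P0" by (rule borel_measurable_simple_function)
  show "integrable P0 (\<lambda>\<omega>. h (s \<omega>))"
    using s by (intro integrable_simple_function) (auto simp: emeasure_eq_measure)
  have "finite ((\<lambda>\<omega>. h (s \<omega>)) ` space P0)" using s by (rule simple_functionD)
  then have "bounded ((\<lambda>\<omega>. h (s \<omega>)) ` space P0)" by (rule finite_imp_bounded)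
  then obtain b where b: "\<And>\<omega>. \<omega> \<in> space P0 \<Longrightarrow> \<bar>h (s \<omega>)\<bar> \<le> b" by (auto simp: bounded_iff)
  show "integrable P0 (\<lambda>\<omega>. X \<omega> * h (s \<omega>))"
  proof (rule Bochner_Integration.integrable_bound)
    show "integrable P0 (\<lambda>\<omega>. X \<omega> * b)" using X by simp
    show "AE \<omega> in P0. norm (X \<omega> * h (s \<omega>)) \<le> norm (X \<omega> * b)"
    proof (rule AE_I2)
      fix \<omega> assume "\<omega> \<in> space P0"
      then have "\<bar>h (s \<omega>)\<bar> \<le> \<bar>b\<bar>" using b by fastforce
      then show "norm (X \<omega> * h (s \<omega>)) \<le> norm (X \<omega> * b)" by (simp add: abs_mult mult_left_mono)
    qed
  qed measurable
qed

lemma admissible_integrable: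
  assumes "admissible s"
  shows "integrable P0 (\<lambda>\<omega>. fst (s \<omega>))" "integrable P0 (\<lambda>\<omega>. fst (s \<omega>) * snd (s \<omega>))"
    "integrable P0 (\<lambda>\<omega>. d2.f (fst (s \<omega>)))"
    "integrable P0 (\<lambda>\<omega>. - X \<omega> * (fst (s \<omega>) * snd (s \<omega>)) - fst (s \<omega>) * d1.f (snd (s \<omega>)))"
proof -
  have s: "simple_function P0 s" using assms by (simp add: admissible_def)
  note i = integrable_simple_image[OF s]
  show "integrable P0 (\<lambda>\<omega>. fst (s \<omega>))" "integrable P0 (\<lambda>\<omega>. fst (s \<omega>) * snd (s \<omega>))"
    "integrable P0 (\<lambda>\<omega>. d2.f (fst (s \<omega>)))"
    using i(1)[of fst] i(1)[of "\<lambda>p. fst p * snd p"] i(1)[of "\<lambda>p. d2.f (fst p)"] by auto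
  show "integrable P0 (\<lambda>\<omega>. - X \<omega> * (fst (s \<omega>) * snd (s \<omega>)) - fst (s \<omega>) * d1.f (snd (s \<omega>)))"
    using i(2)[of "\<lambda>p. fst p * snd p"] i(1)[of "\<lambda>p. fst p * d1.f (snd p)"] by auto
qed

text \<open>In the coordinates \<open>(t, t y)\<close> this is the convexity of the perspective \<open>(t, w) \<mapsto> t \<phi>1(w/t)\<close>.\<close>

lemma K_combination:
  assumes "(t, y) \<in> K" "(t', y') \<in> K" "0 \<le> u" "u \<le> 1"
  defines "T \<equiv> (1 - u) * t + u * t'"
  defines "Y \<equiv> ((1 - u) * (t * y) + u * (t' * y')) / T"
  shows "(T, Y) \<in> K" "T * Y = (1 - u) * (t * y) + u * (t' * y')"
    "d2.f T \<le> (1 - u) * d2.f t + u * d2.f t'"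
    "T * d1.f Y \<le> (1 - u) * (t * d1.f y) + u * (t' * d1.f y')"
proof -
  have K: "t \<in> d2.D" "0 < t" "y \<in> d1.D" "t' \<in> d2.D" "0 < t'" "y' \<in> d1.D"
    using assms by (auto simp: K_def)
  have T: "0 < T"
    using K assms(3,4) by (cases "u = 0") (auto simp: T_def intro!: add_nonneg_pos)
  have T2: "T \<in> d2.D \<and> d2.f T \<le> (1 - u) * d2.f t + u * d2.f t'"
    unfolding T_def by (intro d2.convex_combination K assms)
  \<comment> \<open>Averaging \<open>(t, t y)\<close> with weight \<open>u\<close> averages
    \<open>y\<close> with weight \<open>v\<close>, in proportion to the masses; multiplication by
    \<open>T\<close> returns to the original weights (\<open>dist\<close>).\<close>
  define v where "v = u * t' / T"
  have vT: "T * v = u * t'" "T * (1 - v) = (1 - u) * t"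
    using T by (simp_all add: v_def right_diff_distrib) (simp add: T_def)
  have "0 \<le> T * v" "0 \<le> T * (1 - v)" unfolding vT using K assms(3,4) by auto
  then have v: "0 \<le> v" "v \<le> 1" using T by (auto simp: zero_le_mult_iff)
  have dist: "T * ((1 - v) * a + v * b) = (1 - u) * (t * a) + u * (t' * b)" for a b
  proof -
    have "T * ((1 - v) * a + v * b) = T * (1 - v) * a + T * v * b" by (simp add: distrib_left mult.assoc)
    then show ?thesis unfolding vT by (simp add: mult.assoc)
  qed
  have Y: "Y = (1 - v) * y + v * y'"
    using dist[of y y'] T by (simp add: Y_def nonzero_divide_eq_eq mult.commute)
  have Y2: "Y \<in> d1.D \<and> d1.f Y \<le> (1 - v) * d1.f y + v * d1.f y'"
    unfolding Y by (intro d1.convex_combination K v)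
  show "(T, Y) \<in> K" using T T2 Y2 by (simp add: K_def)
  show "T * Y = (1 - u) * (t * y) + u * (t' * y')" using T by (simp add: Y_def)
  show "d2.f T \<le> (1 - u) * d2.f t + u * d2.f t'" using T2 by simp
  have "T * d1.f Y \<le> T * ((1 - v) * d1.f y + v * d1.f y')" using T Y2 by (intro mult_left_mono) auto
  also have "\<dots> = (1 - u) * (t * d1.f y) + u * (t' * d1.f y')"
    by (rule dist)
  finally show "T * d1.f Y \<le> (1 - u) * (t * d1.f y) + u * (t' * d1.f y')" .
qed

text \<open>Mixing in the coordinates \<open>(t, t y)\<close> at every point keeps the mass affine,
  the penalty convex and the value concave, which is what convexity of \<open>hypo\<close> rests
  on.\<close>

lemma admissible_combination:
  assumes s: "admissible s" and s': "admissible s'" and u: "0 \<le> u" "u \<le> 1"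
  obtains s'' where "admissible s''" "mass s'' = (1 - u) *\<^sub>R mass s + u *\<^sub>R mass s'"
    "pen s'' \<le> (1 - u) * pen s + u * pen s'" "(1 - u) * val s + u * val s' \<le> val s''"
proof -
  define k where "k = (\<lambda>(t, y) (t', y'). ((1 - u) * t + u * t', ((1 - u) * (t * y) + u * (t' * y')) / ((1 - u) * t + u * t')))"
  define s'' where "s'' = (\<lambda>\<omega>. k (s \<omega>) (s' \<omega>))"
  have "simple_function P0 s''"
    unfolding s''_def by (rule simple_function_compose2) (use s s' in \<open>auto simp: admissible_def\<close>)
  have sK: "s \<omega> \<in> K" "s' \<omega> \<in> K" for \<omega> using s s' by (auto simp: admissible_def)
  have k: "s'' \<omega> \<in> K" "fst (s'' \<omega>) = (1 - u) * fst (s \<omega>) + u * fst (s' \<omega>)"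
    "fst (s'' \<omega>) * snd (s'' \<omega>) = (1 - u) * (fst (s \<omega>) * snd (s \<omega>)) + u * (fst (s' \<omega>) * snd (s' \<omega>))"
    "d2.f (fst (s'' \<omega>)) \<le> (1 - u) * d2.f (fst (s \<omega>)) + u * d2.f (fst (s' \<omega>))"
    "fst (s'' \<omega>) * d1.f (snd (s'' \<omega>)) \<le> (1 - u) * (fst (s \<omega>) * d1.f (snd (s \<omega>))) + u * (fst (s' \<omega>) * d1.f (snd (s' \<omega>)))" for \<omega>
  proof -
    obtain t y t' y' where e: "s \<omega> = (t, y)" "s' \<omega> = (t', y')" by (metis surj_pair)
    have tK: "(t, y) \<in> K" "(t', y') \<in> K" using sK[of \<omega>] e by auto
    note c = K_combination[OF tK u]
    show "s'' \<omega> \<in> K" "fst (s'' \<omega>) = (1 - u) * fst (s \<omega>) + u * fst (s' \<omega>)"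
      "fst (s'' \<omega>) * snd (s'' \<omega>) = (1 - u) * (fst (s \<omega>) * snd (s \<omega>)) + u * (fst (s' \<omega>) * snd (s' \<omega>))"
      "d2.f (fst (s'' \<omega>)) \<le> (1 - u) * d2.f (fst (s \<omega>)) + u * d2.f (fst (s' \<omega>))"
      "fst (s'' \<omega>) * d1.f (snd (s'' \<omega>)) \<le> (1 - u) * (fst (s \<omega>) * d1.f (snd (s \<omega>))) + u * (fst (s' \<omega>) * d1.f (snd (s' \<omega>)))"
      unfolding s''_def e k_def prod.case fst_conv snd_conv by (rule c refl)+
  qed
  have a: "admissible s''" using \<open>simple_function P0 s''\<close> k(1) by (simp add: admissible_def)
  note i = admissible_integrable[OF s] and i' = admissible_integrable[OF s'] and i'' = admissible_integrable[OF a]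
  have "mass s'' = (1 - u) *\<^sub>R mass s + u *\<^sub>R mass s'"
    unfolding mass_def k(3) unfolding k(2) using i i' by simp
  moreover have "pen s'' \<le> (\<integral>\<omega>. (1 - u) * d2.f (fst (s \<omega>)) + u * d2.f (fst (s' \<omega>)) \<partial>P0)"
    unfolding pen_def using i i' i'' k(4) by (intro integral_mono) auto
  then have "pen s'' \<le> (1 - u) * pen s + u * pen s'" unfolding pen_def using i i' by simp
  moreover have "(\<integral>\<omega>. (1 - u) * (- X \<omega> * (fst (s \<omega>) * snd (s \<omega>)) - fst (s \<omega>) * d1.f (snd (s \<omega>)))
      + u * (- X \<omega> * (fst (s' \<omega>) * snd (s' \<omega>)) - fst (s' \<omega>) * d1.f (snd (s' \<omega>))) \<partial>P0) \<le> val s''"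
    unfolding val_def
  proof (rule integral_mono)
    fix \<omega>
    have e: "- X \<omega> * (fst (s'' \<omega>) * snd (s'' \<omega>)) = (1 - u) * (- X \<omega> * (fst (s \<omega>) * snd (s \<omega>)))
      + u * (- X \<omega> * (fst (s' \<omega>) * snd (s' \<omega>)))" unfolding k(3) by (simp add: algebra_simps)
    show "(1 - u) * (- X \<omega> * (fst (s \<omega>) * snd (s \<omega>)) - fst (s \<omega>) * d1.f (snd (s \<omega>)))
      + u * (- X \<omega> * (fst (s' \<omega>) * snd (s' \<omega>)) - fst (s' \<omega>) * d1.f (snd (s' \<omega>)))
      \<le> - X \<omega> * (fst (s'' \<omega>) * snd (s'' \<omega>)) - fst (s'' \<omega>) * d1.f (snd (s'' \<omega>))"
      unfolding e using k(5)[of \<omega>] unfolding right_diff_distrib by linarith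
  qed (use i i' i'' in auto)
  then have "(1 - u) * val s + u * val s' \<le> val s''" unfolding val_def using i i' by simp
  ultimately show ?thesis using that a by blast
qed

text \<open>Up to heights that are suprema without being attained, the hypograph of the perturbation
  function, which assigns to (m, d) the supremum of \<open>val s\<close> subject to
  \<open>mass s = m\<close> and \<open>pen s \<le> d\<close>.\<close>

definition hypo :: "(((real \<times> real) \<times> real) \<times> real) set" where
  "hypo = {((mass s, d), c) | s d c. admissible s \<and> pen s \<le> d \<and> c \<le> val s}"

lemma convex_hypo: "convex hypo"
proof (rule convexI)
  fix x y :: "((real \<times> real) \<times> real) \<times> real" and a u :: real
  assume x: "x \<in> hypo" and y: "y \<in> hypo" and u: "0 \<le> a" "0 \<le> u" "a + u = 1"
  have a: "a = 1 - u" using u by simp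
  obtain s d c where x': "x = ((mass s, d), c)" "admissible s" "pen s \<le> d" "c \<le> val s"
    using x by (auto simp: hypo_def)
  obtain s' d' c' where y': "y = ((mass s', d'), c')" "admissible s'" "pen s' \<le> d'" "c' \<le> val s'"
    using y by (auto simp: hypo_def)
  obtain s'' where s'': "admissible s''" "mass s'' = (1 - u) *\<^sub>R mass s + u *\<^sub>R mass s'"
    "pen s'' \<le> (1 - u) * pen s + u * pen s'" "(1 - u) * val s + u * val s' \<le> val s''"
    using admissible_combination[OF x'(2) y'(2), of u] u by auto
  have "(1 - u) * pen s + u * pen s' \<le> (1 - u) * d + u * d'" "(1 - u) * c + u * c' \<le> (1 - u) * val s + u * val s'"
    using x' y' u by (auto intro!: add_mono mult_left_mono)
  then have "pen s'' \<le> (1 - u) * d + u * d'" "(1 - u) * c + u * c' \<le> val s''"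
    using s'' by auto
  then have "((mass s'', (1 - u) * d + u * d'), (1 - u) * c + u * c') \<in> hypo"
    using s''(1) by (auto simp: hypo_def)
  then show "a *\<^sub>R x + u *\<^sub>R y \<in> hypo" by (simp add: x' y' a s'')
qed

lemma constant_in_hypo:
  assumes "p \<in> d2.D" "0 < p" "q / p \<in> d1.D" "d2.f p \<le> d"
  shows "((p, q), d) \<in> fst ` hypo"
proof -
  let ?s = "\<lambda>\<omega>::'a. (p, q / p)"
  have "admissible ?s" using assms by (simp add: admissible_def K_def)
  moreover have "mass ?s = (p, q)" using assms by (simp add: mass_def prob_space)
  moreover have "pen ?s \<le> d" using assms by (simp add: pen_def prob_space)
  ultimately have "((mass ?s, d), val ?s) \<in> hypo" unfolding hypo_def by blast
  then show ?thesis using \<open>mass ?s = (p, q)\<close> by (metis fst_conv image_eqI)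
qed

text \<open>The Slater condition in terms of neighbourhoods: 1 is interior to both domains, and
  \<open>f\<close> is continuous at 1 with value 0, hence stays below levels near
  \<open>r > 0\<close>.\<close>

lemma eventually_constant_admissible:
  "\<forall>\<^sub>F x in nhds (1, 1). fst x \<in> d2.D \<and> 0 < fst x \<and> snd x / fst x \<in> d1.D"
  "0 < r \<Longrightarrow> \<forall>\<^sub>F x in nhds ((1, 1 :: real), r). d2.f (fst (fst x)) < snd x"
proof -
  have f: "(fst \<longlongrightarrow> 1) (nhds (1::real, 1::real))" and s: "(snd \<longlongrightarrow> 1) (nhds (1::real, 1::real))"
    using tendsto_fst[OF filterlim_ident, of "(1::real, 1::real)"] tendsto_snd[OF filterlim_ident, of "(1::real, 1::real)"]
    by (simp_all add: filterlim_ident)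
  have "((\<lambda>x. snd x / fst x) \<longlongrightarrow> 1 / 1) (nhds (1::real, 1::real))" by (intro tendsto_divide f s) simp
  then have d: "((\<lambda>x. snd x / fst x) \<longlongrightarrow> 1) (nhds (1::real, 1::real))" by simp
  have "\<forall>\<^sub>F x in nhds (1, 1 :: real). fst x \<in> interior d2.D"
    by (rule topological_tendstoD[OF f]) (use d2.one_interior in auto)
  moreover have "\<forall>\<^sub>F x in nhds (1, 1). snd x / fst x \<in> interior d1.D"
    by (rule topological_tendstoD[OF d]) (use d1.one_interior in auto)
  ultimately show "\<forall>\<^sub>F x in nhds (1, 1). fst x \<in> d2.D \<and> 0 < fst x \<and> snd x / fst x \<in> d1.D"
    by eventually_elim (use interior_subset d2.interior_D_pos in blast)
  assume r: "0 < r"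
  have "isCont d2.f 1" using d2.continuous_on_f d2.one_interior by (simp add: continuous_on_eq_continuous_at)
  then have "(d2.f \<longlongrightarrow> d2.f 1) (nhds 1)" by (simp only: isCont_def tendsto_at_iff_tendsto_nhds)
  then have c: "(d2.f \<longlongrightarrow> 0) (nhds 1)" by simp
  have i: "((\<lambda>x. x) \<longlongrightarrow> ((1::real, 1::real), r)) (nhds ((1, 1), r))" by (rule filterlim_ident)
  have "((\<lambda>x. d2.f (fst (fst x))) \<longlongrightarrow> 0) (nhds ((1::real, 1::real), r))"
    by (rule filterlim_compose[OF c]) (use tendsto_fst[OF tendsto_fst[OF i]] in simp)
  then have "((\<lambda>x. d2.f (fst (fst x)) - snd x) \<longlongrightarrow> 0 - r) (nhds ((1::real, 1::real), r))"
    by (intro tendsto_diff) (use tendsto_snd[OF i] in simp_all)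
  then have "\<forall>\<^sub>F x in nhds ((1::real, 1::real), r). d2.f (fst (fst x)) - snd x < 0"
    by (rule order_tendstoD) (use r in simp)
  then show "\<forall>\<^sub>F x in nhds ((1, 1 :: real), r). d2.f (fst (fst x)) < snd x" by simp
qed

lemma interior_fst_hypo:
  assumes r: "0 < r"
  shows "((1, 1), r) \<in> interior (fst ` hypo)"
proof -
  have i: "((\<lambda>x. x) \<longlongrightarrow> ((1::real, 1::real), r)) (nhds ((1, 1), r))" by (rule filterlim_ident)
  have "filterlim fst (nhds (1::real, 1::real)) (nhds ((1, 1), r))" using tendsto_fst[OF i] by simp
  from eventually_compose_filterlim[OF eventually_constant_admissible(1) this] eventually_constant_admissible(2)[OF r]
  have "\<forall>\<^sub>F x in nhds ((1, 1), r). x \<in> fst ` hypo"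
  proof eventually_elim
    case (elim x)
    then show ?case using constant_in_hypo[of "fst (fst x)" "snd (fst x)" "snd x"] by simp
  qed
  then show ?thesis unfolding eventually_nhds by (meson interiorI subsetI)
qed

text \<open>A bound on the integrated Lagrangian over simple selectors bounds the expectation of its
  pointwise supremum. The selectors take values in the sets \<open>C\<close>, whose points are
  positive, hence in \<open>K\<close>.\<close>

lemma eexpect_B_le:
  assumes lam: "0 \<le> lam"
    and bound: "\<And>s. admissible s \<Longrightarrow> val s + \<theta>1 * fst (mass s) + \<theta>2 * snd (mass s) - lam * pen s \<le> W"
  shows "eexpect P0 (\<lambda>\<omega>. B lam (X \<omega>) \<theta>1 \<theta>2) \<le> ereal W"
  unfolding B_eq_countable_SUP[OF lam]
proof (rule eexpect_SUP_le_of_simple_selectors)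
  show "countable (d2.C \<times> d1.C)" by (intro countable_SIGMA d1.countable_C d2.countable_C)
  show "(1, 1) \<in> d2.C \<times> d1.C" using d1.one_C d2.one_C by simp
  show "integrable P0 (\<lambda>\<omega>. psi lam (X \<omega>) \<theta>1 \<theta>2 b)" for b by (rule integrable_psi)
  fix s assume s: "simple_function P0 s" "\<And>\<omega>. s \<omega> \<in> d2.C \<times> d1.C"
  have "s \<omega> \<in> K" for \<omega>
  proof -
    obtain t y where e: "s \<omega> = (t, y)" by (cases "s \<omega>")
    then have "t \<in> d2.C" "y \<in> d1.C" using s(2)[of \<omega>] by auto
    then show ?thesis using d1.C_subset_D d2.C_subset_D d2.interior_D_pos by (auto simp: e K_def d2.C_def)
  qed
  then have a: "admissible s" using s by (simp add: admissible_def)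
  note i = admissible_integrable[OF a]
  have "psi lam (X \<omega>) \<theta>1 \<theta>2 (s \<omega>) = (- X \<omega> * (fst (s \<omega>) * snd (s \<omega>)) - fst (s \<omega>) * d1.f (snd (s \<omega>)))
      + \<theta>1 * fst (s \<omega>) + \<theta>2 * (fst (s \<omega>) * snd (s \<omega>)) - lam * d2.f (fst (s \<omega>))" for \<omega>
    by (cases "s \<omega>") (simp add: psi_def algebra_simps)
  then have "(\<integral>\<omega>. psi lam (X \<omega>) \<theta>1 \<theta>2 (s \<omega>) \<partial>P0) = val s + \<theta>1 * fst (mass s) + \<theta>2 * snd (mass s) - lam * pen s"
    unfolding val_def mass_def pen_def using i by simp
  then show "(\<integral>\<omega>. psi lam (X \<omega>) \<theta>1 \<theta>2 (s \<omega>) \<partial>P0) \<le> W" using bound[OF a] by simp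
qed

text \<open>The supergradient at the levels \<open>((1, 1), r)\<close> bounds the integrated
  Lagrangian of all simple pairs by one constant, as \<open>eexpect_B_le\<close> demands.\<close>

lemma strong_duality_s:
  assumes r: "0 < r" and V: "\<And>s. admissible s \<Longrightarrow> mass s = (1, 1) \<Longrightarrow> pen s \<le> r \<Longrightarrow> val s \<le> V"
  obtains \<theta>1 \<theta>2 lam where "0 \<le> lam"
    "ereal (- \<theta>1 - \<theta>2 + lam * r) + eexpect P0 (\<lambda>\<omega>. B lam (X \<omega>) \<theta>1 \<theta>2) \<le> ereal V"
proof -
  have "c \<le> V" if "(((1, 1), r), c) \<in> hypo" for c
    using that V by (force simp: hypo_def)
  then obtain \<alpha> where \<alpha>: "\<And>x c. (x, c) \<in> hypo \<Longrightarrow> c + \<alpha> \<bullet> x \<le> V + \<alpha> \<bullet> ((1, 1), r)"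
    using concave_hypograph_supergradient[OF convex_hypo interior_fst_hypo[OF r]] by metis
  obtain \<theta>1 \<theta>2 m where m: "\<alpha> = ((\<theta>1, \<theta>2), m)" by (metis surj_pair)
  have A: "c + \<theta>1 * fst (mass s) + \<theta>2 * snd (mass s) + m * d \<le> V + \<theta>1 + \<theta>2 + m * r"
    if "admissible s" "pen s \<le> d" "c \<le> val s" for s d c
  proof -
    have "((mass s, d), c) \<in> hypo" using that unfolding hypo_def by blast
    from \<alpha>[OF this] show ?thesis by (cases "mass s") (simp add: m algebra_simps)
  qed
  \<comment> \<open>The level \<open>d\<close> in \<open>hypo\<close> may be raised freely, so a
    positive slope \<open>m\<close> contradicts the upper bound: a level of at least
    \<open>k / m + 1\<close> would give \<open>k + m \<le> k\<close>.\<close>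
  have m0: "m \<le> 0"
  proof (rule ccontr)
    assume "\<not> m \<le> 0"
    then have "0 < m" by simp
    obtain s where s: "admissible s"
      using interior_fst_hypo[OF r] interior_subset unfolding hypo_def by fastforce
    define k where "k = V + \<theta>1 + \<theta>2 + m * r - (val s + \<theta>1 * fst (mass s) + \<theta>2 * snd (mass s))"
    have "m * d \<le> k" if "pen s \<le> d" for d using A[OF s that order_refl] by (simp add: k_def)
    from this[of "max (pen s) (k / m + 1)"] have "m * (k / m + 1) \<le> k"
      using \<open>0 < m\<close> by (smt (verit) max.cobounded1 max.cobounded2 mult_left_mono)
    moreover have "m * (k / m + 1) = k + m" using \<open>0 < m\<close> by (simp add: distrib_left)
    ultimately show False using \<open>0 < m\<close> by simp
  qed
  have E: "eexpect P0 (\<lambda>\<omega>. B (- m) (X \<omega>) \<theta>1 \<theta>2) \<le> ereal (V + \<theta>1 + \<theta>2 + m * r)"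
    by (rule eexpect_B_le) (use m0 A[OF _ order_refl order_refl] in auto)
  then have "ereal (- \<theta>1 - \<theta>2 + (- m) * r) + eexpect P0 (\<lambda>\<omega>. B (- m) (X \<omega>) \<theta>1 \<theta>2) \<le> ereal V"
    by (cases "eexpect P0 (\<lambda>\<omega>. B (- m) (X \<omega>) \<theta>1 \<theta>2)") auto
  from that[OF _ this] show ?thesis using m0 by simp
qed

lemma strong_duality_l:
  assumes V: "\<And>s. admissible s \<Longrightarrow> mass s = (1, 1) \<Longrightarrow> val s - pen s \<le> V"
  obtains \<theta>1 \<theta>2 where
    "ereal (- \<theta>1 - \<theta>2) + eexpect P0 (\<lambda>\<omega>. B 1 (X \<omega>) \<theta>1 \<theta>2) \<le> ereal V"
proof -
  \<comment> \<open>Subtracting the penalty level from the height turns the hypograph of the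
    constrained problem into one for the penalized problem; linearity of \<open>L\<close> preserves
    convexity.\<close>
  define L :: "((real \<times> real) \<times> real) \<times> real \<Rightarrow> (real \<times> real) \<times> real" where "L = (\<lambda>((p, d), c). (p, c - d))"
  have "linear L" unfolding L_def by (rule linearI) (auto simp: algebra_simps)
  then have conv: "convex (L ` hypo)" using convex_hypo by (rule convex_linear_image)
  have int: "(1, 1) \<in> interior (fst ` L ` hypo)"
  proof -
    have "\<forall>\<^sub>F x in nhds (1, 1). x \<in> fst ` L ` hypo"
      using eventually_constant_admissible(1)
    proof eventually_elim
      case (elim x)
      then have "(x, d2.f (fst x)) \<in> fst ` hypo"
        using constant_in_hypo[of "fst x" "snd x" "d2.f (fst x)"] by simp
      then show ?case by (force simp: L_def image_iff)
    qed
    then show ?thesis unfolding eventually_nhds by (meson interiorI subsetI)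
  qed
  have "c \<le> V" if "((1, 1), c) \<in> L ` hypo" for c
    using that V by (force simp: hypo_def L_def)
  then obtain \<alpha> where \<alpha>: "\<And>x c. (x, c) \<in> L ` hypo \<Longrightarrow> c + \<alpha> \<bullet> x \<le> V + \<alpha> \<bullet> (1, 1)"
    using concave_hypograph_supergradient[OF conv int] by metis
  obtain \<theta>1 \<theta>2 where m: "\<alpha> = (\<theta>1, \<theta>2)" by (metis surj_pair)
  have A: "val s - pen s + \<theta>1 * fst (mass s) + \<theta>2 * snd (mass s) \<le> V + \<theta>1 + \<theta>2" if "admissible s" for s
  proof -
    have "((mass s, pen s), val s) \<in> hypo"
      unfolding hypo_def by (intro CollectI exI[of _ s] exI[of _ "pen s"] exI[of _ "val s"]) (use that in simp)
    then have "(mass s, val s - pen s) \<in> L ` hypo" by (force simp: L_def)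
    from \<alpha>[OF this] show ?thesis by (cases "mass s") (simp add: m algebra_simps)
  qed
  have "eexpect P0 (\<lambda>\<omega>. B 1 (X \<omega>) \<theta>1 \<theta>2) \<le> ereal (V + \<theta>1 + \<theta>2)"
    by (rule eexpect_B_le) (use A in \<open>auto simp: algebra_simps\<close>)
  then have "ereal (- \<theta>1 - \<theta>2) + eexpect P0 (\<lambda>\<omega>. B 1 (X \<omega>) \<theta>1 \<theta>2) \<le> ereal V"
    by (cases "eexpect P0 (\<lambda>\<omega>. B 1 (X \<omega>) \<theta>1 \<theta>2)") auto
  then show ?thesis by (rule that)
qed

section \<open>Passage from densities to measures, and weak duality\<close>

lemma feasible_pair_densities:
  assumes Q: "Q \<in> feasible_l P0" and Q': "Q' \<in> feasible_l Q"
  obtains z y where "z \<in> borel_measurable P0" "y \<in> borel_measurable P0" "\<And>\<omega>. 0 \<le> z \<omega>" "\<And>\<omega>. 0 \<le> y \<omega>"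
    "Q = density P0 (\<lambda>\<omega>. ennreal (z \<omega>))" "Q' = density Q (\<lambda>\<omega>. ennreal (y \<omega>))" "prob_space Q"
    "integrable P0 z" "(\<integral>\<omega>. z \<omega> \<partial>P0) = 1"
    "integrable P0 (\<lambda>\<omega>. z \<omega> * y \<omega>)" "(\<integral>\<omega>. z \<omega> * y \<omega> \<partial>P0) = 1"
proof -
  have p: "prob_space Q" "prob_space Q'" and sQ: "sets Q = sets P0"
    using Q Q' by (auto simp: feasible_l_def prob_on_def)
  obtain z :: "'a \<Rightarrow> real" where z: "z \<in> borel_measurable P0" "\<And>\<omega>. 0 \<le> z \<omega>" "Q = density P0 (\<lambda>\<omega>. ennreal (z \<omega>))"
    using feasible_l_density[OF prob_space_axioms Q] by blast
  obtain y :: "'a \<Rightarrow> real" where y: "y \<in> borel_measurable Q" "\<And>\<omega>. 0 \<le> y \<omega>" "Q' = density Q (\<lambda>\<omega>. ennreal (y \<omega>))"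
    using feasible_l_density[OF p(1) Q'] by blast
  have ym: "y \<in> borel_measurable P0" using y(1) measurable_cong_sets[OF sQ refl] by blast
  have "Q' = density P0 (\<lambda>\<omega>. ennreal (z \<omega> * y \<omega>))"
    using density_density_mult[OF z(1) ym z(2)] y(3) z(3) by simp
  then have "integrable P0 (\<lambda>\<omega>. z \<omega> * y \<omega>)" "(\<integral>\<omega>. z \<omega> * y \<omega> \<partial>P0) = 1"
    using prob_density_integral[of "\<lambda>\<omega>. z \<omega> * y \<omega>" P0] z(1,2) ym y(2) p(2) by auto
  moreover have "integrable P0 z" "(\<integral>\<omega>. z \<omega> \<partial>P0) = 1"
    using prob_density_integral[OF z(1,2)] z(3) p(1) by auto
  ultimately show ?thesis using that[OF z(1) ym z(2) y(2) z(3) y(3) p(1)] by blast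
qed

lemma feasible_pairI:
  assumes z: "z \<in> borel_measurable P0" "\<And>\<omega>. 0 \<le> z \<omega>" "integrable P0 z" "(\<integral>\<omega>. z \<omega> \<partial>P0) = 1"
    and y: "y \<in> borel_measurable P0" "\<And>\<omega>. 0 \<le> y \<omega>" "integrable P0 (\<lambda>\<omega>. z \<omega> * y \<omega>)" "(\<integral>\<omega>. z \<omega> * y \<omega> \<partial>P0) = 1"
    and Q: "Q = density P0 (\<lambda>\<omega>. ennreal (z \<omega>))" and Q': "Q' = density P0 (\<lambda>\<omega>. ennreal (z \<omega> * y \<omega>))"
  shows "Q \<in> feasible_l P0" "Q' \<in> feasible_l Q" "Q' = density Q (\<lambda>\<omega>. ennreal (y \<omega>))" "prob_space Q"
proof -
  show Qf: "Q \<in> feasible_l P0" unfolding Q by (rule feasible_l_densityI[OF z])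
  then show "prob_space Q" by (simp add: feasible_l_def prob_on_def)
  show e: "Q' = density Q (\<lambda>\<omega>. ennreal (y \<omega>))"
    unfolding Q Q' by (rule density_density_mult[symmetric]) (use z y in auto)
  have "Q' \<in> feasible_l P0" unfolding Q'
    by (rule feasible_l_densityI) (use z y in auto)
  then have "prob_space Q'" by (simp add: feasible_l_def prob_on_def)
  moreover have "absolutely_continuous Q Q'"
    unfolding e by (rule absolutely_continuousI_density) (use y(1) in \<open>simp add: Q\<close>)
  ultimately show "Q' \<in> feasible_l Q" by (simp add: feasible_l_def prob_on_def e)
qed

text \<open>A measure that is not absolutely continuous has penalty \<infinity>, above every real
  level.\<close>

lemma feasible_s_subset: "Q \<in> feasible_s P0 \<phi>2 r \<Longrightarrow> Q \<in> feasible_l P0"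
  by (auto simp: feasible_s_def feasible_l_def phi_div_def top_unique split: if_splits)

lemma dual_s_closed_eq:
  "0 \<le> lam \<Longrightarrow> dual_s_closed P0 \<phi>1 \<phi>2 r X ((\<theta>1, \<theta>2), lam)
    = ereal (- \<theta>1 - \<theta>2 + lam * r) + eexpect P0 (\<lambda>\<omega>. B lam (X \<omega>) \<theta>1 \<theta>2)"
  by (simp add: dual_s_closed_def beta_s_closed_eq)

lemma dual_s_eq:
  "0 < lam \<Longrightarrow> dual_s P0 \<phi>1 \<phi>2 r X ((\<theta>1, \<theta>2), lam)
    = ereal (- \<theta>1 - \<theta>2 + lam * r) + eexpect P0 (\<lambda>\<omega>. B lam (X \<omega>) \<theta>1 \<theta>2)"
  by (simp add: dual_s_def beta_s_pos)

lemma dual_l_eq: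
  "dual_l P0 \<phi>1 \<phi>2 X (\<theta>1, \<theta>2) = ereal (- \<theta>1 - \<theta>2) + eexpect P0 (\<lambda>\<omega>. B 1 (X \<omega>) \<theta>1 \<theta>2)"
  by (simp add: dual_l_def beta_l_eq)

lemma dual_s_closed_le_dual_s:
  assumes "0 \<le> lam"
  shows "dual_s_closed P0 \<phi>1 \<phi>2 r X ((\<theta>1, \<theta>2), lam) \<le> dual_s P0 \<phi>1 \<phi>2 r X ((\<theta>1, \<theta>2), lam)"
  unfolding dual_s_closed_eq[OF assms] dual_s_def prod.case
  by (intro add_left_mono eexpect_mono_AE) (simp add: B_le_beta_s[OF assms])

text \<open>The bound on the penalty forces \<open>z\<close> into the domain of \<phi>2 almost
  everywhere and makes \<open>d2.f (z \<omega>)\<close> integrable, as \<open>weak_duality\<close>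
  requires; then \<open>lam \<ge> 0\<close> lets \<open>r\<close> replace the actual
  penalty.\<close>

lemma weak_duality_s:
  assumes Q: "Q \<in> feasible_s P0 \<phi>2 r" and Q': "Q' \<in> feasible_l Q" and lam: "0 \<le> lam" and r: "0 < r"
  shows "primal_s \<phi>1 X Q Q' \<le> dual_s_closed P0 \<phi>1 \<phi>2 r X ((\<theta>1, \<theta>2), lam)"
proof -
  obtain z y where zy: "z \<in> borel_measurable P0" "y \<in> borel_measurable P0" "\<And>\<omega>. 0 \<le> z \<omega>" "\<And>\<omega>. 0 \<le> y \<omega>"
    "Q = density P0 (\<lambda>\<omega>. ennreal (z \<omega>))" "Q' = density Q (\<lambda>\<omega>. ennreal (y \<omega>))" "prob_space Q"
    and z: "integrable P0 z" "(\<integral>\<omega>. z \<omega> \<partial>P0) = 1"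
    and y: "integrable P0 (\<lambda>\<omega>. z \<omega> * y \<omega>)" "(\<integral>\<omega>. z \<omega> * y \<omega> \<partial>P0) = 1"
    using feasible_pair_densities[OF feasible_s_subset[OF Q] Q'] by blast
  note [measurable] = zy(1,2)
  have "(\<integral>\<^sup>+\<omega>. \<phi>2 (z \<omega>) \<partial>P0) \<le> ennreal r"
    using Q phi_div_Q[OF zy] by (simp add: feasible_s_def)
  then have fin: "(\<integral>\<^sup>+\<omega>. \<phi>2 (z \<omega>) \<partial>P0) \<noteq> \<infinity>" by (auto simp: top_unique)
  have "AE \<omega> in P0. \<phi>2 (z \<omega>) \<noteq> \<infinity>"
    by (rule nn_integral_noteq_infinite) (use fin in auto)
  then have D: "AE \<omega> in P0. z \<omega> \<in> d2.D" by eventually_elim (use d2.phi_notin in blast)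
  have "(\<integral>\<^sup>+\<omega>. \<phi>2 (z \<omega>) \<partial>P0) = (\<integral>\<^sup>+\<omega>. ennreal (d2.f (z \<omega>)) \<partial>P0)"
    by (rule nn_integral_cong_AE) (use D in eventually_elim, simp add: d2.phi_eq)
  with \<open>_ \<le> ennreal r\<close> have le: "(\<integral>\<^sup>+\<omega>. ennreal (d2.f (z \<omega>)) \<partial>P0) \<le> ennreal r" by simp
  have fm: "(\<lambda>\<omega>. d2.f (z \<omega>)) \<in> borel_measurable P0"
    using measurable_compose[OF zy(1) d2.measurable_f] .
  have f: "integrable P0 (\<lambda>\<omega>. d2.f (z \<omega>))"
    by (rule integrableI_nonneg[OF fm]) (use le d2.f_nonneg in \<open>auto intro: le_less_trans\<close>)
  have fr: "(\<integral>\<omega>. d2.f (z \<omega>) \<partial>P0) \<le> r"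
    using le nn_integral_eq_integral[OF f] d2.f_nonneg r by simp
  have "primal_s \<phi>1 X Q Q' = eexpect P0 (payoff z y)" by (rule primal_s_eq[OF zy])
  also have "\<dots> \<le> ereal (- \<theta>1 - \<theta>2 + lam * (\<integral>\<omega>. d2.f (z \<omega>) \<partial>P0)) + eexpect P0 (\<lambda>\<omega>. B lam (X \<omega>) \<theta>1 \<theta>2)"
    by (rule weak_duality[OF zy(1,2) lam z D y f])
  also have "\<dots> \<le> ereal (- \<theta>1 - \<theta>2 + lam * r) + eexpect P0 (\<lambda>\<omega>. B lam (X \<omega>) \<theta>1 \<theta>2)"
    using fr lam by (intro add_right_mono) (simp add: mult_left_mono)
  finally show ?thesis by (simp add: dual_s_closed_eq[OF lam])
qed

text \<open>The second penalty may be infinite here, so it stays inside the integrand and is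
  compared with \<open>B 1\<close> pointwise; where \<open>z\<close> leaves the domain of \<phi>2
  the integrand is -\<infinity>.\<close>

lemma weak_duality_l:
  assumes Q: "Q \<in> feasible_l P0" and Q': "Q' \<in> feasible_l Q"
  shows "primal_l P0 \<phi>1 \<phi>2 X Q Q' \<le> dual_l P0 \<phi>1 \<phi>2 X (\<theta>1, \<theta>2)"
proof -
  obtain z y where zy: "z \<in> borel_measurable P0" "y \<in> borel_measurable P0" "\<And>\<omega>. 0 \<le> z \<omega>" "\<And>\<omega>. 0 \<le> y \<omega>"
    "Q = density P0 (\<lambda>\<omega>. ennreal (z \<omega>))" "Q' = density Q (\<lambda>\<omega>. ennreal (y \<omega>))" "prob_space Q"
    and z: "integrable P0 z" "(\<integral>\<omega>. z \<omega> \<partial>P0) = 1"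
    and y: "integrable P0 (\<lambda>\<omega>. z \<omega> * y \<omega>)" "(\<integral>\<omega>. z \<omega> * y \<omega> \<partial>P0) = 1"
    using feasible_pair_densities[OF Q Q'] by blast
  note [measurable] = zy(1,2)
  let ?g = "\<lambda>\<omega>. \<theta>1 * z \<omega> + \<theta>2 * (z \<omega> * y \<omega>)"
  have g: "integrable P0 ?g" "(\<integral>\<omega>. ?g \<omega> \<partial>P0) = \<theta>1 + \<theta>2" using z y by simp_all
  have pt: "payoff z y \<omega> - enn2ereal (\<phi>2 (z \<omega>)) + ereal (?g \<omega>) \<le> B 1 (X \<omega>) \<theta>1 \<theta>2" for \<omega>
  proof (cases "z \<omega> \<in> d2.D")
    case True
    have e: "u - ereal a + ereal b = u + ereal (b - a)" for u a b by (cases u) auto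
    show ?thesis
      using payoff_le_B[OF True, of 1 "X \<omega>" "y \<omega>" \<theta>1 \<theta>2] d2.f_nonneg
      by (simp add: d2.phi_eq[OF True] payoff_def[of z y \<omega>] e)
  next
    case False
    \<comment> \<open>Excludes \<infinity> - \<infinity>, which \<open>ereal\<close> evaluates to
      \<infinity>.\<close>
    have "payoff z y \<omega> \<noteq> \<infinity>" by (cases "ennreal (z \<omega>) * \<phi>1 (y \<omega>)") (auto simp: payoff_def)
    then have "payoff z y \<omega> - \<infinity> = - \<infinity>" by (cases "payoff z y \<omega>") auto
    then show ?thesis by (simp add: d2.phi_notin[OF False])
  qed
  have "eexpect P0 (\<lambda>\<omega>. payoff z y \<omega> - enn2ereal (\<phi>2 (z \<omega>))) + ereal (\<theta>1 + \<theta>2)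
      = eexpect P0 (\<lambda>\<omega>. payoff z y \<omega> - enn2ereal (\<phi>2 (z \<omega>)) + ereal (?g \<omega>))"
    using g by (subst eexpect_add_integrable) auto
  also have "\<dots> \<le> eexpect P0 (\<lambda>\<omega>. B 1 (X \<omega>) \<theta>1 \<theta>2)"
    by (intro eexpect_mono_AE AE_I2 pt)
  finally show ?thesis
    unfolding primal_l_eq[OF zy] dual_l_eq
    by (cases "eexpect P0 (\<lambda>\<omega>. payoff z y \<omega> - enn2ereal (\<phi>2 (z \<omega>)))";
        cases "eexpect P0 (\<lambda>\<omega>. B 1 (X \<omega>) \<theta>1 \<theta>2)") (auto simp: algebra_simps)
qed

text \<open>Connects simple pairs with the suprema over measures: a pair of mass
  \<open>(1, 1)\<close> consists of the densities of feasible measures, so its value is a lower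
  bound for the primal supremum.\<close>

lemma admissible_primal:
  assumes s: "admissible s" and m: "mass s = (1, 1)"
  obtains Q Q' where "Q \<in> feasible_l P0" "Q' \<in> feasible_l Q" "phi_div \<phi>2 Q P0 = ennreal (pen s)"
    "primal_s \<phi>1 X Q Q' = ereal (val s)" "primal_l P0 \<phi>1 \<phi>2 X Q Q' = ereal (val s - pen s)"
proof -
  define z y where "z = (\<lambda>\<omega>. fst (s \<omega>))" and "y = (\<lambda>\<omega>. snd (s \<omega>))"
  have sK: "s \<omega> \<in> K" for \<omega> using s by (simp add: admissible_def)
  have zD: "z \<omega> \<in> d2.D" "0 < z \<omega>" and yD: "y \<omega> \<in> d1.D" for \<omega>
    using sK[of \<omega>] by (auto simp: z_def y_def K_def)
  have z0: "0 \<le> z \<omega>" and y0: "0 \<le> y \<omega>" for \<omega> using zD(2)[of \<omega>] yD d1.D_nonneg by (auto intro: less_imp_le)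
  have sf: "simple_function P0 s" using s by (simp add: admissible_def)
  have zm: "z \<in> borel_measurable P0" and ym: "y \<in> borel_measurable P0"
    unfolding z_def y_def using integrable_simple_image(1)[OF sf, of fst] integrable_simple_image(1)[OF sf, of snd] by auto
  note i = admissible_integrable[OF s]
  have m': "(\<integral>\<omega>. z \<omega> \<partial>P0) = 1" "(\<integral>\<omega>. z \<omega> * y \<omega> \<partial>P0) = 1"
    using m by (auto simp: mass_def z_def y_def)
  have iz: "integrable P0 z" "integrable P0 (\<lambda>\<omega>. z \<omega> * y \<omega>)" using i by (auto simp: z_def y_def)
  have ip: "integrable P0 (\<lambda>\<omega>. d2.f (z \<omega>))" using i by (auto simp: z_def)
  have iv: "integrable P0 (\<lambda>\<omega>. - X \<omega> * (z \<omega> * y \<omega>) - z \<omega> * d1.f (y \<omega>))" using i(4) by (simp add: z_def y_def)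
  define Q Q' where "Q = density P0 (\<lambda>\<omega>. ennreal (z \<omega>))" and "Q' = density P0 (\<lambda>\<omega>. ennreal (z \<omega> * y \<omega>))"
  note F = feasible_pairI[OF zm z0 iz(1) m'(1) ym y0 iz(2) m'(2) Q_def Q'_def]
  note zy = zm ym z0 y0 Q_def F(3,4)
  have pay: "payoff z y \<omega> = ereal (- X \<omega> * (z \<omega> * y \<omega>) - z \<omega> * d1.f (y \<omega>))" for \<omega>
    using z0[of \<omega>] d1.f_nonneg[of "y \<omega>"]
    by (simp add: payoff_def d1.phi_eq[OF yD] flip: ennreal_mult)
  have val: "val s = (\<integral>\<omega>. - X \<omega> * (z \<omega> * y \<omega>) - z \<omega> * d1.f (y \<omega>) \<partial>P0)"
    and pen: "pen s = (\<integral>\<omega>. d2.f (z \<omega>) \<partial>P0)" by (simp_all add: val_def pen_def z_def y_def)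
  have "phi_div \<phi>2 Q P0 = ennreal (pen s)"
    unfolding phi_div_Q[OF zy] pen d2.phi_eq[OF zD(1)]
    using nn_integral_eq_integral[OF ip] d2.f_nonneg by simp
  moreover have "primal_s \<phi>1 X Q Q' = ereal (val s)"
    unfolding primal_s_eq[OF zy] val using eexpect_real[OF iv] by (simp add: pay[abs_def])
  moreover have "primal_l P0 \<phi>1 \<phi>2 X Q Q' = ereal (val s - pen s)"
  proof -
    have "payoff z y \<omega> - enn2ereal (\<phi>2 (z \<omega>)) = ereal ((- X \<omega> * (z \<omega> * y \<omega>) - z \<omega> * d1.f (y \<omega>)) - d2.f (z \<omega>))" for \<omega>
      unfolding pay d2.phi_eq[OF zD(1)] using d2.f_nonneg by simp
    then show ?thesis
      unfolding primal_l_eq[OF zy] val pen using eexpect_real[OF Bochner_Integration.integrable_diff[OF iv ip]] iv ip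
      by simp
  qed
  ultimately show ?thesis using that F(1,2) by blast
qed

text \<open>This is the choice Q = Q' = P0; it keeps the primal suprema above -\<infinity>.\<close>

lemma admissible_one: "admissible (\<lambda>_. (1, 1))" "mass (\<lambda>_. (1, 1)) = (1, 1)" "pen (\<lambda>_. (1, 1)) = 0"
  using d1.one_D d2.one_D by (auto simp: admissible_def K_def mass_def pen_def prob_space)

section \<open>Attainment and the dual representations\<close>

lemma rho_l_upper:
  "rho_l P0 \<phi>1 \<phi>2 X \<le> dual_l P0 \<phi>1 \<phi>2 X \<theta>"
  unfolding rho_l_def by (cases \<theta>) (auto intro!: SUP_least weak_duality_l)

lemma rho_l_lower:
  assumes "admissible s" "mass s = (1, 1)"
  shows "ereal (val s - pen s) \<le> rho_l P0 \<phi>1 \<phi>2 X"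
proof -
  obtain Q Q' where "Q \<in> feasible_l P0" "Q' \<in> feasible_l Q" "primal_l P0 \<phi>1 \<phi>2 X Q Q' = ereal (val s - pen s)"
    using admissible_primal[OF assms] by metis
  then show ?thesis unfolding rho_l_def by (auto intro!: SUP_upper2)
qed

lemma rho_s_upper:
  "0 < r \<Longrightarrow> 0 \<le> lam \<Longrightarrow> rho_s P0 \<phi>1 \<phi>2 r X \<le> dual_s_closed P0 \<phi>1 \<phi>2 r X (\<theta>, lam)"
  unfolding rho_s_def by (cases \<theta>) (auto intro!: SUP_least weak_duality_s)

lemma rho_s_lower:
  assumes "admissible s" "mass s = (1, 1)" "pen s \<le> r"
  shows "ereal (val s) \<le> rho_s P0 \<phi>1 \<phi>2 r X"
proof -
  obtain Q Q' where Q: "Q \<in> feasible_l P0" "Q' \<in> feasible_l Q" "primal_s \<phi>1 X Q Q' = ereal (val s)"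
    "phi_div \<phi>2 Q P0 = ennreal (pen s)"
    using admissible_primal[OF assms(1,2)] by metis
  then have "Q \<in> feasible_s P0 \<phi>2 r"
    using assms(3) by (auto simp: feasible_s_def feasible_l_def intro: ennreal_leI)
  then show ?thesis using Q unfolding rho_s_def by (auto intro!: SUP_upper2)
qed

text \<open>A finite primal value serves as the bound \<open>V\<close> in strong duality. If the
  value is \<infinity>, weak duality makes every multiplier optimal, and -\<infinity> is excluded by
  \<open>admissible_one\<close>.\<close>

lemma dual_l_attained: "\<exists>\<theta>. dual_l P0 \<phi>1 \<phi>2 X \<theta> = rho_l P0 \<phi>1 \<phi>2 X"
proof (cases "rho_l P0 \<phi>1 \<phi>2 X")
  case (real V)
  have "val s - pen s \<le> V" if "admissible s" "mass s = (1, 1)" for s using rho_l_lower[OF that] real by simp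
  from strong_duality_l[OF this] obtain \<theta>1 \<theta>2 where
    "ereal (- \<theta>1 - \<theta>2) + eexpect P0 (\<lambda>\<omega>. B 1 (X \<omega>) \<theta>1 \<theta>2) \<le> ereal V" by blast
  then have "dual_l P0 \<phi>1 \<phi>2 X (\<theta>1, \<theta>2) \<le> rho_l P0 \<phi>1 \<phi>2 X" by (simp add: dual_l_eq real)
  then show ?thesis using rho_l_upper antisym by blast
next
  case PInf
  then show ?thesis using rho_l_upper by (metis ereal_infty_less_eq(1))
next
  case MInf
  then show ?thesis using rho_l_lower[OF admissible_one(1,2)] by simp
qed

lemma dual_s_closed_attained:
  assumes r: "0 < r"
  shows "\<exists>\<theta> lam. 0 \<le> lam \<and> dual_s_closed P0 \<phi>1 \<phi>2 r X (\<theta>, lam) = rho_s P0 \<phi>1 \<phi>2 r X"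
proof (cases "rho_s P0 \<phi>1 \<phi>2 r X")
  case (real V)
  have "val s \<le> V" if "admissible s" "mass s = (1, 1)" "pen s \<le> r" for s using rho_s_lower[OF that] real by simp
  from strong_duality_s[OF r this] obtain \<theta>1 \<theta>2 lam where l: "0 \<le> lam"
    "ereal (- \<theta>1 - \<theta>2 + lam * r) + eexpect P0 (\<lambda>\<omega>. B lam (X \<omega>) \<theta>1 \<theta>2) \<le> ereal V" by blast
  then have "dual_s_closed P0 \<phi>1 \<phi>2 r X ((\<theta>1, \<theta>2), lam) \<le> rho_s P0 \<phi>1 \<phi>2 r X"
    by (simp add: dual_s_closed_eq real)
  then show ?thesis using rho_s_upper[OF r l(1)] l(1) antisym by blast
next
  case PInf
  then show ?thesis using rho_s_upper[OF r order_refl] by (metis ereal_infty_less_eq(1) order_refl)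
next
  case MInf
  then show ?thesis using rho_s_lower[OF admissible_one(1,2), of r] admissible_one(3) r by simp
qed

lemma dual_l_INF: "rho_l P0 \<phi>1 \<phi>2 X = (INF \<theta>. dual_l P0 \<phi>1 \<phi>2 X \<theta>)"
proof (rule antisym)
  show "rho_l P0 \<phi>1 \<phi>2 X \<le> (INF \<theta>. dual_l P0 \<phi>1 \<phi>2 X \<theta>)" by (intro INF_greatest rho_l_upper)
  show "(INF \<theta>. dual_l P0 \<phi>1 \<phi>2 X \<theta>) \<le> rho_l P0 \<phi>1 \<phi>2 X" using dual_l_attained by (metis INF_lower UNIV_I)
qed

text \<open>At \<open>lam = 0\<close> the function \<open>dual_s\<close> may exceed \<open>dual_s_closed\<close>. Since \<open>\<phi>2 \<ge> 0\<close>, its values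
  at \<open>(\<theta>, l)\<close> with small \<open>l > 0\<close> exceed \<open>dual_s_closed\<close> at \<open>(\<theta>, 0)\<close> by at most \<open>l r\<close>.\<close>

lemma dual_s_INF:
  assumes r: "0 < r"
  shows "rho_s P0 \<phi>1 \<phi>2 r X = (INF (\<theta>, lam) \<in> UNIV \<times> {0..}. dual_s P0 \<phi>1 \<phi>2 r X (\<theta>, lam))"
proof (rule antisym)
  show "rho_s P0 \<phi>1 \<phi>2 r X \<le> (INF (\<theta>, lam) \<in> UNIV \<times> {0..}. dual_s P0 \<phi>1 \<phi>2 r X (\<theta>, lam))"
  proof (rule INF_greatest)
    fix x :: "(real \<times> real) \<times> real" assume x: "x \<in> UNIV \<times> {0..}"
    obtain \<theta>1 \<theta>2 lam where e: "x = ((\<theta>1, \<theta>2), lam)" by (metis surj_pair)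
    then show "rho_s P0 \<phi>1 \<phi>2 r X \<le> (case x of (\<theta>, lam) \<Rightarrow> dual_s P0 \<phi>1 \<phi>2 r X (\<theta>, lam))"
      using x rho_s_upper[OF r, of lam "(\<theta>1, \<theta>2)"] dual_s_closed_le_dual_s[of lam r \<theta>1 \<theta>2] by auto
  qed
  let ?I = "INF (\<theta>, lam) \<in> UNIV \<times> {0..}. dual_s P0 \<phi>1 \<phi>2 r X (\<theta>, lam)"
  have I: "?I \<le> dual_s P0 \<phi>1 \<phi>2 r X (\<theta>, lam)" if "0 \<le> lam" for \<theta> lam
    by (rule INF_lower2[of "(\<theta>, lam)"]) (use that in auto)
  obtain \<theta>1 \<theta>2 lam where l: "0 \<le> lam" "dual_s_closed P0 \<phi>1 \<phi>2 r X ((\<theta>1, \<theta>2), lam) = rho_s P0 \<phi>1 \<phi>2 r X"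
    using dual_s_closed_attained[OF r] by (metis surj_pair)
  show "?I \<le> rho_s P0 \<phi>1 \<phi>2 r X"
  proof (cases "lam = 0")
    case False
    then show ?thesis using I[of lam "(\<theta>1, \<theta>2)"] l by (simp add: dual_s_closed_eq dual_s_eq)
  next
    case True
    show ?thesis
    proof (rule ereal_le_epsilon2)
      fix e :: real assume e: "0 < e"
      \<comment> \<open>The choice \<open>lam = e / r\<close> makes the extra term
        \<open>lam * r\<close> equal to \<open>e\<close>.\<close>
      have "?I \<le> dual_s P0 \<phi>1 \<phi>2 r X ((\<theta>1, \<theta>2), e / r)" using e r by (intro I) simp
      also have "\<dots> = ereal (- \<theta>1 - \<theta>2 + e) + eexpect P0 (\<lambda>\<omega>. B (e / r) (X \<omega>) \<theta>1 \<theta>2)"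
        using e r by (simp add: dual_s_eq)
      also have "\<dots> \<le> ereal (- \<theta>1 - \<theta>2 + e) + eexpect P0 (\<lambda>\<omega>. B 0 (X \<omega>) \<theta>1 \<theta>2)"
        using e r by (intro add_left_mono eexpect_mono_AE) (simp add: B_antimono)
      also have "\<dots> = rho_s P0 \<phi>1 \<phi>2 r X + ereal e"
        unfolding l(2)[symmetric] True by (simp add: dual_s_closed_eq ac_simps flip: plus_ereal.simps(1))
      finally show "?I \<le> rho_s P0 \<phi>1 \<phi>2 r X + ereal e" .
    qed
  qed
qed

lemma dual_l_arg_min: "\<exists>\<theta>. is_arg_min (dual_l P0 \<phi>1 \<phi>2 X) (\<lambda>_. True) \<theta>"
  using dual_l_attained rho_l_upper by (metis is_arg_min_def not_less)

lemma dual_s_closed_arg_min: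
  assumes r: "0 < r"
  shows "\<exists>\<theta> lam. is_arg_min (dual_s_closed P0 \<phi>1 \<phi>2 r X) (\<lambda>(\<theta>, lam). 0 \<le> lam) (\<theta>, lam)
    \<and> dual_s_closed P0 \<phi>1 \<phi>2 r X (\<theta>, lam) = rho_s P0 \<phi>1 \<phi>2 r X"
proof -
  obtain \<theta> lam where l: "0 \<le> lam" "dual_s_closed P0 \<phi>1 \<phi>2 r X (\<theta>, lam) = rho_s P0 \<phi>1 \<phi>2 r X"
    using dual_s_closed_attained[OF r] by blast
  then have "is_arg_min (dual_s_closed P0 \<phi>1 \<phi>2 r X) (\<lambda>(\<theta>, lam). 0 \<le> lam) (\<theta>, lam)"
    using rho_s_upper[OF r] by (auto simp: is_arg_min_def not_less)
  with l show ?thesis by blast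
qed

text \<open>On such a domain the two dual objectives agree also at \<open>lam = 0\<close>, by
  \<open>beta_s_eq\<close>.\<close>

lemma dual_s_arg_min:
  assumes r: "0 < r" and D: "{0<..} \<subseteq> effdom \<phi>2"
  shows "\<exists>\<theta> lam. is_arg_min (dual_s P0 \<phi>1 \<phi>2 r X) (\<lambda>(\<theta>, lam). 0 \<le> lam) (\<theta>, lam)"
proof -
  have e: "dual_s P0 \<phi>1 \<phi>2 r X (\<theta>, lam) = dual_s_closed P0 \<phi>1 \<phi>2 r X (\<theta>, lam)" if "0 \<le> lam" for \<theta> lam
    by (cases \<theta>) (simp add: dual_s_def dual_s_closed_eq[OF that] beta_s_eq[OF that D])
  obtain \<theta> lam where l: "is_arg_min (dual_s_closed P0 \<phi>1 \<phi>2 r X) (\<lambda>(\<theta>, lam). 0 \<le> lam) (\<theta>, lam)"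
    using dual_s_closed_arg_min[OF r] by blast
  then have "is_arg_min (dual_s P0 \<phi>1 \<phi>2 r X) (\<lambda>(\<theta>, lam). 0 \<le> lam) (\<theta>, lam)"
    by (auto simp: is_arg_min_def e)
  then show ?thesis by blast
qed

end

section \<open>Optimal densities\<close>

locale smooth_oce = oce P0 \<phi>1 \<phi>2 X + d1: smooth_divergence_function \<phi>1 + d2: smooth_divergence_function \<phi>2
  for P0 :: "'a measure" and \<phi>1 \<phi>2 X
begin

text \<open>Represents \<open>beta_s\<close> for \<open>lam > 0\<close>; at \<open>lam = 0\<close>
  the formula degenerates to 0.\<close>

definition b :: "real \<Rightarrow> real \<Rightarrow> real \<Rightarrow> 'a \<Rightarrow> real" where
  "b lam \<theta>1 \<theta>2 \<omega> = lam * d2.c ((d1.c (\<theta>2 - X \<omega>) + \<theta>1) / lam)"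

text \<open>The candidate for dQ/dP0, a maximizer of the outer supremum by
  \<open>fenchel_deriv\<close>; \<open>yopt\<close> is that for dQ'/dQ. By the chain rule the
  partial derivatives in \<theta>1 and \<theta>2 are \<open>zopt\<close> and
  \<open>zopt * yopt\<close>.\<close>

definition zopt :: "real \<Rightarrow> real \<Rightarrow> real \<Rightarrow> 'a \<Rightarrow> real" where
  "zopt lam \<theta>1 \<theta>2 \<omega> = deriv d2.c ((d1.c (\<theta>2 - X \<omega>) + \<theta>1) / lam)"

definition yopt :: "real \<Rightarrow> 'a \<Rightarrow> real" where
  "yopt \<theta>2 \<omega> = deriv d1.c (\<theta>2 - X \<omega>)"

lemma beta_s_b: "0 < lam \<Longrightarrow> beta_s \<phi>1 \<phi>2 X \<omega> ((\<theta>1, \<theta>2), lam) = ereal (b lam \<theta>1 \<theta>2 \<omega>)"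
  by (simp add: beta_s_def conjugate_persp_def conjugate_ext_def d1.conjugate_c d2.conjugate_c b_def)

lemma B_b: "0 < lam \<Longrightarrow> B lam (X \<omega>) \<theta>1 \<theta>2 = ereal (b lam \<theta>1 \<theta>2 \<omega>)"
  using beta_s_b beta_s_pos by metis

lemma beta_l_b: "beta_l \<phi>1 \<phi>2 X \<omega> (\<theta>1, \<theta>2) = ereal (b 1 \<theta>1 \<theta>2 \<omega>)"
  by (simp add: beta_l_eq B_b)

lemma measurable_b [measurable]: "b lam \<theta>1 \<theta>2 \<in> borel_measurable P0"
  unfolding b_def using d1.measurable_c d2.measurable_c by measurable

lemma measurable_zopt [measurable]: "zopt lam \<theta>1 \<theta>2 \<in> borel_measurable P0"
  unfolding zopt_def using d1.measurable_c d2.measurable_deriv_c by measurable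

lemma measurable_yopt [measurable]: "yopt \<theta>2 \<in> borel_measurable P0"
  unfolding yopt_def using d1.measurable_deriv_c by measurable

lemma zopt_D: "zopt lam \<theta>1 \<theta>2 \<omega> \<in> d2.D" and yopt_D: "yopt \<theta>2 \<omega> \<in> d1.D"
  by (simp_all add: zopt_def yopt_def d1.fenchel_deriv d2.fenchel_deriv)

lemma zopt_nonneg: "0 \<le> zopt lam \<theta>1 \<theta>2 \<omega>" and yopt_nonneg: "0 \<le> yopt \<theta>2 \<omega>"
  using zopt_D d2.D_nonneg yopt_D d1.D_nonneg by blast+

text \<open>Fenchel-Young holds with equality at both levels, so the point
  \<open>(zopt, yopt)\<close> attains the supremum of the Lagrangian.\<close>

lemma b_fenchel:
  assumes "0 < lam"
  shows "b lam \<theta>1 \<theta>2 \<omega> = zopt lam \<theta>1 \<theta>2 \<omega> * (\<theta>1 + (\<theta>2 - X \<omega>) * yopt \<theta>2 \<omega> - d1.f (yopt \<theta>2 \<omega>))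
    - lam * d2.f (zopt lam \<theta>1 \<theta>2 \<omega>)"
proof -
  define u where "u = d1.c (\<theta>2 - X \<omega>) + \<theta>1"
  have "lam * d2.c (u / lam) = lam * (u / lam * deriv d2.c (u / lam) - d2.f (deriv d2.c (u / lam)))"
    using d2.fenchel_deriv(2)[of "u / lam"] by simp
  also have "\<dots> = deriv d2.c (u / lam) * u - lam * d2.f (deriv d2.c (u / lam))"
    using assms by (simp add: right_diff_distrib)
  finally have res: "lam * d2.c (u / lam) = deriv d2.c (u / lam) * u - lam * d2.f (deriv d2.c (u / lam))" .
  have u: "\<theta>1 + (\<theta>2 - X \<omega>) * yopt \<theta>2 \<omega> - d1.f (yopt \<theta>2 \<omega>) = u"
    using d1.fenchel_deriv(2)[of "\<theta>2 - X \<omega>"] by (simp add: u_def yopt_def)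
  show ?thesis unfolding u using res by (simp add: b_def zopt_def u_def)
qed

section \<open>Derivatives and convexity in the multipliers\<close>

lemma b_deriv1:
  "0 < lam \<Longrightarrow> ((\<lambda>t. b lam t \<theta>2 \<omega>) has_real_derivative zopt lam \<theta>1 \<theta>2 \<omega>) (at \<theta>1)"
  unfolding b_def zopt_def
  by (auto intro!: derivative_eq_intros DERIV_chain2[of d2.c] d2.c_deriv)

lemma b_deriv2:
  "0 < lam \<Longrightarrow> ((\<lambda>t. b lam \<theta>1 t \<omega>) has_real_derivative zopt lam \<theta>1 \<theta>2 \<omega> * yopt \<theta>2 \<omega>) (at \<theta>2)"
  unfolding b_def zopt_def yopt_def
  by (auto intro!: derivative_eq_intros DERIV_chain2[of d2.c] d2.c_deriv DERIV_chain2[of d1.c] d1.c_deriv)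

text \<open>With v = u / lam the derivative is c(v) - v c'(v), which is -f(c'(v)) by equality in
  Fenchel-Young: the penalty appears as the slope in \<open>lam\<close>.\<close>

lemma b_deriv_lam:
  assumes "0 < lam"
  shows "((\<lambda>l. b l \<theta>1 \<theta>2 \<omega>) has_real_derivative - d2.f (zopt lam \<theta>1 \<theta>2 \<omega>)) (at lam)"
proof -
  define u where "u = d1.c (\<theta>2 - X \<omega>) + \<theta>1"
  have "((\<lambda>l. l * d2.c (u / l)) has_real_derivative
      1 * d2.c (u / lam) + deriv d2.c (u / lam) * (- u / lam\<^sup>2) * lam) (at lam)"
    by (rule DERIV_mult, rule DERIV_ident, rule DERIV_chain2[of d2.c], rule d2.c_deriv)
      (use assms in \<open>auto intro!: derivative_eq_intros simp: power2_eq_square\<close>)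
  moreover have "1 * d2.c (u / lam) + deriv d2.c (u / lam) * (- u / lam\<^sup>2) * lam = - d2.f (deriv d2.c (u / lam))"
    using d2.fenchel_deriv(2)[of "u / lam"] assms by (simp add: power2_eq_square)
  ultimately show ?thesis by (simp add: b_def zopt_def u_def)
qed

lemma b_SUP:
  "0 < lam \<Longrightarrow> ereal (b lam \<theta>1 \<theta>2 \<omega>) = (SUP p\<in>d2.D \<times> d1.D. ereal (psi lam (X \<omega>) \<theta>1 \<theta>2 p))"
  by (simp add: B_def flip: B_b)

text \<open>At a fixed point \<open>(t, y)\<close> the Lagrangian is affine in each multiplier;
  \<open>p\<close> and \<open>q\<close> are its constant term and slope. The next two lemmas do the
  same for \<theta>2 and \<open>lam\<close>.\<close>

lemma convex_b1: "0 < lam \<Longrightarrow> convex S \<Longrightarrow> convex_on S (\<lambda>t. b lam t \<theta>2 \<omega>)"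
  by (rule convex_on_SUP_affine[where I = "d2.D \<times> d1.D"
      and p = "\<lambda>(t, y). t * ((\<theta>2 - X \<omega>) * y - d1.f y) - lam * d2.f t" and q = "\<lambda>(t, y). t"])
    (auto simp: b_SUP psi_def algebra_simps intro!: SUP_cong)

lemma convex_b2: "0 < lam \<Longrightarrow> convex S \<Longrightarrow> convex_on S (\<lambda>t. b lam \<theta>1 t \<omega>)"
  by (rule convex_on_SUP_affine[where I = "d2.D \<times> d1.D"
      and p = "\<lambda>(t, y). t * (\<theta>1 - X \<omega> * y - d1.f y) - lam * d2.f t" and q = "\<lambda>(t, y). t * y"])
    (auto simp: b_SUP psi_def algebra_simps intro!: SUP_cong)

lemma convex_b_lam: "S \<subseteq> {0<..} \<Longrightarrow> convex S \<Longrightarrow> convex_on S (\<lambda>l. b l \<theta>1 \<theta>2 \<omega>)"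
  by (rule convex_on_SUP_affine[where I = "d2.D \<times> d1.D"
      and p = "\<lambda>(t, y). t * (\<theta>1 + (\<theta>2 - X \<omega>) * y - d1.f y)" and q = "\<lambda>(t, y). - d2.f t"])
    (auto simp: b_SUP subset_iff psi_def algebra_simps intro!: SUP_cong)

lemma integrable_b:
  assumes "0 < lam" "eexpect P0 (\<lambda>\<omega>. B lam (X \<omega>) \<theta>1 \<theta>2) < \<infinity>"
  shows "integrable P0 (b lam \<theta>1 \<theta>2)"
  using assms eexpect_B_gt_MInf[of lam \<theta>1 \<theta>2]
  by (intro integrable_of_eexpect_finite) (auto simp: B_b)

lemma eexpect_b: "0 < lam \<Longrightarrow> integrable P0 (b lam \<theta>1 \<theta>2)
  \<Longrightarrow> eexpect P0 (\<lambda>\<omega>. B lam (X \<omega>) \<theta>1 \<theta>2) = ereal (\<integral>\<omega>. b lam \<theta>1 \<theta>2 \<omega> \<partial>P0)"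
  by (simp add: B_b eexpect_real)

text \<open>The equality case of \<open>payoff_le_B\<close>; after integration the first order
  conditions turn the correction terms into constants.\<close>

lemma payoff_opt:
  assumes "0 < lam"
  shows "payoff (zopt lam \<theta>1 \<theta>2) (yopt \<theta>2) \<omega> = ereal (b lam \<theta>1 \<theta>2 \<omega> - \<theta>1 * zopt lam \<theta>1 \<theta>2 \<omega>
    - \<theta>2 * (zopt lam \<theta>1 \<theta>2 \<omega> * yopt \<theta>2 \<omega>) + lam * d2.f (zopt lam \<theta>1 \<theta>2 \<omega>))"
  unfolding b_fenchel[OF assms] payoff_def d1.phi_eq[OF yopt_D]
  using zopt_nonneg d1.f_nonneg by (simp add: algebra_simps flip: ennreal_mult)

lemma finite_l_iff: "(\<theta>1, \<theta>2) \<in> finite_l P0 \<phi>1 \<phi>2 X \<longleftrightarrow> eexpect P0 (\<lambda>\<omega>. B 1 (X \<omega>) \<theta>1 \<theta>2) < \<infinity>"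
  by (simp add: finite_l_def beta_l_eq)

lemma finite_s_iff: "0 < lam \<Longrightarrow> ((\<theta>1, \<theta>2), lam) \<in> finite_s P0 \<phi>1 \<phi>2 X \<longleftrightarrow> eexpect P0 (\<lambda>\<omega>. B lam (X \<omega>) \<theta>1 \<theta>2) < \<infinity>"
  by (simp add: finite_s_def beta_s_pos)

text \<open>The slope 1 passed to \<open>integral_deriv_convex_minimizer\<close> comes from the term
  - \<theta>1 of the dual objective.\<close>

lemma zopt_mass:
  assumes lam: "0 < lam" and e: "0 < e"
    and i: "\<And>t. \<bar>t - \<theta>1\<bar> \<le> e \<Longrightarrow> integrable P0 (b lam t \<theta>2)"
    and m: "\<And>t. \<bar>t - \<theta>1\<bar> \<le> e \<Longrightarrow> (\<integral>\<omega>. b lam \<theta>1 \<theta>2 \<omega> \<partial>P0) - \<theta>1 \<le> (\<integral>\<omega>. b lam t \<theta>2 \<omega> \<partial>P0) - t"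
  shows "integrable P0 (zopt lam \<theta>1 \<theta>2)" "(\<integral>\<omega>. zopt lam \<theta>1 \<theta>2 \<omega> \<partial>P0) = 1"
  using integral_deriv_convex_minimizer[of e \<theta>1 P0 "\<lambda>\<omega> t. b lam t \<theta>2 \<omega>" "zopt lam \<theta>1 \<theta>2" 1,
      OF e i convex_b1[OF lam convex_real_interval(5)] b_deriv1[OF lam]] m by auto

lemma zyopt_mass:
  assumes lam: "0 < lam" and e: "0 < e"
    and i: "\<And>t. \<bar>t - \<theta>2\<bar> \<le> e \<Longrightarrow> integrable P0 (b lam \<theta>1 t)"
    and m: "\<And>t. \<bar>t - \<theta>2\<bar> \<le> e \<Longrightarrow> (\<integral>\<omega>. b lam \<theta>1 \<theta>2 \<omega> \<partial>P0) - \<theta>2 \<le> (\<integral>\<omega>. b lam \<theta>1 t \<omega> \<partial>P0) - t"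
  shows "integrable P0 (\<lambda>\<omega>. zopt lam \<theta>1 \<theta>2 \<omega> * yopt \<theta>2 \<omega>)" "(\<integral>\<omega>. zopt lam \<theta>1 \<theta>2 \<omega> * yopt \<theta>2 \<omega> \<partial>P0) = 1"
  using integral_deriv_convex_minimizer[of e \<theta>2 P0 "\<lambda>\<omega> t. b lam \<theta>1 t \<omega>" "\<lambda>\<omega>. zopt lam \<theta>1 \<theta>2 \<omega> * yopt \<theta>2 \<omega>" 1,
      OF e i convex_b2[OF lam convex_real_interval(5)] b_deriv2[OF lam]] m by auto

text \<open>The slope is \<open>- r\<close>, from the term \<open>lam * r\<close> of the dual
  objective; \<open>e < lam\<close> keeps the interval within the positive numbers, where
  \<open>b\<close> is convex in \<open>lam\<close>.\<close>

lemma zopt_penalty: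
  assumes lam: "0 < lam" and e: "0 < e" "e < lam"
    and i: "\<And>t. \<bar>t - lam\<bar> \<le> e \<Longrightarrow> integrable P0 (b t \<theta>1 \<theta>2)"
    and m: "\<And>t. \<bar>t - lam\<bar> \<le> e \<Longrightarrow> (\<integral>\<omega>. b lam \<theta>1 \<theta>2 \<omega> \<partial>P0) + r * lam \<le> (\<integral>\<omega>. b t \<theta>1 \<theta>2 \<omega> \<partial>P0) + r * t"
  shows "integrable P0 (\<lambda>\<omega>. d2.f (zopt lam \<theta>1 \<theta>2 \<omega>))" "(\<integral>\<omega>. d2.f (zopt lam \<theta>1 \<theta>2 \<omega>) \<partial>P0) = r"
proof -
  have S: "{lam - e..lam + e} \<subseteq> {0<..}" using e by auto
  note * = integral_deriv_convex_minimizer[of e lam P0 "\<lambda>\<omega> t. b t \<theta>1 \<theta>2 \<omega>" "\<lambda>\<omega>. - d2.f (zopt lam \<theta>1 \<theta>2 \<omega>)" "- r",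
      OF e(1) i convex_b_lam[OF S convex_real_interval(5)] b_deriv_lam[OF lam]]
  have m': "(\<integral>\<omega>. b lam \<theta>1 \<theta>2 \<omega> \<partial>P0) - - r * lam \<le> (\<integral>\<omega>. b t \<theta>1 \<theta>2 \<omega> \<partial>P0) - - r * t" if "\<bar>t - lam\<bar> \<le> e" for t
    using m[OF that] by simp
  show "integrable P0 (\<lambda>\<omega>. d2.f (zopt lam \<theta>1 \<theta>2 \<omega>))" using *(1)[OF _ m'] by simp
  show "(\<integral>\<omega>. d2.f (zopt lam \<theta>1 \<theta>2 \<omega>) \<partial>P0) = r" using *(2)[OF _ m'] by simp
qed

section \<open>Optimality of the partial derivatives\<close>

lemma dual_l_b: "integrable P0 (b 1 \<theta>1 \<theta>2) \<Longrightarrow>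
    dual_l P0 \<phi>1 \<phi>2 X (\<theta>1, \<theta>2) = ereal (- \<theta>1 - \<theta>2 + (\<integral>\<omega>. b 1 \<theta>1 \<theta>2 \<omega> \<partial>P0))"
  by (simp add: dual_l_eq eexpect_b)

lemma dual_s_b: "0 < lam \<Longrightarrow> integrable P0 (b lam \<theta>1 \<theta>2) \<Longrightarrow>
    dual_s P0 \<phi>1 \<phi>2 r X ((\<theta>1, \<theta>2), lam) = ereal (- \<theta>1 - \<theta>2 + lam * r + (\<integral>\<omega>. b lam \<theta>1 \<theta>2 \<omega> \<partial>P0))"
  by (simp add: dual_s_eq eexpect_b)

text \<open>The candidate pair is feasible by the first order conditions and its primal value equals
  the minimal dual value, so weak duality makes it optimal.\<close>

lemma optimal_l:
  assumes min: "is_arg_min (dual_l P0 \<phi>1 \<phi>2 X) (\<lambda>_. True) (\<theta>1, \<theta>2)"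
    and int: "(\<theta>1, \<theta>2) \<in> interior (finite_l P0 \<phi>1 \<phi>2 X)"
  shows "\<exists>z z' Q Q'.
     (\<forall>\<omega>\<in>space P0.
        ((\<lambda>t. real_of_ereal (beta_l \<phi>1 \<phi>2 X \<omega> (t, \<theta>2))) has_real_derivative z \<omega>) (at \<theta>1)
      \<and> ((\<lambda>t. real_of_ereal (beta_l \<phi>1 \<phi>2 X \<omega> (\<theta>1, t))) has_real_derivative z' \<omega>) (at \<theta>2))
     \<and> is_density P0 Q z \<and> is_density P0 Q' z'
     \<and> is_arg_max (\<lambda>(Q, Q'). primal_l P0 \<phi>1 \<phi>2 X Q Q')
         (\<lambda>(Q, Q'). Q \<in> feasible_l P0 \<and> Q' \<in> feasible_l Q) (Q, Q')"
proof -
  obtain e where e: "0 < e" "cball (\<theta>1, \<theta>2) e \<subseteq> finite_l P0 \<phi>1 \<phi>2 X"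
    using int by (auto simp: mem_interior_cball)
  \<comment> \<open>Interior membership supplies integrability along both coordinate directions,
    where the first order conditions are taken.\<close>
  have i: "integrable P0 (b 1 s t)" if "(s, t) \<in> cball (\<theta>1, \<theta>2) e" for s t
    using subsetD[OF e(2) that] by (intro integrable_b) (simp_all only: finite_l_iff zero_less_one)
  have i0: "integrable P0 (b 1 \<theta>1 \<theta>2)" using i e(1) by simp
  have i1: "integrable P0 (b 1 t \<theta>2)" if "\<bar>t - \<theta>1\<bar> \<le> e" for t
    using that by (intro i) (simp add: dist_Pair_Pair dist_real_def abs_minus_commute)
  have i2: "integrable P0 (b 1 \<theta>1 t)" if "\<bar>t - \<theta>2\<bar> \<le> e" for t
    using that by (intro i) (simp add: dist_Pair_Pair dist_real_def abs_minus_commute)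
  have m: "dual_l P0 \<phi>1 \<phi>2 X (\<theta>1, \<theta>2) \<le> dual_l P0 \<phi>1 \<phi>2 X (s, t)" for s t
    using min by (auto simp: is_arg_min_def not_less)
  have m1: "(\<integral>\<omega>. b 1 \<theta>1 \<theta>2 \<omega> \<partial>P0) - \<theta>1 \<le> (\<integral>\<omega>. b 1 t \<theta>2 \<omega> \<partial>P0) - t" if "\<bar>t - \<theta>1\<bar> \<le> e" for t
    using m[of t \<theta>2] by (simp add: dual_l_b i0 i1 that)
  have m2: "(\<integral>\<omega>. b 1 \<theta>1 \<theta>2 \<omega> \<partial>P0) - \<theta>2 \<le> (\<integral>\<omega>. b 1 \<theta>1 t \<omega> \<partial>P0) - t" if "\<bar>t - \<theta>2\<bar> \<le> e" for t
    using m[of \<theta>1 t] by (simp add: dual_l_b i0 i2 that)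
  define z y where "z = zopt 1 \<theta>1 \<theta>2" and "y = yopt \<theta>2"
  have z: "integrable P0 z" "(\<integral>\<omega>. z \<omega> \<partial>P0) = 1"
    unfolding z_def
    by (rule zopt_mass[OF zero_less_one e(1) i1 m1]; assumption)+
  have y: "integrable P0 (\<lambda>\<omega>. z \<omega> * y \<omega>)" "(\<integral>\<omega>. z \<omega> * y \<omega> \<partial>P0) = 1"
    unfolding z_def y_def
    by (rule zyopt_mass[OF zero_less_one e(1) i2 m2]; assumption)+
  have zm: "z \<in> borel_measurable P0" "y \<in> borel_measurable P0" and z0: "0 \<le> z \<omega>" "0 \<le> y \<omega>" for \<omega>
    by (simp_all add: z_def y_def zopt_nonneg yopt_nonneg)
  define Q Q' where "Q = density P0 (\<lambda>\<omega>. ennreal (z \<omega>))" and "Q' = density P0 (\<lambda>\<omega>. ennreal (z \<omega> * y \<omega>))"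
  note F = feasible_pairI[OF zm(1) z0(1) z zm(2) z0(2) y Q_def Q'_def]
  have "primal_l P0 \<phi>1 \<phi>2 X Q Q' = eexpect P0 (\<lambda>\<omega>. payoff z y \<omega> - enn2ereal (\<phi>2 (z \<omega>)))"
    by (rule primal_l_eq[OF zm z0 Q_def F(3,4)])
  also have "(\<lambda>\<omega>. payoff z y \<omega> - enn2ereal (\<phi>2 (z \<omega>))) = (\<lambda>\<omega>. ereal (b 1 \<theta>1 \<theta>2 \<omega> - \<theta>1 * z \<omega> - \<theta>2 * (z \<omega> * y \<omega>)))"
    unfolding z_def y_def payoff_opt[OF zero_less_one] d2.phi_eq[OF zopt_D] by (simp add: d2.f_nonneg)
  also have "eexpect P0 \<dots> = ereal (\<integral>\<omega>. b 1 \<theta>1 \<theta>2 \<omega> - \<theta>1 * z \<omega> - \<theta>2 * (z \<omega> * y \<omega>) \<partial>P0)"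
    by (rule eexpect_real) (use i0 z y in simp)
  also have "\<dots> = dual_l P0 \<phi>1 \<phi>2 X (\<theta>1, \<theta>2)"
    using i0 z y by (simp add: dual_l_b)
  finally have opt: "primal_l P0 \<phi>1 \<phi>2 X Q Q' = dual_l P0 \<phi>1 \<phi>2 X (\<theta>1, \<theta>2)" .
  have "is_arg_max (\<lambda>(Q, Q'). primal_l P0 \<phi>1 \<phi>2 X Q Q')
      (\<lambda>(Q, Q'). Q \<in> feasible_l P0 \<and> Q' \<in> feasible_l Q) (Q, Q')"
    using F(1,2) weak_duality_l[of _ _ \<theta>1 \<theta>2] by (auto simp: is_arg_max_def opt not_less)
  moreover have "is_density P0 Q z" "is_density P0 Q' (\<lambda>\<omega>. z \<omega> * y \<omega>)"
    using zm z0 by (auto simp: is_density_def Q_def Q'_def)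
  moreover have "\<forall>\<omega>\<in>space P0.
        ((\<lambda>t. real_of_ereal (beta_l \<phi>1 \<phi>2 X \<omega> (t, \<theta>2))) has_real_derivative z \<omega>) (at \<theta>1)
      \<and> ((\<lambda>t. real_of_ereal (beta_l \<phi>1 \<phi>2 X \<omega> (\<theta>1, t))) has_real_derivative z \<omega> * y \<omega>) (at \<theta>2)"
    unfolding beta_l_b z_def y_def using b_deriv1[of 1] b_deriv2[of 1] by simp
  ultimately show ?thesis
    by - (intro exI[of _ z] exI[of _ "\<lambda>\<omega>. z \<omega> * y \<omega>"] exI[of _ Q] exI[of _ Q'] conjI; assumption)
qed

lemma optimal_s:
  assumes r: "0 < r"
    and min: "is_arg_min (dual_s P0 \<phi>1 \<phi>2 r X) (\<lambda>(\<theta>, lam). 0 \<le> lam) ((\<theta>1, \<theta>2), lam)"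
    and int: "((\<theta>1, \<theta>2), lam) \<in> interior (finite_s P0 \<phi>1 \<phi>2 X)"
  shows "\<exists>z z' Q Q'.
     (\<forall>\<omega>\<in>space P0.
        ((\<lambda>t. real_of_ereal (beta_s \<phi>1 \<phi>2 X \<omega> ((t, \<theta>2), lam))) has_real_derivative z \<omega>) (at \<theta>1)
      \<and> ((\<lambda>t. real_of_ereal (beta_s \<phi>1 \<phi>2 X \<omega> ((\<theta>1, t), lam))) has_real_derivative z' \<omega>) (at \<theta>2))
     \<and> is_density P0 Q z \<and> is_density P0 Q' z'
     \<and> is_arg_max (\<lambda>(Q, Q'). primal_s \<phi>1 X Q Q')
         (\<lambda>(Q, Q'). Q \<in> feasible_s P0 \<phi>2 r \<and> Q' \<in> feasible_l Q) (Q, Q')"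
proof -
  obtain e' where e': "0 < e'" "cball ((\<theta>1, \<theta>2), lam) e' \<subseteq> finite_s P0 \<phi>1 \<phi>2 X"
    using int by (auto simp: mem_interior_cball)
  \<comment> \<open>\<open>finite_s\<close> contains only points with \<open>lam \<ge> 0\<close>, so
    a ball inside it around the minimizer forces \<open>lam \<ge> e'\<close>, hence
    \<open>lam > 0\<close>.\<close>
  have "((\<theta>1, \<theta>2), lam - e') \<in> cball ((\<theta>1, \<theta>2), lam) e'"
    using e'(1) by (simp add: dist_Pair_Pair dist_real_def)
  then have "0 \<le> lam - e'" using e'(2) by (auto simp: finite_s_def)
  then have lam: "0 < lam" and el: "e' \<le> lam" using e'(1) by auto
  \<comment> \<open>Halving makes the radius strictly smaller than \<open>lam\<close>.\<close>
  define e where "e = e' / 2"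
  have e: "0 < e" "e < lam" "cball ((\<theta>1, \<theta>2), lam) e \<subseteq> finite_s P0 \<phi>1 \<phi>2 X"
    using e' el by (auto simp: e_def)
  have i: "integrable P0 (b l s t)" if "((s, t), l) \<in> cball ((\<theta>1, \<theta>2), lam) e" "0 < l" for s t l
    using subsetD[OF e(3) that(1)] that(2) by (intro integrable_b) (simp_all only: finite_s_iff)
  have i0: "integrable P0 (b lam \<theta>1 \<theta>2)" using i e(1) lam by simp
  have i1: "integrable P0 (b lam t \<theta>2)" if "\<bar>t - \<theta>1\<bar> \<le> e" for t
    using that lam by (intro i) (simp_all add: dist_Pair_Pair dist_real_def abs_minus_commute)
  have i2: "integrable P0 (b lam \<theta>1 t)" if "\<bar>t - \<theta>2\<bar> \<le> e" for t
    using that lam by (intro i) (simp_all add: dist_Pair_Pair dist_real_def abs_minus_commute)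
  have pos: "0 < t" if "\<bar>t - lam\<bar> \<le> e" for t using that e(2) by linarith
  have i3: "integrable P0 (b t \<theta>1 \<theta>2)" if "\<bar>t - lam\<bar> \<le> e" for t
    using that pos[OF that] by (intro i) (simp_all add: dist_Pair_Pair dist_real_def abs_minus_commute)
  have m: "dual_s P0 \<phi>1 \<phi>2 r X ((\<theta>1, \<theta>2), lam) \<le> dual_s P0 \<phi>1 \<phi>2 r X ((s, t), l)" if "0 < l" for s t l
    using min that by (auto simp: is_arg_min_def not_less less_imp_le)
  have m1: "(\<integral>\<omega>. b lam \<theta>1 \<theta>2 \<omega> \<partial>P0) - \<theta>1 \<le> (\<integral>\<omega>. b lam t \<theta>2 \<omega> \<partial>P0) - t" if "\<bar>t - \<theta>1\<bar> \<le> e" for t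
    using m[OF lam, of t \<theta>2] by (simp add: dual_s_b i0 i1 lam that)
  have m2: "(\<integral>\<omega>. b lam \<theta>1 \<theta>2 \<omega> \<partial>P0) - \<theta>2 \<le> (\<integral>\<omega>. b lam \<theta>1 t \<omega> \<partial>P0) - t" if "\<bar>t - \<theta>2\<bar> \<le> e" for t
    using m[OF lam, of \<theta>1 t] by (simp add: dual_s_b i0 i2 lam that)
  define z y where "z = zopt lam \<theta>1 \<theta>2" and "y = yopt \<theta>2"
  have z: "integrable P0 z" "(\<integral>\<omega>. z \<omega> \<partial>P0) = 1"
    unfolding z_def
    by (rule zopt_mass[OF lam e(1) i1 m1]; assumption)+
  have y: "integrable P0 (\<lambda>\<omega>. z \<omega> * y \<omega>)" "(\<integral>\<omega>. z \<omega> * y \<omega> \<partial>P0) = 1"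
    unfolding z_def y_def
    by (rule zyopt_mass[OF lam e(1) i2 m2]; assumption)+
  \<comment> \<open>Stationarity in \<open>lam\<close> makes the penalty constraint active. This
    gives feasibility of \<open>Q\<close> and lets \<open>lam\<close> times the penalty match the
    term \<open>lam * r\<close> of the dual value.\<close>
  have m3: "(\<integral>\<omega>. b lam \<theta>1 \<theta>2 \<omega> \<partial>P0) + r * lam \<le> (\<integral>\<omega>. b t \<theta>1 \<theta>2 \<omega> \<partial>P0) + r * t" if "\<bar>t - lam\<bar> \<le> e" for t
    using m[OF pos[OF that], of \<theta>1 \<theta>2] by (simp add: dual_s_b i0 i3 lam that pos algebra_simps)
  have p: "integrable P0 (\<lambda>\<omega>. d2.f (z \<omega>))" "(\<integral>\<omega>. d2.f (z \<omega>) \<partial>P0) = r"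
    unfolding z_def by (rule zopt_penalty[OF lam e(1,2) i3 m3]; assumption)+
  have zm: "z \<in> borel_measurable P0" "y \<in> borel_measurable P0" and z0: "0 \<le> z \<omega>" "0 \<le> y \<omega>" for \<omega>
    by (simp_all add: z_def y_def zopt_nonneg yopt_nonneg)
  define Q Q' where "Q = density P0 (\<lambda>\<omega>. ennreal (z \<omega>))" and "Q' = density P0 (\<lambda>\<omega>. ennreal (z \<omega> * y \<omega>))"
  note F = feasible_pairI[OF zm(1) z0(1) z zm(2) z0(2) y Q_def Q'_def]
  have "phi_div \<phi>2 Q P0 = (\<integral>\<^sup>+\<omega>. ennreal (d2.f (z \<omega>)) \<partial>P0)"
    unfolding phi_div_Q[OF zm z0 Q_def F(3,4)] z_def by (simp only: d2.phi_eq[OF zopt_D])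
  also have "\<dots> = ennreal r" using nn_integral_eq_integral[OF p(1)] p(2) d2.f_nonneg by simp
  finally have Qf: "Q \<in> feasible_s P0 \<phi>2 r" using F(1) by (simp add: feasible_s_def feasible_l_def)
  have "primal_s \<phi>1 X Q Q' = eexpect P0 (payoff z y)"
    by (rule primal_s_eq[OF zm z0 Q_def F(3,4)])
  also have "payoff z y = (\<lambda>\<omega>. ereal (b lam \<theta>1 \<theta>2 \<omega> - \<theta>1 * z \<omega> - \<theta>2 * (z \<omega> * y \<omega>) + lam * d2.f (z \<omega>)))"
    unfolding z_def y_def using payoff_opt[OF lam] by blast
  also have "eexpect P0 \<dots> = ereal (\<integral>\<omega>. b lam \<theta>1 \<theta>2 \<omega> - \<theta>1 * z \<omega> - \<theta>2 * (z \<omega> * y \<omega>) + lam * d2.f (z \<omega>) \<partial>P0)"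
    by (rule eexpect_real) (use i0 z y p in simp)
  also have "\<dots> = dual_s P0 \<phi>1 \<phi>2 r X ((\<theta>1, \<theta>2), lam)"
    using i0 z y p by (simp add: dual_s_b lam)
  finally have opt: "primal_s \<phi>1 X Q Q' = dual_s P0 \<phi>1 \<phi>2 r X ((\<theta>1, \<theta>2), lam)" .
  \<comment> \<open>Weak duality is available for the closed dual objective, which lies below
    \<open>dual_s\<close>.\<close>
  have "primal_s \<phi>1 X R R' \<le> dual_s P0 \<phi>1 \<phi>2 r X ((\<theta>1, \<theta>2), lam)"
    if "R \<in> feasible_s P0 \<phi>2 r" "R' \<in> feasible_l R" for R R'
    using weak_duality_s[OF that less_imp_le[OF lam] r, of \<theta>1 \<theta>2] dual_s_closed_le_dual_s[of lam r \<theta>1 \<theta>2] lam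
    by auto
  then have "is_arg_max (\<lambda>(Q, Q'). primal_s \<phi>1 X Q Q')
      (\<lambda>(Q, Q'). Q \<in> feasible_s P0 \<phi>2 r \<and> Q' \<in> feasible_l Q) (Q, Q')"
    using Qf F(2) by (auto simp: is_arg_max_def opt not_less)
  moreover have "is_density P0 Q z" "is_density P0 Q' (\<lambda>\<omega>. z \<omega> * y \<omega>)"
    using zm z0 by (auto simp: is_density_def Q_def Q'_def)
  moreover have "\<forall>\<omega>\<in>space P0.
        ((\<lambda>t. real_of_ereal (beta_s \<phi>1 \<phi>2 X \<omega> ((t, \<theta>2), lam))) has_real_derivative z \<omega>) (at \<theta>1)
      \<and> ((\<lambda>t. real_of_ereal (beta_s \<phi>1 \<phi>2 X \<omega> ((\<theta>1, t), lam))) has_real_derivative z \<omega> * y \<omega>) (at \<theta>2)"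
    unfolding beta_s_b[OF lam] z_def y_def using b_deriv1[OF lam] b_deriv2[OF lam] by simp
  ultimately show ?thesis
    by - (intro exI[of _ z] exI[of _ "\<lambda>\<omega>. z \<omega> * y \<omega>"] exI[of _ Q] exI[of _ Q'] conjI; assumption)
qed

end

theorem theorem1:
  fixes P0 :: "'a measure" and X :: "'a \<Rightarrow> real"
    and \<phi>1 \<phi>2 :: "real \<Rightarrow> ennreal" and r :: real
  assumes "prob_space P0" and "integrable P0 X"
    and "\<phi>1 \<in> Phi0" and "lower_semicont \<phi>1"
    and "\<phi>2 \<in> Phi0" and "lower_semicont \<phi>2"
    and "r > 0"
  shows "rho_l P0 \<phi>1 \<phi>2 X = (INF \<theta>. dual_l P0 \<phi>1 \<phi>2 X \<theta>)
    \<and> rho_s P0 \<phi>1 \<phi>2 r X = (INF (\<theta>, lam) \<in> UNIV \<times> {0..}. dual_s P0 \<phi>1 \<phi>2 r X (\<theta>, lam))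
    \<and> (conjugate_differentiable \<phi>1 \<and> conjugate_differentiable \<phi>2
        \<and> interior (finite_l P0 \<phi>1 \<phi>2 X) \<noteq> {} \<and> interior (finite_s P0 \<phi>1 \<phi>2 X) \<noteq> {}
       \<longrightarrow>
        (\<exists>\<theta>. is_arg_min (dual_l P0 \<phi>1 \<phi>2 X) (\<lambda>_. True) \<theta>)
        \<and> (\<exists>\<theta> lam. is_arg_min (dual_s_closed P0 \<phi>1 \<phi>2 r X) (\<lambda>(\<theta>, lam). 0 \<le> lam) (\<theta>, lam)
              \<and> dual_s_closed P0 \<phi>1 \<phi>2 r X (\<theta>, lam) = rho_s P0 \<phi>1 \<phi>2 r X)
        \<and> ({0<..} \<subseteq> effdom \<phi>2 \<longrightarrow>
              (\<exists>\<theta> lam. is_arg_min (dual_s P0 \<phi>1 \<phi>2 r X) (\<lambda>(\<theta>, lam). 0 \<le> lam) (\<theta>, lam)))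
        \<and> (\<forall>\<theta>1 \<theta>2. is_arg_min (dual_l P0 \<phi>1 \<phi>2 X) (\<lambda>_. True) (\<theta>1, \<theta>2)
              \<and> (\<theta>1, \<theta>2) \<in> interior (finite_l P0 \<phi>1 \<phi>2 X) \<longrightarrow>
            (\<exists>z z' Q Q'.
               (\<forall>\<omega>\<in>space P0.
                  ((\<lambda>t. real_of_ereal (beta_l \<phi>1 \<phi>2 X \<omega> (t, \<theta>2))) has_real_derivative z \<omega>) (at \<theta>1)
                \<and> ((\<lambda>t. real_of_ereal (beta_l \<phi>1 \<phi>2 X \<omega> (\<theta>1, t))) has_real_derivative z' \<omega>) (at \<theta>2))
               \<and> is_density P0 Q z \<and> is_density P0 Q' z'
               \<and> is_arg_max (\<lambda>(Q, Q'). primal_l P0 \<phi>1 \<phi>2 X Q Q')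
                   (\<lambda>(Q, Q'). Q \<in> feasible_l P0 \<and> Q' \<in> feasible_l Q) (Q, Q')))
        \<and> (\<forall>\<theta>1 \<theta>2 lam. is_arg_min (dual_s P0 \<phi>1 \<phi>2 r X) (\<lambda>(\<theta>, lam). 0 \<le> lam) ((\<theta>1, \<theta>2), lam)
              \<and> ((\<theta>1, \<theta>2), lam) \<in> interior (finite_s P0 \<phi>1 \<phi>2 X) \<longrightarrow>
            (\<exists>z z' Q Q'.
               (\<forall>\<omega>\<in>space P0.
                  ((\<lambda>t. real_of_ereal (beta_s \<phi>1 \<phi>2 X \<omega> ((t, \<theta>2), lam))) has_real_derivative z \<omega>) (at \<theta>1)
                \<and> ((\<lambda>t. real_of_ereal (beta_s \<phi>1 \<phi>2 X \<omega> ((\<theta>1, t), lam))) has_real_derivative z' \<omega>) (at \<theta>2))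
               \<and> is_density P0 Q z \<and> is_density P0 Q' z'
               \<and> is_arg_max (\<lambda>(Q, Q'). primal_s \<phi>1 X Q Q')
                   (\<lambda>(Q, Q'). Q \<in> feasible_s P0 \<phi>2 r \<and> Q' \<in> feasible_l Q) (Q, Q'))))"
proof -
  interpret oce P0 \<phi>1 \<phi>2 X
    using assms by (intro oce.intro oce_axioms.intro divergence_function.intro)
  \<comment> \<open>Differentiability stands inside the implication, so the smooth locale is
    obtained as a conditional fact and not by interpretation.\<close>
  have smooth: "smooth_oce P0 \<phi>1 \<phi>2 X" if "conjugate_differentiable \<phi>1" "conjugate_differentiable \<phi>2"
    using that by (intro smooth_oce.intro smooth_divergence_function.intro
        smooth_divergence_function_axioms.intro oce_axioms d1.divergence_function_axioms d2.divergence_function_axioms)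
  show ?thesis
    by (intro conjI impI allI dual_l_INF dual_s_INF dual_l_arg_min dual_s_closed_arg_min dual_s_arg_min assms(7);
      (elim conjE)?; (rule smooth_oce.optimal_l[OF smooth] smooth_oce.optimal_s[OF smooth assms(7)])?; assumption)
qed

end
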